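(* Over $\mathrm{HA}^\omega+\mathrm{BI}+\mathrm{CONT}$, the dependent implicitly controlled product of selection functions $\mathsf{IPS}$ is $T$-definable from the dependent iterated skewed product (modified bar recursion) $\mathsf{MBR}$; that is, $\mathsf{MBR}\geq_T\mathsf{IPS}$. Here both functionals are considered for sequences over a single fixed type ($X_i=X$ for all $i$), with $R$ discrete.
   Context: Types and systems. Finite types are generated from $\mathbb{B}$ (booleans) and $\mathbb{N}$ by $X\times Y$, $X\to Y$ and $X^*$ (finite sequences); $X^{\mathbb{N}}$ is $\mathbb{N}\to X$. $\mathrm{HA}^\omega$ is Heyting arithmetic in all finite types with fully extensional equality (Troelstra's E-$\mathrm{HA}^\omega$); system $T$ is its quantifier-free fragment (Gödel's primitive recursive functionals). Notation. $*$ is concatenation; $q_x(\alpha)=q(x*\alpha)$; $[\alpha](n)=\langle\alpha(0),\dots,\alpha(n-1)\rangle$. $J_RX=(X\to R)\to X$. $T$-definability. A functional is specified by a defining equation (for each choice of type parameters). $G$ is $T$-definable from $F$ over a theory $\mathcal{S}$ (written $F\ge_T G$) if for each choice of types for $G$ there are a choice of types for $F$ and a term $s$ of system $T$ such that $s(F)$ satisfies the defining equation of $G$, provably in $\mathcal{S}$ together with the defining equation of $F$. $\mathsf{IPS}$ (types $X,R$). For $\varepsilon\colon X^*\to J_RX$, $s\colon X^*$ and $q\colon X^{\mathbb{N}}\to R$, $\mathsf{IPS}_s(\varepsilon)(q)\colon X^{\mathbb{N}}$ is specified by $\mathsf{IPS}_s(\varepsilon)(q)=c*\mathsf{IPS}_{s*c}(\varepsilon)(q_c)$,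 where $c=\varepsilon_s(\lambda x.\,q_x(\mathsf{IPS}_{s*x}(\varepsilon)(q_x)))$. $\mathsf{MBR}$ (types $Y,R$). For $\nu_s\colon(Y\to R)\to Y^{\mathbb{N}}$ ($s\colon Y^*$) and $q\colon Y^{\mathbb{N}}\to R$, $\mathsf{MBR}_s(\nu)(q)\colon Y^{\mathbb{N}}$ is specified by $\mathsf{MBR}_s(\nu)(q)=\nu_s(\lambda y.\,q_y(\mathsf{MBR}_{s*y}(\nu)(q_y)))$. $\mathrm{CONT}$: for discrete $R$, $\forall q^{X^{\mathbb{N}}\to R}\,\forall\alpha\,\exists n\,\forall\beta\,([\alpha](n)=[\beta](n)\to q(\alpha)=q(\beta))$. Discrete and compact types are generated by: compact $::=\mathbb{B}\mid$ compact $\times$ compact $\mid$ discrete $\to$ compact; discrete $::=\mathbb{B}\mid\mathbb{N}\mid$ discrete $\times$ discrete $\mid$ discrete$^*$ $\mid$ compact $\to$ discrete. $\mathrm{BI}$ (relativised bar induction) is the scheme, for arbitrary predicates $S,P$ on finite sequences: if $S(\langle\rangle)$, and for every infinite $\alpha$ with $S([\alpha](n))$ for all $n$ there is $n$ with $P([\alpha](n))$, and for all $s$ with $S(s)$: $\forall x[S(s*x)\to P(s*x)]\to P(s)$; then $P(\langle\rangle)$. *)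

theory Defs
  imports Main
begin

section \<open>Finite types and the terms of system T\<close>

datatype ty =
    Bool
  | Nat
  | Prod ty ty  (infixr "\<times>\<^sub>t" 70)
  | Fun ty ty  (infixr "\<rightarrow>\<^sub>t" 60)
  | Seq ty

abbreviation Inf_seq :: "ty \<Rightarrow> ty" where
  "Inf_seq X \<equiv> Nat \<rightarrow>\<^sub>t X"

inductive compact_ty :: "ty \<Rightarrow> bool" and discrete_ty :: "ty \<Rightarrow> bool" where
  "compact_ty Bool"
| "compact_ty X \<Longrightarrow> compact_ty Y \<Longrightarrow> compact_ty (X \<times>\<^sub>t Y)"
| "discrete_ty X \<Longrightarrow> compact_ty Y \<Longrightarrow> compact_ty (X \<rightarrow>\<^sub>t Y)"
| "discrete_ty Bool"
| "discrete_ty Nat"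
| "discrete_ty X \<Longrightarrow> discrete_ty Y \<Longrightarrow> discrete_ty (X \<times>\<^sub>t Y)"
| "discrete_ty X \<Longrightarrow> discrete_ty (Seq X)"
| "compact_ty X \<Longrightarrow> discrete_ty Y \<Longrightarrow> discrete_ty (X \<rightarrow>\<^sub>t Y)"

datatype const =
    True\<^sub>c | False\<^sub>c | If\<^sub>c ty
  | Zero\<^sub>c | Suc\<^sub>c | Rec\<^sub>c ty
  | Pair\<^sub>c ty ty | Fst\<^sub>c ty ty | Snd\<^sub>c ty ty
  | Nil\<^sub>c ty | Cons\<^sub>c ty | RecSeq\<^sub>c ty ty

primrec const_ty :: "const \<Rightarrow> ty" where
  "const_ty True\<^sub>c = Bool"
| "const_ty False\<^sub>c = Bool"
| "const_ty (If\<^sub>c T) = Bool \<rightarrow>\<^sub>t T \<rightarrow>\<^sub>t T \<rightarrow>\<^sub>t T"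
| "const_ty Zero\<^sub>c = Nat"
| "const_ty Suc\<^sub>c = Nat \<rightarrow>\<^sub>t Nat"
| "const_ty (Rec\<^sub>c T) = T \<rightarrow>\<^sub>t (Nat \<rightarrow>\<^sub>t T \<rightarrow>\<^sub>t T) \<rightarrow>\<^sub>t Nat \<rightarrow>\<^sub>t T"
| "const_ty (Pair\<^sub>c X Y) = X \<rightarrow>\<^sub>t Y \<rightarrow>\<^sub>t X \<times>\<^sub>t Y"
| "const_ty (Fst\<^sub>c X Y) = X \<times>\<^sub>t Y \<rightarrow>\<^sub>t X"
| "const_ty (Snd\<^sub>c X Y) = X \<times>\<^sub>t Y \<rightarrow>\<^sub>t Y"
| "const_ty (Nil\<^sub>c X) = Seq X"
| "const_ty (Cons\<^sub>c X) = X \<rightarrow>\<^sub>t Seq X \<rightarrow>\<^sub>t Seq X"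
| "const_ty (RecSeq\<^sub>c X T) = T \<rightarrow>\<^sub>t (X \<rightarrow>\<^sub>t Seq X \<rightarrow>\<^sub>t T \<rightarrow>\<^sub>t T) \<rightarrow>\<^sub>t Seq X \<rightarrow>\<^sub>t T"

text \<open>Terms and formulas are in locally nameless form: free variables have a name and a type
  (two variables with the same name and different types are different), bound variables are
  de Bruijn indices. A term that is well typed in the empty list of bound-variable types has no
  dangling index, so it can be substituted without capture. The named binders \<open>lam\<close>,
  \<open>all\<close>, \<open>ex\<close> below turn a free variable into a bound one.\<close>

type_synonym name = string

datatype tm =
    Cn const
  | Fv name ty
  | Bv nat
  | App tm tm  (infixl "\<cdot>" 90)
  | Lam ty tm

inductive has_type :: "ty list \<Rightarrow> tm \<Rightarrow> ty \<Rightarrow> bool"  ("_ \<turnstile> _ : _" [51, 51, 51] 50) where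
  ty_Cn: "\<Gamma> \<turnstile> Cn c : const_ty c"
| ty_Fv: "\<Gamma> \<turnstile> Fv x T : T"
| ty_Bv: "i < length \<Gamma> \<Longrightarrow> \<Gamma> \<turnstile> Bv i : \<Gamma> ! i"
| ty_App: "\<Gamma> \<turnstile> t : U \<rightarrow>\<^sub>t T \<Longrightarrow> \<Gamma> \<turnstile> u : U \<Longrightarrow> \<Gamma> \<turnstile> t \<cdot> u : T"
| ty_Lam: "U # \<Gamma> \<turnstile> t : T \<Longrightarrow> \<Gamma> \<turnstile> Lam U t : U \<rightarrow>\<^sub>t T"

primrec fv_tm :: "tm \<Rightarrow> (name \<times> ty) set" where
  "fv_tm (Cn c) = {}"
| "fv_tm (Fv x T) = {(x, T)}"
| "fv_tm (Bv i) = {}"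
| "fv_tm (t \<cdot> u) = fv_tm t \<union> fv_tm u"
| "fv_tm (Lam T t) = fv_tm t"

primrec open_tm :: "nat \<Rightarrow> tm \<Rightarrow> tm \<Rightarrow> tm" where
  "open_tm k s (Cn c) = Cn c"
| "open_tm k s (Fv x T) = Fv x T"
| "open_tm k s (Bv i) = (if i = k then s else Bv i)"
| "open_tm k s (t \<cdot> u) = open_tm k s t \<cdot> open_tm k s u"
| "open_tm k s (Lam T t) = Lam T (open_tm (Suc k) s t)"

primrec close_tm :: "nat \<Rightarrow> name \<Rightarrow> ty \<Rightarrow> tm \<Rightarrow> tm" where
  "close_tm k x T (Cn c) = Cn c"
| "close_tm k x T (Fv y U) = (if y = x \<and> U = T then Bv k else Fv y U)"
| "close_tm k x T (Bv i) = Bv i"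
| "close_tm k x T (t \<cdot> u) = close_tm k x T t \<cdot> close_tm k x T u"
| "close_tm k x T (Lam U t) = Lam U (close_tm (Suc k) x T t)"

primrec subst_tm :: "name \<Rightarrow> ty \<Rightarrow> tm \<Rightarrow> tm \<Rightarrow> tm" where
  "subst_tm x T s (Cn c) = Cn c"
| "subst_tm x T s (Fv y U) = (if y = x \<and> U = T then s else Fv y U)"
| "subst_tm x T s (Bv i) = Bv i"
| "subst_tm x T s (t \<cdot> u) = subst_tm x T s t \<cdot> subst_tm x T s u"
| "subst_tm x T s (Lam U t) = Lam U (subst_tm x T s t)"

abbreviation lam :: "name \<Rightarrow> ty \<Rightarrow> tm \<Rightarrow> tm" where
  "lam x T t \<equiv> Lam T (close_tm 0 x T t)"


section \<open>Formulas\<close>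

datatype fm =
    Eq ty tm tm
  | Fls
  | And fm fm
  | Or fm fm
  | Imp fm fm  (infixr "\<rightarrow>\<^sub>f" 55)
  | All ty fm
  | Ex ty fm

primrec wff :: "ty list \<Rightarrow> fm \<Rightarrow> bool" where
  "wff \<Gamma> (Eq T t u) \<longleftrightarrow> \<Gamma> \<turnstile> t : T \<and> \<Gamma> \<turnstile> u : T"
| "wff \<Gamma> Fls \<longleftrightarrow> True"
| "wff \<Gamma> (And A B) \<longleftrightarrow> wff \<Gamma> A \<and> wff \<Gamma> B"
| "wff \<Gamma> (Or A B) \<longleftrightarrow> wff \<Gamma> A \<and> wff \<Gamma> B"
| "wff \<Gamma> (A \<rightarrow>\<^sub>f B) \<longleftrightarrow> wff \<Gamma> A \<and> wff \<Gamma> B"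
| "wff \<Gamma> (All T A) \<longleftrightarrow> wff (T # \<Gamma>) A"
| "wff \<Gamma> (Ex T A) \<longleftrightarrow> wff (T # \<Gamma>) A"

primrec fv_fm :: "fm \<Rightarrow> (name \<times> ty) set" where
  "fv_fm (Eq T t u) = fv_tm t \<union> fv_tm u"
| "fv_fm Fls = {}"
| "fv_fm (And A B) = fv_fm A \<union> fv_fm B"
| "fv_fm (Or A B) = fv_fm A \<union> fv_fm B"
| "fv_fm (A \<rightarrow>\<^sub>f B) = fv_fm A \<union> fv_fm B"
| "fv_fm (All T A) = fv_fm A"
| "fv_fm (Ex T A) = fv_fm A"

primrec open_fm :: "nat \<Rightarrow> tm \<Rightarrow> fm \<Rightarrow> fm" where
  "open_fm k s (Eq T t u) = Eq T (open_tm k s t) (open_tm k s u)"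
| "open_fm k s Fls = Fls"
| "open_fm k s (And A B) = And (open_fm k s A) (open_fm k s B)"
| "open_fm k s (Or A B) = Or (open_fm k s A) (open_fm k s B)"
| "open_fm k s (A \<rightarrow>\<^sub>f B) = (open_fm k s A \<rightarrow>\<^sub>f open_fm k s B)"
| "open_fm k s (All T A) = All T (open_fm (Suc k) s A)"
| "open_fm k s (Ex T A) = Ex T (open_fm (Suc k) s A)"

primrec close_fm :: "nat \<Rightarrow> name \<Rightarrow> ty \<Rightarrow> fm \<Rightarrow> fm" where
  "close_fm k x T (Eq U t u) = Eq U (close_tm k x T t) (close_tm k x T u)"
| "close_fm k x T Fls = Fls"
| "close_fm k x T (And A B) = And (close_fm k x T A) (close_fm k x T B)"
| "close_fm k x T (Or A B) = Or (close_fm k x T A) (close_fm k x T B)"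
| "close_fm k x T (A \<rightarrow>\<^sub>f B) = (close_fm k x T A \<rightarrow>\<^sub>f close_fm k x T B)"
| "close_fm k x T (All U A) = All U (close_fm (Suc k) x T A)"
| "close_fm k x T (Ex U A) = Ex U (close_fm (Suc k) x T A)"

primrec subst_fm :: "name \<Rightarrow> ty \<Rightarrow> tm \<Rightarrow> fm \<Rightarrow> fm" where
  "subst_fm x T s (Eq U t u) = Eq U (subst_tm x T s t) (subst_tm x T s u)"
| "subst_fm x T s Fls = Fls"
| "subst_fm x T s (And A B) = And (subst_fm x T s A) (subst_fm x T s B)"
| "subst_fm x T s (Or A B) = Or (subst_fm x T s A) (subst_fm x T s B)"
| "subst_fm x T s (A \<rightarrow>\<^sub>f B) = (subst_fm x T s A \<rightarrow>\<^sub>f subst_fm x T s B)"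
| "subst_fm x T s (All U A) = All U (subst_fm x T s A)"
| "subst_fm x T s (Ex U A) = Ex U (subst_fm x T s A)"

abbreviation all :: "name \<Rightarrow> ty \<Rightarrow> fm \<Rightarrow> fm" where
  "all x T A \<equiv> All T (close_fm 0 x T A)"

abbreviation ex :: "name \<Rightarrow> ty \<Rightarrow> fm \<Rightarrow> fm" where
  "ex x T A \<equiv> Ex T (close_fm 0 x T A)"


section \<open>Intuitionistic many-sorted predicate logic with equality\<close>

text \<open>\<open>S\<close> is a set of axioms whose free variables are read as universally quantified
  (so they do not restrict the eigenvariables); \<open>H\<close> is a set of hypotheses.\<close>

inductive provable :: "fm set \<Rightarrow> fm set \<Rightarrow> fm \<Rightarrow> bool"  ("_; _ \<turnstile>\<^sub>i _" [50, 50, 50] 50)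
  for S :: "fm set" where
  Ax: "A \<in> S \<Longrightarrow> wff [] A \<Longrightarrow> S; H \<turnstile>\<^sub>i A"
| Hyp: "A \<in> H \<Longrightarrow> wff [] A \<Longrightarrow> S; H \<turnstile>\<^sub>i A"
| FlsE: "S; H \<turnstile>\<^sub>i Fls \<Longrightarrow> wff [] A \<Longrightarrow> S; H \<turnstile>\<^sub>i A"
| AndI: "S; H \<turnstile>\<^sub>i A \<Longrightarrow> S; H \<turnstile>\<^sub>i B \<Longrightarrow> S; H \<turnstile>\<^sub>i And A B"
| AndE1: "S; H \<turnstile>\<^sub>i And A B \<Longrightarrow> S; H \<turnstile>\<^sub>i A"
| AndE2: "S; H \<turnstile>\<^sub>i And A B \<Longrightarrow> S; H \<turnstile>\<^sub>i B"
| OrI1: "S; H \<turnstile>\<^sub>i A \<Longrightarrow> wff [] B \<Longrightarrow> S; H \<turnstile>\<^sub>i Or A B"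
| OrI2: "S; H \<turnstile>\<^sub>i B \<Longrightarrow> wff [] A \<Longrightarrow> S; H \<turnstile>\<^sub>i Or A B"
| OrE: "S; H \<turnstile>\<^sub>i Or A B \<Longrightarrow> S; insert A H \<turnstile>\<^sub>i C \<Longrightarrow> S; insert B H \<turnstile>\<^sub>i C \<Longrightarrow> S; H \<turnstile>\<^sub>i C"
| ImpI: "S; insert A H \<turnstile>\<^sub>i B \<Longrightarrow> wff [] A \<Longrightarrow> S; H \<turnstile>\<^sub>i A \<rightarrow>\<^sub>f B"
| ImpE: "S; H \<turnstile>\<^sub>i A \<rightarrow>\<^sub>f B \<Longrightarrow> S; H \<turnstile>\<^sub>i A \<Longrightarrow> S; H \<turnstile>\<^sub>i B"
| AllI: "S; H \<turnstile>\<^sub>i A \<Longrightarrow> \<forall>B\<in>H. (x, T) \<notin> fv_fm B \<Longrightarrow> S; H \<turnstile>\<^sub>i all x T A"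
| AllE: "S; H \<turnstile>\<^sub>i All T A \<Longrightarrow> [] \<turnstile> t : T \<Longrightarrow> S; H \<turnstile>\<^sub>i open_fm 0 t A"
| ExI: "S; H \<turnstile>\<^sub>i open_fm 0 t A \<Longrightarrow> [] \<turnstile> t : T \<Longrightarrow> wff [T] A \<Longrightarrow> S; H \<turnstile>\<^sub>i Ex T A"
| ExE: "S; H \<turnstile>\<^sub>i ex x T A \<Longrightarrow> S; insert A H \<turnstile>\<^sub>i C \<Longrightarrow>
    \<forall>B\<in>insert C H. (x, T) \<notin> fv_fm B \<Longrightarrow> S; H \<turnstile>\<^sub>i C"
| Refl: "[] \<turnstile> t : T \<Longrightarrow> S; H \<turnstile>\<^sub>i Eq T t t"
| Repl: "S; H \<turnstile>\<^sub>i Eq T t u \<Longrightarrow> wff [T] A \<Longrightarrow> S; H \<turnstile>\<^sub>i open_fm 0 t A \<Longrightarrow> S; H \<turnstile>\<^sub>i open_fm 0 u A"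


section \<open>The theory E-HA in all finite types, bar induction and continuity\<close>

text \<open>The rule \<open>Ax\<close> above only admits the well-formed members of an axiom set, which imposes the
  typing side conditions left out below. The eta rule and the compatibility of equality with abstraction follow
  from \<open>ext\<close> and \<open>beta\<close>.\<close>

inductive_set HA_omega :: "fm set" where
  beta: "Eq T (Lam U t \<cdot> u) (open_tm 0 u t) \<in> HA_omega"
| ext: "All U (Eq T (f \<cdot> Bv 0) (g \<cdot> Bv 0)) \<rightarrow>\<^sub>f Eq (U \<rightarrow>\<^sub>t T) f g \<in> HA_omega"
| if_True: "Eq T (Cn (If\<^sub>c T) \<cdot> Cn True\<^sub>c \<cdot> t \<cdot> u) t \<in> HA_omega"
| if_False: "Eq T (Cn (If\<^sub>c T) \<cdot> Cn False\<^sub>c \<cdot> t \<cdot> u) u \<in> HA_omega"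
| bool_cases: "subst_fm x Bool (Cn True\<^sub>c) A \<rightarrow>\<^sub>f subst_fm x Bool (Cn False\<^sub>c) A \<rightarrow>\<^sub>f all x Bool A
    \<in> HA_omega"
| Suc_not_Zero: "Eq Nat (Cn Suc\<^sub>c \<cdot> t) (Cn Zero\<^sub>c) \<rightarrow>\<^sub>f Fls \<in> HA_omega"
| Suc_inject: "Eq Nat (Cn Suc\<^sub>c \<cdot> t) (Cn Suc\<^sub>c \<cdot> u) \<rightarrow>\<^sub>f Eq Nat t u \<in> HA_omega"
| rec_Zero: "Eq T (Cn (Rec\<^sub>c T) \<cdot> a \<cdot> f \<cdot> Cn Zero\<^sub>c) a \<in> HA_omega"
| rec_Suc: "Eq T (Cn (Rec\<^sub>c T) \<cdot> a \<cdot> f \<cdot> (Cn Suc\<^sub>c \<cdot> n)) (f \<cdot> n \<cdot> (Cn (Rec\<^sub>c T) \<cdot> a \<cdot> f \<cdot> n)) \<in> HA_omega"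
| nat_induct: "subst_fm x Nat (Cn Zero\<^sub>c) A \<rightarrow>\<^sub>f
    all x Nat (A \<rightarrow>\<^sub>f subst_fm x Nat (Cn Suc\<^sub>c \<cdot> Fv x Nat) A) \<rightarrow>\<^sub>f all x Nat A \<in> HA_omega"
| fst_pair: "Eq X (Cn (Fst\<^sub>c X Y) \<cdot> (Cn (Pair\<^sub>c X Y) \<cdot> t \<cdot> u)) t \<in> HA_omega"
| snd_pair: "Eq Y (Cn (Snd\<^sub>c X Y) \<cdot> (Cn (Pair\<^sub>c X Y) \<cdot> t \<cdot> u)) u \<in> HA_omega"
| pair_eta: "Eq (X \<times>\<^sub>t Y) (Cn (Pair\<^sub>c X Y) \<cdot> (Cn (Fst\<^sub>c X Y) \<cdot> t) \<cdot> (Cn (Snd\<^sub>c X Y) \<cdot> t)) t \<in> HA_omega"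
| recseq_Nil: "Eq T (Cn (RecSeq\<^sub>c X T) \<cdot> a \<cdot> f \<cdot> Cn (Nil\<^sub>c X)) a \<in> HA_omega"
| recseq_Cons: "Eq T (Cn (RecSeq\<^sub>c X T) \<cdot> a \<cdot> f \<cdot> (Cn (Cons\<^sub>c X) \<cdot> t \<cdot> l))
    (f \<cdot> t \<cdot> l \<cdot> (Cn (RecSeq\<^sub>c X T) \<cdot> a \<cdot> f \<cdot> l)) \<in> HA_omega"
| seq_induct: "(y, X) \<notin> fv_fm A \<Longrightarrow> subst_fm x (Seq X) (Cn (Nil\<^sub>c X)) A \<rightarrow>\<^sub>f
    all y X (all x (Seq X) (A \<rightarrow>\<^sub>f subst_fm x (Seq X) (Cn (Cons\<^sub>c X) \<cdot> Fv y X \<cdot> Fv x (Seq X)) A)) \<rightarrow>\<^sub>f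
    all x (Seq X) A \<in> HA_omega"

text \<open>The sequence operations \<open>s * x\<close>, \<open>x * \<alpha>\<close> (\<open>x\<close> a single element), \<open>[\<alpha>](n)\<close> and
  \<open>q\<^sub>x\<close> are application of the following closed terms.\<close>

definition snoc_tm :: "ty \<Rightarrow> tm" where
  "snoc_tm X = lam ''s'' (Seq X) (lam ''x'' X
     (Cn (RecSeq\<^sub>c X (Seq X))
       \<cdot> (Cn (Cons\<^sub>c X) \<cdot> Fv ''x'' X \<cdot> Cn (Nil\<^sub>c X))
       \<cdot> lam ''y'' X (lam ''t'' (Seq X) (lam ''r'' (Seq X) (Cn (Cons\<^sub>c X) \<cdot> Fv ''y'' X \<cdot> Fv ''r'' (Seq X))))
       \<cdot> Fv ''s'' (Seq X)))"

definition prefix_tm :: "ty \<Rightarrow> tm" where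
  "prefix_tm X = lam ''x'' X (lam ''a'' (Inf_seq X)
     (Cn (Rec\<^sub>c X) \<cdot> Fv ''x'' X
       \<cdot> lam ''n'' Nat (lam ''r'' X (Fv ''a'' (Inf_seq X) \<cdot> Fv ''n'' Nat))))"

definition initial_tm :: "ty \<Rightarrow> tm" where
  "initial_tm X = lam ''a'' (Inf_seq X)
     (Cn (Rec\<^sub>c (Seq X)) \<cdot> Cn (Nil\<^sub>c X)
       \<cdot> lam ''n'' Nat (lam ''r'' (Seq X)
           (snoc_tm X \<cdot> Fv ''r'' (Seq X) \<cdot> (Fv ''a'' (Inf_seq X) \<cdot> Fv ''n'' Nat))))"

definition shift_tm :: "ty \<Rightarrow> ty \<Rightarrow> tm" where
  "shift_tm X R = lam ''q'' (Inf_seq X \<rightarrow>\<^sub>t R) (lam ''x'' X (lam ''a'' (Inf_seq X)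
     (Fv ''q'' (Inf_seq X \<rightarrow>\<^sub>t R) \<cdot> (prefix_tm X \<cdot> Fv ''x'' X \<cdot> Fv ''a'' (Inf_seq X)))))"

text \<open>Bar induction for sequences over \<open>X\<close>: the predicates \<open>S\<close>, \<open>P\<close> are given by arbitrary
  formulas (possibly with parameters) in which the variable \<open>s\<close> of type \<open>Seq X\<close> stands for the
  argument. The freshness conditions prevent capture of parameters; the
  variables bound together, \<open>s\<close>, \<open>a\<close>, \<open>n\<close> and \<open>s\<close>, \<open>x\<close>, have pairwise different types, so they are
  distinct whatever their names.\<close>

definition BI_fm :: "ty \<Rightarrow> name \<Rightarrow> name \<Rightarrow> name \<Rightarrow> name \<Rightarrow> fm \<Rightarrow> fm \<Rightarrow> fm" where
  "BI_fm X s a n x S P =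
    (let at = (\<lambda>A t. subst_fm s (Seq X) t A);
         initial = initial_tm X \<cdot> Fv a (Inf_seq X) \<cdot> Fv n Nat;
         extended = snoc_tm X \<cdot> Fv s (Seq X) \<cdot> Fv x X
     in at S (Cn (Nil\<^sub>c X)) \<rightarrow>\<^sub>f
        all a (Inf_seq X) (all n Nat (at S initial) \<rightarrow>\<^sub>f ex n Nat (at P initial)) \<rightarrow>\<^sub>f
        all s (Seq X) (S \<rightarrow>\<^sub>f all x X (at S extended \<rightarrow>\<^sub>f at P extended) \<rightarrow>\<^sub>f P) \<rightarrow>\<^sub>f
        at P (Cn (Nil\<^sub>c X)))"

definition BI :: "fm set" where
  "BI = {BI_fm X s a n x S P | X s a n x S P.
     {(a, Inf_seq X), (n, Nat), (x, X)} \<inter> (fv_fm S \<union> fv_fm P) = {}}"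

definition CONT_fm :: "ty \<Rightarrow> ty \<Rightarrow> fm" where
  "CONT_fm X R =
    (let q = Fv ''q'' (Inf_seq X \<rightarrow>\<^sub>t R); a = Fv ''a'' (Inf_seq X); b = Fv ''b'' (Inf_seq X);
         n = Fv ''n'' Nat
     in all ''q'' (Inf_seq X \<rightarrow>\<^sub>t R) (all ''a'' (Inf_seq X) (ex ''n'' Nat (all ''b'' (Inf_seq X)
          (Eq (Seq X) (initial_tm X \<cdot> a \<cdot> n) (initial_tm X \<cdot> b \<cdot> n) \<rightarrow>\<^sub>f Eq R (q \<cdot> a) (q \<cdot> b))))))"

definition CONT :: "fm set" where
  "CONT = {CONT_fm X R | X R. discrete_ty R}"


section \<open>Functionals specified by equations, and T-definability\<close>

text \<open>\<open>spec X R\<close> is the defining equation for the type parameters \<open>X\<close>, \<open>R\<close>; in it the free variable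
  \<open>''F''\<close> of type \<open>ftype X R\<close> stands for the functional. \<open>admissible\<close> is the restriction on the choice of
  parameters. In \<open>T_definable\<close> the functional \<open>F\<close> is likewise a free variable, and its defining
  equation is a hypothesis, so it is fixed throughout the derivation; every term of the language is
  a term of system T.\<close>

record functional =
  admissible :: "ty \<Rightarrow> ty \<Rightarrow> bool"
  ftype :: "ty \<Rightarrow> ty \<Rightarrow> ty"
  spec :: "ty \<Rightarrow> ty \<Rightarrow> fm"

definition T_definable :: "functional \<Rightarrow> fm set \<Rightarrow> functional \<Rightarrow> bool"
    ("_ \<ge>\<^sub>T[_] _" [51, 0, 51] 50) where
  "F \<ge>\<^sub>T[S] G \<longleftrightarrow>
    (\<forall>X R. admissible G X R \<longrightarrow>
      (\<exists>Y Q t. admissible F Y Q \<and>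
        [] \<turnstile> t : ftype F Y Q \<rightarrow>\<^sub>t ftype G X R \<and> fv_tm t = {} \<and>
        S; {spec F Y Q} \<turnstile>\<^sub>i
          subst_fm ''F'' (ftype G X R) (t \<cdot> Fv ''F'' (ftype F Y Q)) (spec G X R)))"

definition IPS_ty :: "ty \<Rightarrow> ty \<Rightarrow> ty" where
  "IPS_ty X R = Seq X \<rightarrow>\<^sub>t (Seq X \<rightarrow>\<^sub>t (X \<rightarrow>\<^sub>t R) \<rightarrow>\<^sub>t X) \<rightarrow>\<^sub>t (Inf_seq X \<rightarrow>\<^sub>t R) \<rightarrow>\<^sub>t Inf_seq X"

definition IPS_spec :: "ty \<Rightarrow> ty \<Rightarrow> fm" where
  "IPS_spec X R =
    (let Te = Seq X \<rightarrow>\<^sub>t (X \<rightarrow>\<^sub>t R) \<rightarrow>\<^sub>t X; Tq = Inf_seq X \<rightarrow>\<^sub>t R;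
         F = Fv ''F'' (IPS_ty X R); s = Fv ''s'' (Seq X); e = Fv ''e'' Te; q = Fv ''q'' Tq;
         x = Fv ''x'' X;
         q_at = (\<lambda>u. shift_tm X R \<cdot> q \<cdot> u);
         next = (\<lambda>u. F \<cdot> (snoc_tm X \<cdot> s \<cdot> u) \<cdot> e \<cdot> q_at u);
         c = e \<cdot> s \<cdot> lam ''x'' X (q_at x \<cdot> next x)
     in all ''s'' (Seq X) (all ''e'' Te (all ''q'' Tq
          (Eq (Inf_seq X) (F \<cdot> s \<cdot> e \<cdot> q) (prefix_tm X \<cdot> c \<cdot> next c)))))"

definition IPS :: functional where
  "IPS = \<lparr>admissible = (\<lambda>X R. discrete_ty R), ftype = IPS_ty, spec = IPS_spec\<rparr>"

definition MBR_ty :: "ty \<Rightarrow> ty \<Rightarrow> ty" where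
  "MBR_ty Y R = Seq Y \<rightarrow>\<^sub>t (Seq Y \<rightarrow>\<^sub>t (Y \<rightarrow>\<^sub>t R) \<rightarrow>\<^sub>t Inf_seq Y) \<rightarrow>\<^sub>t (Inf_seq Y \<rightarrow>\<^sub>t R) \<rightarrow>\<^sub>t Inf_seq Y"

definition MBR_spec :: "ty \<Rightarrow> ty \<Rightarrow> fm" where
  "MBR_spec Y R =
    (let Tv = Seq Y \<rightarrow>\<^sub>t (Y \<rightarrow>\<^sub>t R) \<rightarrow>\<^sub>t Inf_seq Y; Tq = Inf_seq Y \<rightarrow>\<^sub>t R;
         F = Fv ''F'' (MBR_ty Y R); s = Fv ''s'' (Seq Y); v = Fv ''v'' Tv; q = Fv ''q'' Tq;
         y = Fv ''y'' Y;
         q_y = shift_tm Y R \<cdot> q \<cdot> y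
     in all ''s'' (Seq Y) (all ''v'' Tv (all ''q'' Tq
          (Eq (Inf_seq Y) (F \<cdot> s \<cdot> v \<cdot> q)
             (v \<cdot> s \<cdot> lam ''y'' Y (q_y \<cdot> (F \<cdot> (snoc_tm Y \<cdot> s \<cdot> y) \<cdot> v \<cdot> q_y)))))))"

definition MBR :: functional where
  "MBR = \<lparr>admissible = (\<lambda>Y R. discrete_ty R), ftype = MBR_ty, spec = MBR_spec\<rparr>"

end

theory Submission
  imports Defs
begin

text \<open>
  Let \<open>Y\<close> consist of entries \<open>(s, l, x)\<close>, read as nonempty sequences \<open>l * x\<close>, and let \<open>q'\<close> be \<open>q\<close> composed
  with the flattening \<open>Y\<^sup>\<nat> \<rightarrow> X\<^sup>\<nat>\<close>. The outcome function \<open>p(y) = q'\<^sub>y(MBR\<^sub>y(q'\<^sub>y))\<close>, defined on entries,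
  already contains the values from which all later moves are computed: with \<open>c = \<epsilon>\<^sub>s(\<lambda>x. p(s*x, \<langle>\<rangle>, x))\<close> the
  move after \<open>c\<close> is found in the same way from \<open>s * c\<close> and \<open>p\<^sup>c(s', l, x) = p(s', c * l, x)\<close>. Hence a single
  \<open>\<nu>\<close> can produce the whole sequence of \<open>IPS\<close> from \<open>p\<close> by primitive recursion. The equation of \<open>IPS\<close> follows once
  \<open>MBR\<close> is known to depend on the past entries only through the position that they reach. By \<open>CONT\<close> this holds
  when the past determines the value of \<open>q'\<close>, and \<open>BI\<close> carries it back to the empty sequence.

  Object-level reasoning takes place in the model of terms modulo provable equality. It is extensional and has
  \<open>\<beta>\<close>-conversion, and each instance of induction becomes the uniqueness of a recursion, so that nearly all
  derivations are equational.
\<close>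

section \<open>Typing and provability\<close>

text \<open>Why entries: the control of \<open>MBR\<close> receives outcomes for single elements of
  \<open>Y\<close> only. With \<open>Y = X\<close> they determine the first move, while later moves
  require outcomes of longer continuations. An entry packs a whole finite continuation into one
  element of \<open>Y\<close>. Its separate last letter keeps it nonempty, so flattening is total.

  The obstacle: \<open>IPS\<close> at \<open>s\<close> is obtained by starting \<open>MBR\<close>
  with the empty history and handing \<open>s\<close> to the control, but unfolding
  \<open>MBR\<close> leads to longer histories instead of new starts. Outcomes in \<open>R\<close>
  are compared here, not infinite sequences: once \<open>q'\<close> has become constant, outcomes
  agree trivially, while nothing is known about the sequences. Equality of sequences is recovered at
  the end, because the control is then applied to equal outcome functions. Start positions and
  histories are arguments inside the type of the compared values, so one equation covers all of them
  and bar induction runs over \<open>q'\<close> alone.\<close>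

primrec cod :: "ty \<Rightarrow> ty" where
  "cod (U \<rightarrow>\<^sub>t T) = T"
| "cod Bool = Bool" | "cod Nat = Nat" | "cod (X \<times>\<^sub>t Y) = Bool" | "cod (Seq X) = Bool"

primrec takes :: "ty \<Rightarrow> ty \<Rightarrow> bool" where
  "takes (U \<rightarrow>\<^sub>t T) V \<longleftrightarrow> U = V"
| "takes Bool V \<longleftrightarrow> False" | "takes Nat V \<longleftrightarrow> False" | "takes (X \<times>\<^sub>t Y) V \<longleftrightarrow> False"
| "takes (Seq X) V \<longleftrightarrow> False"

lemma takes_iff: "takes T U \<longleftrightarrow> T = U \<rightarrow>\<^sub>t cod T"
  by (cases T) auto

text \<open>Types are unique, so typing can be computed and typing judgements become rewriting
  problems. The \<open>Bool\<close> that \<open>cod\<close> gives outside function types is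
  arbitrary; \<open>takes\<close> guards it in \<open>wt\<close>.\<close>

primrec tyof :: "ty list \<Rightarrow> tm \<Rightarrow> ty" where
  "tyof \<Gamma> (Cn c) = const_ty c"
| "tyof \<Gamma> (Fv x T) = T"
| "tyof \<Gamma> (Bv i) = \<Gamma> ! i"
| "tyof \<Gamma> (t \<cdot> u) = cod (tyof \<Gamma> t)"
| "tyof \<Gamma> (Lam U t) = U \<rightarrow>\<^sub>t tyof (U # \<Gamma>) t"

primrec wt :: "ty list \<Rightarrow> tm \<Rightarrow> bool" where
  "wt \<Gamma> (Cn c) \<longleftrightarrow> True"
| "wt \<Gamma> (Fv x T) \<longleftrightarrow> True"
| "wt \<Gamma> (Bv i) \<longleftrightarrow> i < length \<Gamma>"
| "wt \<Gamma> (t \<cdot> u) \<longleftrightarrow> wt \<Gamma> t \<and> wt \<Gamma> u \<and> takes (tyof \<Gamma> t) (tyof \<Gamma> u)"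
| "wt \<Gamma> (Lam U t) \<longleftrightarrow> wt (U # \<Gamma>) t"

lemma has_type_iff: "\<Gamma> \<turnstile> t : T \<longleftrightarrow> wt \<Gamma> t \<and> tyof \<Gamma> t = T"
proof
  show "\<Gamma> \<turnstile> t : T \<Longrightarrow> wt \<Gamma> t \<and> tyof \<Gamma> t = T"
    by (induction rule: has_type.induct) auto
  have "wt \<Gamma> t \<Longrightarrow> \<Gamma> \<turnstile> t : tyof \<Gamma> t"
  proof (induction t arbitrary: \<Gamma>)
    case (App t u)
    then show ?case by (metis takes_iff tyof.simps(4) ty_App wt.simps(4))
  qed (auto intro: has_type.intros)
  then show "wt \<Gamma> t \<and> tyof \<Gamma> t = T \<Longrightarrow> \<Gamma> \<turnstile> t : T" by auto
qed

text \<open>A whole environment is substituted at once, so that nested beta steps can be computed by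
  extending the environment.\<close>

primrec inst :: "nat \<Rightarrow> tm list \<Rightarrow> tm \<Rightarrow> tm" where
  "inst k \<sigma> (Cn c) = Cn c"
| "inst k \<sigma> (Fv x T) = Fv x T"
| "inst k \<sigma> (Bv i) = (if k \<le> i \<and> i - k < length \<sigma> then \<sigma> ! (i - k) else Bv i)"
| "inst k \<sigma> (t \<cdot> u) = inst k \<sigma> t \<cdot> inst k \<sigma> u"
| "inst k \<sigma> (Lam U t) = Lam U (inst (Suc k) \<sigma> t)"

lemma open_tm_eq_inst: "open_tm k u t = inst k [u] t"
  by (induction t arbitrary: k) auto

lemma wt_append: "wt \<Gamma> t \<Longrightarrow> wt (\<Gamma> @ \<Delta>) t \<and> tyof (\<Gamma> @ \<Delta>) t = tyof \<Gamma> t"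
proof (induction t arbitrary: \<Gamma>)
  case (Lam U t)
  from Lam.IH[of "U # \<Gamma>"] Lam.prems show ?case by simp
qed (auto simp: nth_append)

lemma inst_ident: "wt \<Gamma> t \<Longrightarrow> length \<Gamma> \<le> k \<Longrightarrow> inst k \<sigma> t = t"
  by (induction t arbitrary: \<Gamma> k) fastforce+

abbreviation closed_wt :: "tm \<Rightarrow> bool" where "closed_wt \<equiv> wt []"

lemma wt_closed [simp]: "closed_wt t \<Longrightarrow> wt \<Gamma> t"
  using wt_append[of "[]" t \<Gamma>] by simp

lemma tyof_closed: "closed_wt t \<Longrightarrow> tyof \<Gamma> t = tyof [] t"
  using wt_append[of "[]" t \<Gamma>] by simp

lemma inst_closed [simp]: "closed_wt t \<Longrightarrow> inst k \<sigma> t = t"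
  using inst_ident[of "[]" t k \<sigma>] by simp

lemma open_closed [simp]: "closed_wt t \<Longrightarrow> open_tm k u t = t"
  by (simp add: open_tm_eq_inst)

lemma wt_inst:
  assumes "list_all closed_wt \<sigma>"
  shows "wt (\<Gamma> @ map (tyof []) \<sigma>) t \<Longrightarrow>
    wt \<Gamma> (inst (length \<Gamma>) \<sigma> t) \<and> tyof \<Gamma> (inst (length \<Gamma>) \<sigma> t) = tyof (\<Gamma> @ map (tyof []) \<sigma>) t"
proof (induction t arbitrary: \<Gamma>)
  case (Bv i)
  then show ?case using assms
    by (auto simp: nth_append list_all_length tyof_closed[of _ \<Gamma>])
next
  case (Lam U t)
  from Lam.IH[of "U # \<Gamma>"] Lam.prems show ?case by simp
qed auto

text \<open>The terms of \<open>\<sigma>\<close> have no dangling index, so opening cannot disturb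
  them. This turns a beta step into an extension of the environment.\<close>

lemma inst_Cons:
  assumes "list_all closed_wt \<sigma>"
  shows "inst k (u # \<sigma>) t = open_tm k u (inst (Suc k) \<sigma> t)"
proof (induction t arbitrary: k)
  case (Bv i)
  show ?case
  proof (cases "i \<le> k")
    case False
    then obtain j where "i = Suc (k + j)" by (metis less_imp_Suc_add not_le)
    then show ?thesis using assms by (simp add: list_all_length)
  qed auto
qed auto

lemma wff_open:
  "wff (\<Gamma> @ [T]) A \<Longrightarrow> closed_wt u \<Longrightarrow> tyof [] u = T \<Longrightarrow> wff \<Gamma> (open_fm (length \<Gamma>) u A)"
proof (induction A arbitrary: \<Gamma>)
  case (Eq U t s)
  then show ?case using wt_inst[of "[u]" \<Gamma>] by (auto simp: has_type_iff open_tm_eq_inst)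
next
  case (All V A)
  from All.IH[of "V # \<Gamma>"] All.prems show ?case by simp
next
  case (Ex V A)
  from Ex.IH[of "V # \<Gamma>"] Ex.prems show ?case by simp
qed auto

lemma wt_close:
  "wt \<Gamma> t \<Longrightarrow> wt (\<Gamma> @ [T]) (close_tm (length \<Gamma>) x T t) \<and>
    tyof (\<Gamma> @ [T]) (close_tm (length \<Gamma>) x T t) = tyof \<Gamma> t"
proof (induction t arbitrary: \<Gamma>)
  case (Lam U t)
  from Lam.IH[of "U # \<Gamma>"] Lam.prems show ?case by simp
qed (auto simp: nth_append)

lemma wff_close: "wff \<Gamma> A \<Longrightarrow> wff (\<Gamma> @ [T]) (close_fm (length \<Gamma>) x T A)"
proof (induction A arbitrary: \<Gamma>)
  case (All V A)
  from All.IH[of "V # \<Gamma>"] All.prems show ?case by simp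
next
  case (Ex V A)
  from Ex.IH[of "V # \<Gamma>"] Ex.prems show ?case by simp
qed (auto simp: has_type_iff wt_close)

lemma provable_wff: "S; H \<turnstile>\<^sub>i A \<Longrightarrow> wff [] A"
proof (induction rule: provable.induct)
  case (AllI H A x T)
  then show ?case using wff_close[of "[]" A T x] by simp
next
  case (AllE H T A t)
  then show ?case using wff_open[of "[]" T A t] by (simp add: has_type_iff)
next
  case (Repl H T t u A)
  then show ?case using wff_open[of "[]" T A u] by (simp add: has_type_iff)
qed auto

lemma finite_fv_tm [simp]: "finite (fv_tm t)" by (induction t) auto
lemma finite_fv_fm [simp]: "finite (fv_fm A)" by (induction A) auto

lemma close_fresh_tm [simp]: "(x, T) \<notin> fv_tm t \<Longrightarrow> close_tm k x T t = t"
  by (induction t arbitrary: k) auto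
lemma subst_fresh_tm [simp]: "(x, T) \<notin> fv_tm t \<Longrightarrow> subst_tm x T s t = t"
  by (induction t) auto

lemma close_open_tm: "(x, T) \<notin> fv_tm t \<Longrightarrow> close_tm k x T (open_tm k (Fv x T) t) = t"
  by (induction t arbitrary: k) auto
lemma close_open_fm: "(x, T) \<notin> fv_fm A \<Longrightarrow> close_fm k x T (open_fm k (Fv x T) A) = A"
  by (induction A arbitrary: k) (auto simp: close_open_tm)

section \<open>Quantifier rules through fresh variables\<close>

lemma fresh_name:
  assumes "finite V" shows "\<exists>x :: name. \<forall>T. (x, T) \<notin> V"
proof -
  have "finite (fst ` V)" using assms by simp
  then obtain x where "x \<notin> fst ` V" using ex_new_if_finite infinite_UNIV_listI by metis
  then show ?thesis by force
qed

text \<open>The premise is applied to a variable fresh for \<open>A\<close> and \<open>H\<close>,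
  which exists because \<open>H\<close> is finite. Stating it for all closed terms lets later proofs
  work with anonymous terms.\<close>

lemma provable_AllI:
  assumes "finite H" and "\<And>u. closed_wt u \<Longrightarrow> tyof [] u = T \<Longrightarrow> S; H \<turnstile>\<^sub>i open_fm 0 u A"
  shows "S; H \<turnstile>\<^sub>i All T A"
proof -
  have "finite (fv_fm A \<union> (\<Union>B\<in>H. fv_fm B))" using assms(1) by simp
  from fresh_name[OF this] obtain x where x: "\<And>T. (x, T) \<notin> fv_fm A \<union> (\<Union>B\<in>H. fv_fm B)" by blast
  have "S; H \<turnstile>\<^sub>i all x T (open_fm 0 (Fv x T) A)"
    by (rule provable.AllI, rule assms(2)) (use x in auto)
  then show ?thesis using x by (simp add: close_open_fm)
qed

lemma provable_AllI3:
  assumes "finite H"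
    and "\<And>s t u. closed_wt s \<Longrightarrow> closed_wt t \<Longrightarrow> closed_wt u \<Longrightarrow> tyof [] s = T \<Longrightarrow> tyof [] t = U \<Longrightarrow> tyof [] u = V \<Longrightarrow>
      S; H \<turnstile>\<^sub>i open_fm 0 u (open_fm 1 t (open_fm 2 s A))"
  shows "S; H \<turnstile>\<^sub>i All T (All U (All V A))"
proof (rule provable_AllI[OF assms(1)])
  fix s assume s: "closed_wt s" "tyof [] s = T"
  have "S; H \<turnstile>\<^sub>i All U (All V (open_fm 2 s A))"
  proof (rule provable_AllI[OF assms(1)])
    fix t assume t: "closed_wt t" "tyof [] t = U"
    have "S; H \<turnstile>\<^sub>i All V (open_fm 1 t (open_fm 2 s A))"
      by (rule provable_AllI[OF assms(1)]) (use assms(2) s t in blast)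
    then show "S; H \<turnstile>\<^sub>i open_fm 0 t (All V (open_fm 2 s A))" by simp
  qed
  then show "S; H \<turnstile>\<^sub>i open_fm 0 s (All U (All V A))" by (simp add: numeral_eq_Suc)
qed

lemma provable_AllE3:
  assumes "S; H \<turnstile>\<^sub>i All T (All U (All V A))" "closed_wt s" "closed_wt t" "closed_wt u"
    "tyof [] s = T" "tyof [] t = U" "tyof [] u = V"
  shows "S; H \<turnstile>\<^sub>i open_fm 0 u (open_fm 1 t (open_fm 2 s A))"
proof -
  have "S; H \<turnstile>\<^sub>i All U (All V (open_fm 2 s A))"
    using provable.AllE[OF assms(1), of s] assms by (simp add: has_type_iff numeral_eq_Suc)
  from provable.AllE[OF this, of t] have "S; H \<turnstile>\<^sub>i All V (open_fm 1 t (open_fm 2 s A))"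
    using assms by (simp add: has_type_iff)
  then show ?thesis using provable.AllE[of S H V _ u] assms by (simp add: has_type_iff)
qed

lemma provable_ExE:
  assumes "finite H" and "S; H \<turnstile>\<^sub>i Ex T A"
    and "\<And>u. closed_wt u \<Longrightarrow> tyof [] u = T \<Longrightarrow> S; insert (open_fm 0 u A) H \<turnstile>\<^sub>i C"
  shows "S; H \<turnstile>\<^sub>i C"
proof -
  have "finite (fv_fm A \<union> fv_fm C \<union> (\<Union>B\<in>H. fv_fm B))" using assms(1) by simp
  from fresh_name[OF this] obtain x where x: "\<And>T. (x, T) \<notin> fv_fm A \<union> fv_fm C \<union> (\<Union>B\<in>H. fv_fm B)" by blast
  show ?thesis
  proof (rule provable.ExE[where x=x and T=T and A="open_fm 0 (Fv x T) A"])
    show "S; H \<turnstile>\<^sub>i ex x T (open_fm 0 (Fv x T) A)" using x assms(2) by (simp add: close_open_fm)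
    show "S; insert (open_fm 0 (Fv x T) A) H \<turnstile>\<^sub>i C" by (rule assms(3)) auto
    show "\<forall>B\<in>insert C H. (x, T) \<notin> fv_fm B" using x by auto
  qed
qed

section \<open>Implications and equations derived without weakening\<close>

lemma provable_const_Imp:
  assumes "S; H \<turnstile>\<^sub>i B" "wff [] A" shows "S; H \<turnstile>\<^sub>i A \<rightarrow>\<^sub>f B"
proof -
  \<comment> \<open>What is known in \<open>H\<close> becomes the premise of an implication and is
    detached at the end, so the derivation under additional hypotheses can start from
    \<open>Hyp\<close> alone. Several rules below follow this scheme.\<close>
  have "S; H \<turnstile>\<^sub>i B \<rightarrow>\<^sub>f (A \<rightarrow>\<^sub>f B)"
    by (intro provable.ImpI provable.Hyp) (use assms(2) provable_wff[OF assms(1)] in auto)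
  then show ?thesis using assms(1) by (rule provable.ImpE)
qed

lemma provable_Imp_trans:
  assumes "S; H \<turnstile>\<^sub>i A \<rightarrow>\<^sub>f B" "S; H \<turnstile>\<^sub>i B \<rightarrow>\<^sub>f C" shows "S; H \<turnstile>\<^sub>i A \<rightarrow>\<^sub>f C"
proof -
  have wf: "wff [] A" "wff [] B" "wff [] C" using assms[THEN provable_wff] by auto
  have "S; insert A (insert (B \<rightarrow>\<^sub>f C) (insert (A \<rightarrow>\<^sub>f B) H)) \<turnstile>\<^sub>i C"
    by (rule provable.ImpE[OF _ provable.ImpE, of _ _ B _ A]; rule provable.Hyp) (use wf in auto)
  then have "S; H \<turnstile>\<^sub>i (A \<rightarrow>\<^sub>f B) \<rightarrow>\<^sub>f ((B \<rightarrow>\<^sub>f C) \<rightarrow>\<^sub>f (A \<rightarrow>\<^sub>f C))"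
    using wf by (intro provable.ImpI) auto
  from provable.ImpE[OF provable.ImpE[OF this assms(1)] assms(2)] show ?thesis .
qed

lemma Repl_tm:
  assumes "S; H \<turnstile>\<^sub>i Eq T t u" "wff [T] A" "B = open_fm 0 t A" "C = open_fm 0 u A" "S; H \<turnstile>\<^sub>i B"
  shows "S; H \<turnstile>\<^sub>i C"
  using provable.Repl[OF assms(1,2)] assms(3-5) by simp

lemma provable_sym:
  assumes "S; H \<turnstile>\<^sub>i Eq T t u" shows "S; H \<turnstile>\<^sub>i Eq T u t"
proof -
  have w: "closed_wt t" "closed_wt u" "tyof [] t = T" "tyof [] u = T"
    using provable_wff[OF assms] by (auto simp: has_type_iff)
  show ?thesis
    by (rule Repl_tm[OF assms, of "Eq T (Bv 0) t"])
       (use w in \<open>auto simp: has_type_iff tyof_closed[of t "[T]"] intro!: provable.Refl\<close>)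
qed

lemma provable_trans:
  assumes "S; H \<turnstile>\<^sub>i Eq T t u" "S; H \<turnstile>\<^sub>i Eq T u v" shows "S; H \<turnstile>\<^sub>i Eq T t v"
proof -
  have w: "closed_wt t" "closed_wt u" "tyof [] t = T" "tyof [] u = T"
    using provable_wff[OF assms(1)] by (auto simp: has_type_iff)
  show ?thesis
    by (rule Repl_tm[OF assms(2), of "Eq T t (Bv 0)"])
       (use w assms in \<open>auto simp: has_type_iff tyof_closed[of t "[T]"]\<close>)
qed

lemma provable_cong:
  assumes "S; H \<turnstile>\<^sub>i Eq (U \<rightarrow>\<^sub>t T) t t'" "S; H \<turnstile>\<^sub>i Eq U u u'"
  shows "S; H \<turnstile>\<^sub>i Eq T (t \<cdot> u) (t' \<cdot> u')"
proof -
  have w: "closed_wt t" "closed_wt t'" "tyof [] t = U \<rightarrow>\<^sub>t T" "tyof [] t' = U \<rightarrow>\<^sub>t T"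
    "closed_wt u" "closed_wt u'" "tyof [] u = U" "tyof [] u' = U"
    using assms[THEN provable_wff] by (auto simp: has_type_iff)
  have "S; H \<turnstile>\<^sub>i Eq T (t \<cdot> u) (t' \<cdot> u)"
    by (rule Repl_tm[OF assms(1), of "Eq T (t \<cdot> u) (Bv 0 \<cdot> u)"])
       (use w in \<open>auto simp: has_type_iff tyof_closed[of _ "[_]"] intro!: provable.Refl\<close>)
  then show ?thesis
    by (rule Repl_tm[OF assms(2), of "Eq T (t \<cdot> u) (t' \<cdot> Bv 0)", rotated 3])
       (use w in \<open>auto simp: has_type_iff tyof_closed[of _ "[_]"]\<close>)
qed

text \<open>Deriving the implication in \<open>H\<close> itself avoids weakening, which would require renaming the
  eigenvariables of a derivation.\<close>

lemma provable_Eq_Imp: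
  assumes "S; H \<turnstile>\<^sub>i Eq T (f \<cdot> u) (g \<cdot> u)" "closed_wt f" "closed_wt g"
    "tyof [] f = U \<rightarrow>\<^sub>t T" "tyof [] g = U \<rightarrow>\<^sub>t T" "closed_wt t" "tyof [] t = U"
  shows "S; H \<turnstile>\<^sub>i Eq U t u \<rightarrow>\<^sub>f Eq T (f \<cdot> t) (g \<cdot> t)"
proof -
  let ?A = "Eq T (f \<cdot> u) (g \<cdot> u)" and ?B = "Eq U t u"
  have w: "closed_wt u" "tyof [] u = U" "wff [] ?A"
    using provable_wff[OF assms(1)] assms by (auto simp: has_type_iff)
  have w2: "wff [] ?B" using w assms by (auto simp: has_type_iff)
  let ?H = "insert ?B (insert ?A H)"
  have e: "S; ?H \<turnstile>\<^sub>i Eq U u t"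
    by (rule provable_sym) (use w2 in \<open>auto intro: provable.Hyp\<close>)
  have a: "S; ?H \<turnstile>\<^sub>i ?A" using w by (auto intro: provable.Hyp)
  have "S; ?H \<turnstile>\<^sub>i Eq T (f \<cdot> t) (g \<cdot> t)"
    by (rule Repl_tm[OF e, of "Eq T (f \<cdot> Bv 0) (g \<cdot> Bv 0)", OF _ _ _ a])
       (use assms w in \<open>auto simp: has_type_iff tyof_closed[of _ "[_]"]\<close>)
  then have "S; H \<turnstile>\<^sub>i ?A \<rightarrow>\<^sub>f (?B \<rightarrow>\<^sub>f Eq T (f \<cdot> t) (g \<cdot> t))"
    using w w2 by (intro provable.ImpI) auto
  then show ?thesis using assms(1) by (rule provable.ImpE)
qed

lemma provable_cong_Imp:
  assumes "closed_wt f" "tyof [] f = U \<rightarrow>\<^sub>t T" "closed_wt t" "tyof [] t = U" "closed_wt u" "tyof [] u = U"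
  shows "S; H \<turnstile>\<^sub>i Eq U t u \<rightarrow>\<^sub>f Eq T (f \<cdot> t) (f \<cdot> u)"
  by (rule provable.ImpI, rule provable_cong[OF provable.Refl provable.Hyp])
    (use assms in \<open>auto simp: has_type_iff\<close>)

lemma provable_Imp_Eq_subst:
  assumes "S; H \<turnstile>\<^sub>i A \<rightarrow>\<^sub>f Eq T t u" "S; H \<turnstile>\<^sub>i Eq T t t'" "S; H \<turnstile>\<^sub>i Eq T u u'"
  shows "S; H \<turnstile>\<^sub>i A \<rightarrow>\<^sub>f Eq T t' u'"
proof -
  have wf: "wff [] A" "wff [] (Eq T t t')" "wff [] (Eq T u u')" "wff [] (Eq T t u)"
    using assms[THEN provable_wff] by auto
  let ?H = "insert (Eq T t u) (insert (Eq T t t') (insert (Eq T u u') H))"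
  have "S; ?H \<turnstile>\<^sub>i Eq T t' u'"
    using wf by (intro provable_trans[OF provable_sym[OF provable.Hyp[of "Eq T t t'"]]]
      provable_trans[OF provable.Hyp[of "Eq T t u"] provable.Hyp]) auto
  then have "S; H \<turnstile>\<^sub>i Eq T u u' \<rightarrow>\<^sub>f (Eq T t t' \<rightarrow>\<^sub>f (Eq T t u \<rightarrow>\<^sub>f Eq T t' u'))"
    using wf by (intro provable.ImpI) auto
  from provable.ImpE[OF provable.ImpE[OF this assms(3)] assms(2)]
  have "S; H \<turnstile>\<^sub>i Eq T t u \<rightarrow>\<^sub>f Eq T t' u'" .
  with assms(1) show ?thesis by (rule provable_Imp_trans)
qed

lemma open_wff: "wff \<Gamma> A \<Longrightarrow> length \<Gamma> \<le> k \<Longrightarrow> open_fm k u A = A"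
proof (induction A arbitrary: \<Gamma> k)
  case (Eq T t s)
  then show ?case by (auto simp: has_type_iff open_tm_eq_inst inst_ident)
qed (fastforce)+

text \<open>\<open>ExE\<close> wants a derivation under a larger set of hypotheses, whereas
  \<open>imp\<close> speaks about \<open>H\<close>. The instances of \<open>imp\<close> are gathered
  into one universal implication, which can then serve as a hypothesis.\<close>

lemma provable_ExE_Imp:
  assumes fin: "finite H" and ex: "S; H \<turnstile>\<^sub>i Ex T A" and wf: "wff [T] A" "wff [] B"
    and imp: "\<And>u. closed_wt u \<Longrightarrow> tyof [] u = T \<Longrightarrow> S; H \<turnstile>\<^sub>i open_fm 0 u A \<rightarrow>\<^sub>f B"
  shows "S; H \<turnstile>\<^sub>i B"
proof -
  have wB: "wff [T] B" and oB: "open_fm 0 u B = B" for u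
  proof -
    show "open_fm 0 u B = B" for u using wf(2) by (rule open_wff) simp
    have "wff \<Gamma> B \<Longrightarrow> wff (\<Gamma> @ [T]) B" for \<Gamma>
    proof (induction B arbitrary: \<Gamma>)
      case (All U B) from All.IH[of "U # \<Gamma>"] All.prems show ?case by simp
    next
      case (Ex U B) from Ex.IH[of "U # \<Gamma>"] Ex.prems show ?case by simp
    qed (auto simp: has_type_iff wt_append)
    from this[of "[]"] show "wff [T] B" using wf by simp
  qed
  have all: "S; H \<turnstile>\<^sub>i All T (A \<rightarrow>\<^sub>f B)"
    by (rule provable_AllI[OF fin]) (use imp in \<open>simp add: oB\<close>)
  let ?H = "insert (Ex T A) (insert (All T (A \<rightarrow>\<^sub>f B)) H)"
  have "S; ?H \<turnstile>\<^sub>i B"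
  proof (rule provable_ExE)
    show "S; ?H \<turnstile>\<^sub>i Ex T A" using wf by (auto intro: provable.Hyp)
    fix u assume u: "closed_wt u" "tyof [] u = T"
    have "S; insert (open_fm 0 u A) ?H \<turnstile>\<^sub>i All T (A \<rightarrow>\<^sub>f B)" using wf wB by (auto intro: provable.Hyp)
    from provable.AllE[OF this, of u]
    have "S; insert (open_fm 0 u A) ?H \<turnstile>\<^sub>i open_fm 0 u A \<rightarrow>\<^sub>f B" using u by (simp add: oB has_type_iff)
    moreover have "S; insert (open_fm 0 u A) ?H \<turnstile>\<^sub>i open_fm 0 u A"
      using wff_open[of "[]" T A u] wf u by (auto intro: provable.Hyp)
    ultimately show "S; insert (open_fm 0 u A) ?H \<turnstile>\<^sub>i B" by (rule provable.ImpE)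
  qed (use fin in simp)
  then have "S; H \<turnstile>\<^sub>i All T (A \<rightarrow>\<^sub>f B) \<rightarrow>\<^sub>f (Ex T A \<rightarrow>\<^sub>f B)"
    using wf wB by (auto intro!: provable.ImpI)
  from provable.ImpE[OF provable.ImpE[OF this all] ex] show ?thesis .
qed

section \<open>The term model\<close>

abbreviation theory_ax :: "fm set" where "theory_ax \<equiv> HA_omega \<union> BI \<union> CONT"

text \<open>The hypotheses are a parameter because the same model is also formed over
  \<open>H\<close> with one more assumption. Finiteness provides fresh names.\<close>

locale world =
  fixes H :: "fm set"
  assumes finite_H: "finite H"
begin

abbreviation prov :: "fm \<Rightarrow> bool" where "prov A \<equiv> theory_ax; H \<turnstile>\<^sub>i A"

text \<open>An element of the model is a type with a class of provably equal terms. Free variables of the terms serve as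
  generic elements, hence the extensionality rule \<open>model_ext\<close> below.\<close>

definition cls :: "tm \<Rightarrow> ty \<times> tm set" where
  "cls t = (tyof [] t, {u. prov (Eq (tyof [] t) t u)})"

definition app :: "ty \<times> tm set \<Rightarrow> ty \<times> tm set \<Rightarrow> ty \<times> tm set"  (infixl "\<bullet>" 90) where
  "f \<bullet> a = (cod (fst f), {w. \<exists>t\<in>snd f. \<exists>u\<in>snd a. prov (Eq (cod (fst f)) (t \<cdot> u) w)})"

definition ok :: "ty \<times> tm set \<Rightarrow> bool" where
  "ok a \<longleftrightarrow> (\<exists>t. closed_wt t \<and> a = cls t)"

abbreviation ty_of :: "ty \<times> tm set \<Rightarrow> ty" where "ty_of \<equiv> fst"

lemma ty_cls [simp]: "ty_of (cls t) = tyof [] t"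
  by (simp add: cls_def)

lemma ok_cls [simp]: "closed_wt t \<Longrightarrow> ok (cls t)"
  by (auto simp: ok_def)

lemma okE: assumes "ok a" obtains t where "closed_wt t" "a = cls t"
  using assms by (auto simp: ok_def)

lemma ty_app [simp]: "ty_of (f \<bullet> a) = cod (ty_of f)"
  by (simp add: app_def)

lemma prov_refl: "closed_wt t \<Longrightarrow> prov (Eq (tyof [] t) t t)"
  by (auto intro: provable.Refl simp: has_type_iff)

lemma cls_eqI: "prov (Eq T t u) \<Longrightarrow> cls t = cls u"
proof -
  assume p: "prov (Eq T t u)"
  have "tyof [] t = T" "tyof [] u = T" using provable_wff[OF p] by (auto simp: has_type_iff)
  then show ?thesis
    using provable_trans[OF p] provable_trans[OF provable_sym[OF p]] by (auto simp: cls_def)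
qed

lemma cls_eqD: "cls t = cls u \<Longrightarrow> closed_wt u \<Longrightarrow> tyof [] u = T \<Longrightarrow> prov (Eq T t u)"
  using prov_refl[of u] by (auto simp: cls_def)

lemma cls_app: "closed_wt (t \<cdot> u) \<Longrightarrow> cls (t \<cdot> u) = cls t \<bullet> cls u"
proof -
  assume w: "closed_wt (t \<cdot> u)"
  then have ty: "tyof [] t = tyof [] u \<rightarrow>\<^sub>t cod (tyof [] t)" by (simp add: takes_iff)
  have t: "prov (Eq (tyof [] u \<rightarrow>\<^sub>t cod (tyof [] t)) t t)" and u: "prov (Eq (tyof [] u) u u)"
    using w prov_refl[of t] prov_refl[of u] ty by auto
  have "prov (Eq (cod (tyof [] t)) (t \<cdot> u) w)"
    if "prov (Eq (tyof [] t) t t')" "prov (Eq (tyof [] u) u u')" "prov (Eq (cod (tyof [] t)) (t' \<cdot> u') w)"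
    for t' u' w
    using provable_trans[OF provable_cong that(3)] that(1,2) ty by metis
  then show ?thesis using t u ty by (auto simp: cls_def app_def)
qed

lemma ok_app [simp]: "ok f \<Longrightarrow> ok a \<Longrightarrow> takes (ty_of f) (ty_of a) \<Longrightarrow> ok (f \<bullet> a)"
proof (elim okE)
  fix t u assume "closed_wt t" "closed_wt u" "f = cls t" "a = cls u" "takes (ty_of f) (ty_of a)"
  then show "ok (f \<bullet> a)" using cls_app[of t u] ok_cls[of "t \<cdot> u"] by simp
qed

text \<open>Abstractions are not interpreted as functions: the class of an abstraction is taken
  whole, and is taken apart only after beta reduction.\<close>

primrec den :: "tm list \<Rightarrow> tm \<Rightarrow> ty \<times> tm set" where
  "den \<sigma> (Cn c) = cls (Cn c)"
| "den \<sigma> (Fv x T) = cls (Fv x T)"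
| "den \<sigma> (Bv i) = cls (\<sigma> ! i)"
| "den \<sigma> (t \<cdot> u) = den \<sigma> t \<bullet> den \<sigma> u"
| "den \<sigma> (Lam U t) = cls (inst 0 \<sigma> (Lam U t))"

lemma cls_inst:
  "list_all closed_wt \<sigma> \<Longrightarrow> wt (map (tyof []) \<sigma>) t \<Longrightarrow> cls (inst 0 \<sigma> t) = den \<sigma> t"
proof (induction t)
  case (App t u)
  then have "closed_wt (inst 0 \<sigma> (t \<cdot> u))" using wt_inst[of \<sigma> "[]"] by fastforce
  then show ?case using App cls_app by simp
qed auto

lemma cls_closed: "closed_wt t \<Longrightarrow> cls t = den [] t"
  using cls_inst[of "[]" t] by simp

lemma den_closed: "closed_wt t \<Longrightarrow> den \<sigma> t = cls t"
  by (induction t) (auto simp: cls_app inst_ident[of "[_]"])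

lemma den_Lam:
  assumes "list_all closed_wt \<sigma>" "closed_wt u" "wt (map (tyof []) (u # \<sigma>)) t" "tyof [] u = U"
  shows "den \<sigma> (Lam U t) \<bullet> cls u = den (u # \<sigma>) t"
proof -
  let ?t = "inst (Suc 0) \<sigma> t"
  have t: "wt [U] ?t" using wt_inst[of \<sigma> "[U]" t] assms by simp
  have "closed_wt (Lam U ?t \<cdot> u)" using t assms by simp
  then have "den \<sigma> (Lam U t) \<bullet> cls u = cls (Lam U ?t \<cdot> u)" using cls_app by force
  also have "\<dots> = cls (open_tm 0 u ?t)"
  proof (rule cls_eqI[where T = "tyof [U] ?t"], rule provable.Ax)
    show "Eq (tyof [U] ?t) (Lam U ?t \<cdot> u) (open_tm 0 u ?t) \<in> theory_ax" by (simp add: HA_omega.beta)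
    show "wff [] (Eq (tyof [U] ?t) (Lam U ?t \<cdot> u) (open_tm 0 u ?t))"
      using t assms wt_inst[of "[u]" "[]" ?t] by (simp add: has_type_iff open_tm_eq_inst)
  qed
  also have "\<dots> = den (u # \<sigma>) t"
    using assms by (simp flip: inst_Cons add: cls_inst)
  finally show ?thesis .
qed

lemma model_ext:
  assumes "ok f" "ok g" "ty_of f = U \<rightarrow>\<^sub>t T" "ty_of g = U \<rightarrow>\<^sub>t T"
    and "\<And>a. ok a \<Longrightarrow> ty_of a = U \<Longrightarrow> f \<bullet> a = g \<bullet> a"
  shows "f = g"
proof -
  obtain t u where t: "closed_wt t" "f = cls t" and u: "closed_wt u" "g = cls u"
    using assms(1,2) by (elim okE)
  have ty: "tyof \<Gamma> t = U \<rightarrow>\<^sub>t T" "tyof \<Gamma> u = U \<rightarrow>\<^sub>t T" for \<Gamma>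
    using assms(3,4) t u by (auto simp: tyof_closed[of _ \<Gamma>])
  have "prov (All U (Eq T (t \<cdot> Bv 0) (u \<cdot> Bv 0)))"
  proof (rule provable_AllI[OF finite_H])
    fix v assume v: "closed_wt v" "tyof [] v = U"
    then have "cls (t \<cdot> v) = cls (u \<cdot> v)" using assms(5)[of "cls v"] t u ty by (simp add: cls_app)
    then show "prov (open_fm 0 v (Eq T (t \<cdot> Bv 0) (u \<cdot> Bv 0)))"
      using v t u ty by (auto intro: cls_eqD)
  qed
  moreover have "prov (All U (Eq T (t \<cdot> Bv 0) (u \<cdot> Bv 0)) \<rightarrow>\<^sub>f Eq (U \<rightarrow>\<^sub>t T) t u)"
    using t u ty by (intro provable.Ax) (auto simp: HA_omega.ext has_type_iff)
  ultimately show ?thesis using t u by (metis provable.ImpE cls_eqI)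
qed

section \<open>Axioms of the constants as equations of the model\<close>

lemma ax_eq:
  assumes "Eq T t u \<in> HA_omega" "closed_wt t" "closed_wt u" "tyof [] t = T" "tyof [] u = T"
  shows "cls t = cls u"
  using assms by (intro cls_eqI[of T] provable.Ax) (auto simp: has_type_iff)

abbreviation "zero \<equiv> cls (Cn Zero\<^sub>c)"
abbreviation "suc n \<equiv> cls (Cn Suc\<^sub>c) \<bullet> n"
abbreviation "rec T \<equiv> cls (Cn (Rec\<^sub>c T))"
abbreviation "nil X \<equiv> cls (Cn (Nil\<^sub>c X))"
abbreviation "cons X x l \<equiv> cls (Cn (Cons\<^sub>c X)) \<bullet> x \<bullet> l"
abbreviation "recseq X T \<equiv> cls (Cn (RecSeq\<^sub>c X T))"
abbreviation "pair X Y a b \<equiv> cls (Cn (Pair\<^sub>c X Y)) \<bullet> a \<bullet> b"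
abbreviation "pfst X Y a \<equiv> cls (Cn (Fst\<^sub>c X Y)) \<bullet> a"
abbreviation "psnd X Y a \<equiv> cls (Cn (Snd\<^sub>c X Y)) \<bullet> a"

lemma rec_zero [simp]:
  "ok a \<Longrightarrow> ok f \<Longrightarrow> ty_of a = T \<Longrightarrow> ty_of f = Nat \<rightarrow>\<^sub>t T \<rightarrow>\<^sub>t T \<Longrightarrow> rec T \<bullet> a \<bullet> f \<bullet> zero = a"
  by (elim okE) (use ax_eq[OF HA_omega.rec_Zero] in \<open>force simp: cls_app\<close>)

lemma rec_suc [simp]:
  "ok a \<Longrightarrow> ok f \<Longrightarrow> ok n \<Longrightarrow> ty_of a = T \<Longrightarrow> ty_of f = Nat \<rightarrow>\<^sub>t T \<rightarrow>\<^sub>t T \<Longrightarrow> ty_of n = Nat \<Longrightarrow>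
    rec T \<bullet> a \<bullet> f \<bullet> (suc n) = f \<bullet> n \<bullet> (rec T \<bullet> a \<bullet> f \<bullet> n)"
proof (elim okE)
  fix ta tf tn assume "closed_wt ta" "closed_wt tf" "closed_wt tn" "a = cls ta" "f = cls tf" "n = cls tn"
    "ty_of a = T" "ty_of f = Nat \<rightarrow>\<^sub>t T \<rightarrow>\<^sub>t T" "ty_of n = Nat"
  then show ?thesis using ax_eq[OF HA_omega.rec_Suc[where T=T and a=ta and f=tf and n=tn]] by (simp add: cls_app)
qed

lemma recseq_nil [simp]:
  "ok a \<Longrightarrow> ok f \<Longrightarrow> ty_of a = T \<Longrightarrow> ty_of f = X \<rightarrow>\<^sub>t Seq X \<rightarrow>\<^sub>t T \<rightarrow>\<^sub>t T \<Longrightarrow>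
    recseq X T \<bullet> a \<bullet> f \<bullet> nil X = a"
proof (elim okE)
  fix ta tf assume "closed_wt ta" "closed_wt tf" "a = cls ta" "f = cls tf"
    "ty_of a = T" "ty_of f = X \<rightarrow>\<^sub>t Seq X \<rightarrow>\<^sub>t T \<rightarrow>\<^sub>t T"
  then show ?thesis using ax_eq[OF HA_omega.recseq_Nil[where X=X and T=T and a=ta and f=tf]] by (simp add: cls_app)
qed

lemma recseq_cons [simp]:
  "ok a \<Longrightarrow> ok f \<Longrightarrow> ok x \<Longrightarrow> ok l \<Longrightarrow> ty_of a = T \<Longrightarrow> ty_of f = X \<rightarrow>\<^sub>t Seq X \<rightarrow>\<^sub>t T \<rightarrow>\<^sub>t T \<Longrightarrow>
    ty_of x = X \<Longrightarrow> ty_of l = Seq X \<Longrightarrow>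
    recseq X T \<bullet> a \<bullet> f \<bullet> (cons X x l) = f \<bullet> x \<bullet> l \<bullet> (recseq X T \<bullet> a \<bullet> f \<bullet> l)"
proof (elim okE)
  fix ta tf tx tl assume "closed_wt ta" "closed_wt tf" "closed_wt tx" "closed_wt tl"
    "a = cls ta" "f = cls tf" "x = cls tx" "l = cls tl"
    "ty_of a = T" "ty_of f = X \<rightarrow>\<^sub>t Seq X \<rightarrow>\<^sub>t T \<rightarrow>\<^sub>t T" "ty_of x = X" "ty_of l = Seq X"
  then show ?thesis
    using ax_eq[OF HA_omega.recseq_Cons[where X=X and T=T and a=ta and f=tf and t=tx and l=tl]]
    by (simp add: cls_app)
qed

lemma pfst_pair [simp]:
  "ok a \<Longrightarrow> ok b \<Longrightarrow> ty_of a = X \<Longrightarrow> ty_of b = Y \<Longrightarrow> pfst X Y (pair X Y a b) = a"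
proof (elim okE)
  fix ta tb assume "closed_wt ta" "closed_wt tb" "a = cls ta" "b = cls tb" "ty_of a = X" "ty_of b = Y"
  then show ?thesis using ax_eq[OF HA_omega.fst_pair[where X=X and Y=Y and t=ta and u=tb]] by (simp add: cls_app)
qed

lemma psnd_pair [simp]:
  "ok a \<Longrightarrow> ok b \<Longrightarrow> ty_of a = X \<Longrightarrow> ty_of b = Y \<Longrightarrow> psnd X Y (pair X Y a b) = b"
proof (elim okE)
  fix ta tb assume "closed_wt ta" "closed_wt tb" "a = cls ta" "b = cls tb" "ty_of a = X" "ty_of b = Y"
  then show ?thesis using ax_eq[OF HA_omega.snd_pair[where X=X and Y=Y and t=ta and u=tb]] by (simp add: cls_app)
qed

lemma pair_eta:
  "ok a \<Longrightarrow> ty_of a = X \<times>\<^sub>t Y \<Longrightarrow> pair X Y (pfst X Y a) (psnd X Y a) = a"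
proof (elim okE)
  fix ta assume "closed_wt ta" "a = cls ta" "ty_of a = X \<times>\<^sub>t Y"
  then show ?thesis using ax_eq[OF HA_omega.pair_eta[where X=X and Y=Y and t=ta]] by (simp add: cls_app)
qed

text \<open>Induction for the equation \<open>a \<bullet> n = b \<bullet> n\<close>. Since
  \<open>U\<close> may be a function type, parameters that vary along the recursion can be carried
  inside the values; this replaces induction formulas with quantifiers.\<close>

lemma nat_rec_unique:
  assumes ok: "ok a" "ok b" "ok f"
    and ty: "ty_of a = Nat \<rightarrow>\<^sub>t U" "ty_of b = Nat \<rightarrow>\<^sub>t U" "ty_of f = Nat \<rightarrow>\<^sub>t U \<rightarrow>\<^sub>t U"
    and zero: "a \<bullet> zero = b \<bullet> zero"
    and suc_a: "\<And>n. ok n \<Longrightarrow> ty_of n = Nat \<Longrightarrow> a \<bullet> (suc n) = f \<bullet> n \<bullet> (a \<bullet> n)"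
    and suc_b: "\<And>n. ok n \<Longrightarrow> ty_of n = Nat \<Longrightarrow> b \<bullet> (suc n) = f \<bullet> n \<bullet> (b \<bullet> n)"
  shows "a = b"
proof -
  obtain t u g where t: "closed_wt t" "a = cls t" and u: "closed_wt u" "b = cls u"
    and g: "closed_wt g" "f = cls g"
    using ok by (elim okE)
  have w: "tyof \<Gamma> t = Nat \<rightarrow>\<^sub>t U" "tyof \<Gamma> u = Nat \<rightarrow>\<^sub>t U" "tyof \<Gamma> g = Nat \<rightarrow>\<^sub>t U \<rightarrow>\<^sub>t U" for \<Gamma>
    using ty t u g by (auto simp: tyof_closed[of _ \<Gamma>])
  have "finite (fv_tm t \<union> fv_tm u \<union> (\<Union>B\<in>H. fv_fm B))" using finite_H by simp
  from fresh_name[OF this] obtain x where x: "\<And>T. (x, T) \<notin> fv_tm t" "\<And>T. (x, T) \<notin> fv_tm u"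
    "\<And>B T. B \<in> H \<Longrightarrow> (x, T) \<notin> fv_fm B" by auto
  let ?A = "\<lambda>n. Eq U (t \<cdot> n) (u \<cdot> n)" and ?x = "Fv x Nat"
  have ind: "prov (?A (Cn Zero\<^sub>c) \<rightarrow>\<^sub>f all x Nat (?A ?x \<rightarrow>\<^sub>f ?A (Cn Suc\<^sub>c \<cdot> ?x)) \<rightarrow>\<^sub>f all x Nat (?A ?x))"
  proof (rule provable.Ax)
    show "(?A (Cn Zero\<^sub>c) \<rightarrow>\<^sub>f all x Nat (?A ?x \<rightarrow>\<^sub>f ?A (Cn Suc\<^sub>c \<cdot> ?x)) \<rightarrow>\<^sub>f all x Nat (?A ?x)) \<in> theory_ax"
      using HA_omega.nat_induct[of x "?A ?x"] x by simp
  qed (use x t u w in \<open>simp add: has_type_iff\<close>)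
  have z: "prov (?A (Cn Zero\<^sub>c))"
    using zero t u w by (intro cls_eqD) (auto simp: cls_app)
  \<comment> \<open>Congruence of the step function is itself a provable implication between
    equations, so the induction hypothesis never has to be added to \<open>H\<close>.\<close>
  have "prov (?A ?x \<rightarrow>\<^sub>f Eq U (g \<cdot> ?x \<cdot> (t \<cdot> ?x)) (g \<cdot> ?x \<cdot> (u \<cdot> ?x)))"
    using t u g w by (intro provable_cong_Imp) auto
  then have s: "prov (?A ?x \<rightarrow>\<^sub>f ?A (Cn Suc\<^sub>c \<cdot> ?x))"
    using t u g w suc_a[of "cls ?x"] suc_b[of "cls ?x"]
    by (elim provable_Imp_Eq_subst; intro cls_eqD) (auto simp: cls_app)
  have "prov (all x Nat (?A ?x))"
    by (rule provable.ImpE[OF provable.ImpE[OF ind z] provable.AllI[OF s]]) (use x in auto)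
  then have all: "prov (All Nat (?A (Bv 0)))" using x by simp
  show ?thesis
  proof (rule model_ext[OF ok(1,2) ty(1,2)])
    fix c assume "ok c" "ty_of c = Nat"
    then obtain n where n: "closed_wt n" "c = cls n" "tyof [] n = Nat" by (auto elim: okE)
    have "prov (?A n)"
      using provable.AllE[OF all, of n] n t u by (simp add: has_type_iff)
    from cls_eqI[OF this] show "a \<bullet> c = b \<bullet> c" using n t u w by (simp add: cls_app)
  qed
qed

lemma seq_rec_unique:
  assumes ok: "ok a" "ok b" "ok f"
    and ty: "ty_of a = Seq X \<rightarrow>\<^sub>t U" "ty_of b = Seq X \<rightarrow>\<^sub>t U" "ty_of f = X \<rightarrow>\<^sub>t Seq X \<rightarrow>\<^sub>t U \<rightarrow>\<^sub>t U"
    and nil: "a \<bullet> nil X = b \<bullet> nil X"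
    and cons_a: "\<And>x l. ok x \<Longrightarrow> ok l \<Longrightarrow> ty_of x = X \<Longrightarrow> ty_of l = Seq X \<Longrightarrow>
      a \<bullet> (cons X x l) = f \<bullet> x \<bullet> l \<bullet> (a \<bullet> l)"
    and cons_b: "\<And>x l. ok x \<Longrightarrow> ok l \<Longrightarrow> ty_of x = X \<Longrightarrow> ty_of l = Seq X \<Longrightarrow>
      b \<bullet> (cons X x l) = f \<bullet> x \<bullet> l \<bullet> (b \<bullet> l)"
  shows "a = b"
proof -
  obtain t u g where t: "closed_wt t" "a = cls t" and u: "closed_wt u" "b = cls u"
    and g: "closed_wt g" "f = cls g"
    using ok by (elim okE)
  have w: "tyof \<Gamma> t = Seq X \<rightarrow>\<^sub>t U" "tyof \<Gamma> u = Seq X \<rightarrow>\<^sub>t U"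
    "tyof \<Gamma> g = X \<rightarrow>\<^sub>t Seq X \<rightarrow>\<^sub>t U \<rightarrow>\<^sub>t U" for \<Gamma>
    using ty t u g by (auto simp: tyof_closed[of _ \<Gamma>])
  have "finite (fv_tm t \<union> fv_tm u \<union> (\<Union>B\<in>H. fv_fm B))" using finite_H by simp
  from fresh_name[OF this] obtain x where x: "\<And>T. (x, T) \<notin> fv_tm t" "\<And>T. (x, T) \<notin> fv_tm u"
    "\<And>B T. B \<in> H \<Longrightarrow> (x, T) \<notin> fv_fm B" by auto
  \<comment> \<open>The name \<open>x\<close> serves for both variables of the induction axiom;
    their types keep them apart.\<close>
  have neq: "X \<noteq> Seq X" by (induction X) auto
  let ?A = "\<lambda>n. Eq U (t \<cdot> n) (u \<cdot> n)" and ?x = "Fv x (Seq X)" and ?y = "Fv x X"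
  let ?s = "Cn (Cons\<^sub>c X) \<cdot> ?y \<cdot> ?x"
  have ind: "prov (?A (Cn (Nil\<^sub>c X)) \<rightarrow>\<^sub>f all x X (all x (Seq X) (?A ?x \<rightarrow>\<^sub>f ?A ?s)) \<rightarrow>\<^sub>f all x (Seq X) (?A ?x))"
  proof (rule provable.Ax)
    show "(?A (Cn (Nil\<^sub>c X)) \<rightarrow>\<^sub>f all x X (all x (Seq X) (?A ?x \<rightarrow>\<^sub>f ?A ?s)) \<rightarrow>\<^sub>f all x (Seq X) (?A ?x)) \<in> theory_ax"
      using HA_omega.seq_induct[of x X "?A ?x" x] x neq by simp
  qed (use x t u w neq in \<open>simp add: has_type_iff\<close>)
  have z: "prov (?A (Cn (Nil\<^sub>c X)))"
    using nil t u w by (intro cls_eqD) (auto simp: cls_app)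
  have "prov (?A ?x \<rightarrow>\<^sub>f Eq U (g \<cdot> ?y \<cdot> ?x \<cdot> (t \<cdot> ?x)) (g \<cdot> ?y \<cdot> ?x \<cdot> (u \<cdot> ?x)))"
    using t u g w by (intro provable_cong_Imp) auto
  then have s: "prov (?A ?x \<rightarrow>\<^sub>f ?A ?s)"
    using t u g w cons_a[of "cls ?y" "cls ?x"] cons_b[of "cls ?y" "cls ?x"]
    by (elim provable_Imp_Eq_subst; intro cls_eqD) (auto simp: cls_app)
  have "prov (all x (Seq X) (?A ?x))"
    by (rule provable.ImpE[OF provable.ImpE[OF ind z] provable.AllI[OF provable.AllI[OF s]]])
      (use x in auto)
  then have all: "prov (All (Seq X) (?A (Bv 0)))" using x by simp
  show ?thesis
  proof (rule model_ext[OF ok(1,2) ty(1,2)])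
    fix c assume "ok c" "ty_of c = Seq X"
    then obtain n where n: "closed_wt n" "c = cls n" "tyof [] n = Seq X" by (auto elim: okE)
    have "prov (?A n)"
      using provable.AllE[OF all, of n] n t u by (simp add: has_type_iff)
    from cls_eqI[OF this] show "a \<bullet> c = b \<bullet> c" using n t u w by (simp add: cls_app)
  qed
qed

section \<open>Evaluation of applied terms by rewriting\<close>

definition rep :: "ty \<times> tm set \<Rightarrow> tm" where
  "rep a = (SOME t. closed_wt t \<and> a = cls t)"

lemma rep: assumes "ok a"
  shows rep_closed [simp]: "closed_wt (rep a)" and cls_rep [simp]: "cls (rep a) = a"
    and tyof_rep [simp]: "tyof \<Gamma> (rep a) = ty_of a"
proof -
  have *: "closed_wt (rep a) \<and> a = cls (rep a)"
    using assms unfolding rep_def ok_def by (rule someI_ex)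
  then show "closed_wt (rep a)" "cls (rep a) = a" by auto
  then show "tyof \<Gamma> (rep a) = ty_of a" using * tyof_closed[of "rep a" \<Gamma>] ty_cls by metis
qed

text \<open>Environments consist of terms while arguments are classes, hence the chosen
  representative. An abstraction unfolds only when applied, which lets the simplifier compute the
  defined terms without entering binders.\<close>

lemma beta_den [simp]:
  assumes "list_all closed_wt \<sigma>" "ok a" "ty_of a = U" "wt (map (tyof []) (rep a # \<sigma>)) t"
  shows "den \<sigma> (Lam U t) \<bullet> a = den (rep a # \<sigma>) t"
proof -
  have "den \<sigma> (Lam U t) \<bullet> cls (rep a) = den (rep a # \<sigma>) t"
    using assms by (intro den_Lam) auto
  then show ?thesis using assms by simp
qed

declare den.simps(5) [simp del]

lemma beta_cls [simp]:
  assumes "ok a" "ty_of a = U" "wt [U] t"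
  shows "cls (Lam U t) \<bullet> a = den [rep a] t"
proof -
  have "cls (Lam U t) = den [] (Lam U t)" using assms by (intro cls_closed) simp
  then show ?thesis using assms by (simp del: den.simps)
qed

declare den_closed [simp]

lemma ok_den [simp]: "list_all closed_wt \<sigma> \<Longrightarrow> wt (map (tyof []) \<sigma>) t \<Longrightarrow> ok (den \<sigma> t)"
  using wt_inst[of \<sigma> "[]" t] by (simp flip: cls_inst)

lemma ty_den [simp]:
  "list_all closed_wt \<sigma> \<Longrightarrow> wt (map (tyof []) \<sigma>) t \<Longrightarrow> ty_of (den \<sigma> t) = tyof (map (tyof []) \<sigma>) t"
  using wt_inst[of \<sigma> "[]" t] by (simp flip: cls_inst)

lemma ext_cls:
  "ok f \<Longrightarrow> ok g \<Longrightarrow> ty_of f = ty_of g \<Longrightarrow> takes (ty_of f) U \<Longrightarrow>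
    (\<And>a. ok a \<Longrightarrow> ty_of a = U \<Longrightarrow> f \<bullet> a = g \<bullet> a) \<Longrightarrow> f = g"
  by (metis model_ext takes_iff)

lemma ext_cls2:
  assumes "ok f" "ok g" "ty_of f = U \<rightarrow>\<^sub>t V \<rightarrow>\<^sub>t T" "ty_of g = U \<rightarrow>\<^sub>t V \<rightarrow>\<^sub>t T"
    and "\<And>a b. ok a \<Longrightarrow> ok b \<Longrightarrow> ty_of a = U \<Longrightarrow> ty_of b = V \<Longrightarrow> f \<bullet> a \<bullet> b = g \<bullet> a \<bullet> b"
  shows "f = g"
proof (rule ext_cls[where U = U])
  fix a assume "ok a" "ty_of a = U"
  then show "f \<bullet> a = g \<bullet> a" by - (rule model_ext[of _ _ V T], simp_all add: assms)
qed (simp_all add: assms)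

end

section \<open>Infinite sequences and bar recursion\<close>

lemma prefix_tm_closed [simp]: "closed_wt (prefix_tm X)" "fv_tm (prefix_tm X) = {}"
  "tyof \<Gamma> (prefix_tm X) = X \<rightarrow>\<^sub>t Inf_seq X \<rightarrow>\<^sub>t Inf_seq X"
  by (simp_all add: prefix_tm_def)

lemma snoc_tm_closed [simp]: "closed_wt (snoc_tm X)" "fv_tm (snoc_tm X) = {}"
  "tyof \<Gamma> (snoc_tm X) = Seq X \<rightarrow>\<^sub>t X \<rightarrow>\<^sub>t Seq X"
  by (simp_all add: snoc_tm_def)

lemma initial_tm_closed [simp]: "closed_wt (initial_tm X)" "fv_tm (initial_tm X) = {}"
  "tyof \<Gamma> (initial_tm X) = Inf_seq X \<rightarrow>\<^sub>t Nat \<rightarrow>\<^sub>t Seq X"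
  by (simp_all add: initial_tm_def)

lemma shift_tm_closed [simp]: "closed_wt (shift_tm X R)" "fv_tm (shift_tm X R) = {}"
  "tyof \<Gamma> (shift_tm X R) = (Inf_seq X \<rightarrow>\<^sub>t R) \<rightarrow>\<^sub>t X \<rightarrow>\<^sub>t Inf_seq X \<rightarrow>\<^sub>t R"
  by (simp_all add: shift_tm_def)

definition cat_tm :: "ty \<Rightarrow> tm" where
  "cat_tm X =
    (let l = Fv ''l'' (Seq X); g = Fv ''g'' (Inf_seq X); y = Fv ''y'' X;
         r = Fv ''r'' (Inf_seq X \<rightarrow>\<^sub>t Inf_seq X)
     in lam ''l'' (Seq X) (
       Cn (RecSeq\<^sub>c X (Inf_seq X \<rightarrow>\<^sub>t Inf_seq X)) \<cdot> lam ''g'' (Inf_seq X) (g)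
         \<cdot> lam ''y'' X (lam ''t'' (Seq X) (lam ''r'' (Inf_seq X \<rightarrow>\<^sub>t Inf_seq X)
             (lam ''g'' (Inf_seq X) (prefix_tm X \<cdot> y \<cdot> (r \<cdot> g))))) \<cdot> l))"

lemma cat_tm_closed [simp]: "closed_wt (cat_tm X)" "fv_tm (cat_tm X) = {}"
  "tyof \<Gamma> (cat_tm X) = Seq X \<rightarrow>\<^sub>t Inf_seq X \<rightarrow>\<^sub>t Inf_seq X"
  by (simp_all add: cat_tm_def Let_def)

definition tail_tm :: "ty \<Rightarrow> tm" where
  "tail_tm X =
    (let a = Fv ''a'' (Inf_seq X); n = Fv ''n'' Nat
     in lam ''a'' (Inf_seq X) (lam ''n'' Nat (
       a \<cdot> (Cn Suc\<^sub>c \<cdot> n))))"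

lemma tail_tm_closed [simp]: "closed_wt (tail_tm X)" "fv_tm (tail_tm X) = {}"
  "tyof \<Gamma> (tail_tm X) = Inf_seq X \<rightarrow>\<^sub>t Inf_seq X"
  by (simp_all add: tail_tm_def Let_def)

definition const_tm :: "ty \<Rightarrow> ty \<Rightarrow> tm" where
  "const_tm X R =
    (let r = Fv ''r'' R
     in lam ''r'' R (lam ''a'' (Inf_seq X) (
       r)))"

lemma const_tm_closed [simp]: "closed_wt (const_tm X R)" "fv_tm (const_tm X R) = {}"
  "tyof \<Gamma> (const_tm X R) = R \<rightarrow>\<^sub>t Inf_seq X \<rightarrow>\<^sub>t R"
  by (simp_all add: const_tm_def Let_def)

definition shifts_tm :: "ty \<Rightarrow> ty \<Rightarrow> tm" where
  "shifts_tm X R =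
    (let q = Fv ''q'' (Inf_seq X \<rightarrow>\<^sub>t R); l = Fv ''l'' (Seq X); a = Fv ''a'' (Inf_seq X)
     in lam ''q'' (Inf_seq X \<rightarrow>\<^sub>t R) (lam ''l'' (Seq X) (lam ''a'' (Inf_seq X) (
       q \<cdot> (cat_tm X \<cdot> l \<cdot> a)))))"

lemma shifts_tm_closed [simp]: "closed_wt (shifts_tm X R)" "fv_tm (shifts_tm X R) = {}"
  "tyof \<Gamma> (shifts_tm X R) = (Inf_seq X \<rightarrow>\<^sub>t R) \<rightarrow>\<^sub>t Seq X \<rightarrow>\<^sub>t Inf_seq X \<rightarrow>\<^sub>t R"
  by (simp_all add: shifts_tm_def Let_def)

text \<open>The values of \<open>G\<close> at the restrictions \<open>q\<^sub>x\<close>, from which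
  a bar recursion computes its value at \<open>q\<close>.\<close>

definition after_tm :: "ty \<Rightarrow> ty \<Rightarrow> ty \<Rightarrow> tm" where
  "after_tm X R U =
    (let G = Fv ''G'' ((Inf_seq X \<rightarrow>\<^sub>t R) \<rightarrow>\<^sub>t U);
         q = Fv ''q'' (Inf_seq X \<rightarrow>\<^sub>t R); x = Fv ''x'' X
     in lam ''G'' ((Inf_seq X \<rightarrow>\<^sub>t R) \<rightarrow>\<^sub>t U) (lam ''q'' (Inf_seq X \<rightarrow>\<^sub>t R) (lam ''x'' X (
       G \<cdot> (shift_tm X R \<cdot> q \<cdot> x)))))"

lemma after_tm_closed [simp]: "closed_wt (after_tm X R U)" "fv_tm (after_tm X R U) = {}"
  "tyof \<Gamma> (after_tm X R U) = ((Inf_seq X \<rightarrow>\<^sub>t R) \<rightarrow>\<^sub>t U) \<rightarrow>\<^sub>t (Inf_seq X \<rightarrow>\<^sub>t R) \<rightarrow>\<^sub>t X \<rightarrow>\<^sub>t U"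
  by (simp_all add: after_tm_def Let_def)

context world begin

lemma prefix_zero [simp]:
  "ok x \<Longrightarrow> ok a \<Longrightarrow> ty_of x = X \<Longrightarrow> ty_of a = Inf_seq X \<Longrightarrow> cls (prefix_tm X) \<bullet> x \<bullet> a \<bullet> zero = x"
  by (simp add: prefix_tm_def)

lemma prefix_suc [simp]:
  "ok x \<Longrightarrow> ok a \<Longrightarrow> ok n \<Longrightarrow> ty_of x = X \<Longrightarrow> ty_of a = Inf_seq X \<Longrightarrow> ty_of n = Nat \<Longrightarrow>
    cls (prefix_tm X) \<bullet> x \<bullet> a \<bullet> (suc n) = a \<bullet> n"
  by (simp add: prefix_tm_def)

lemma snoc_nil [simp]:
  "ok x \<Longrightarrow> ty_of x = X \<Longrightarrow> cls (snoc_tm X) \<bullet> nil X \<bullet> x = cons X x (nil X)"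
  by (simp add: snoc_tm_def)

lemma snoc_cons [simp]:
  "ok x \<Longrightarrow> ok y \<Longrightarrow> ok l \<Longrightarrow> ty_of x = X \<Longrightarrow> ty_of y = X \<Longrightarrow> ty_of l = Seq X \<Longrightarrow>
    cls (snoc_tm X) \<bullet> (cons X y l) \<bullet> x = cons X y (cls (snoc_tm X) \<bullet> l \<bullet> x)"
  by (simp add: snoc_tm_def)

lemma initial_zero [simp]:
  "ok a \<Longrightarrow> ty_of a = Inf_seq X \<Longrightarrow> cls (initial_tm X) \<bullet> a \<bullet> zero = nil X"
  by (simp add: initial_tm_def)

lemma initial_suc:
  "ok a \<Longrightarrow> ok n \<Longrightarrow> ty_of a = Inf_seq X \<Longrightarrow> ty_of n = Nat \<Longrightarrow>
    cls (initial_tm X) \<bullet> a \<bullet> (suc n) = cls (snoc_tm X) \<bullet> (cls (initial_tm X) \<bullet> a \<bullet> n) \<bullet> (a \<bullet> n)"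
  by (simp add: initial_tm_def)

lemma shift_app [simp]:
  "ok q \<Longrightarrow> ok x \<Longrightarrow> ok a \<Longrightarrow> ty_of q = Inf_seq X \<rightarrow>\<^sub>t R \<Longrightarrow> ty_of x = X \<Longrightarrow> ty_of a = Inf_seq X \<Longrightarrow>
    cls (shift_tm X R) \<bullet> q \<bullet> x \<bullet> a = q \<bullet> (cls (prefix_tm X) \<bullet> x \<bullet> a)"
  by (simp add: shift_tm_def)

lemma cat_nil [simp]:
  "ok a \<Longrightarrow> ty_of a = Inf_seq X \<Longrightarrow> cls (cat_tm X) \<bullet> nil X \<bullet> a = a"
  by (simp add: cat_tm_def Let_def)

lemma cat_cons [simp]:
  "ok a \<Longrightarrow> ok x \<Longrightarrow> ok l \<Longrightarrow> ty_of a = Inf_seq X \<Longrightarrow> ty_of x = X \<Longrightarrow> ty_of l = Seq X \<Longrightarrow>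
    cls (cat_tm X) \<bullet> (cons X x l) \<bullet> a = cls (prefix_tm X) \<bullet> x \<bullet> (cls (cat_tm X) \<bullet> l \<bullet> a)"
  by (simp add: cat_tm_def Let_def)

lemma tail_app [simp]:
  "ok a \<Longrightarrow> ok n \<Longrightarrow> ty_of a = Inf_seq X \<Longrightarrow> ty_of n = Nat \<Longrightarrow> cls (tail_tm X) \<bullet> a \<bullet> n = a \<bullet> (suc n)"
  by (simp add: tail_tm_def Let_def)

lemma const_app [simp]:
  "ok r \<Longrightarrow> ok a \<Longrightarrow> ty_of r = R \<Longrightarrow> ty_of a = Inf_seq X \<Longrightarrow> cls (const_tm X R) \<bullet> r \<bullet> a = r"
  by (simp add: const_tm_def Let_def)

lemma shifts_app [simp]:
  "ok q \<Longrightarrow> ok l \<Longrightarrow> ok a \<Longrightarrow> ty_of q = Inf_seq X \<rightarrow>\<^sub>t R \<Longrightarrow> ty_of l = Seq X \<Longrightarrow> ty_of a = Inf_seq X \<Longrightarrow>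
    cls (shifts_tm X R) \<bullet> q \<bullet> l \<bullet> a = q \<bullet> (cls (cat_tm X) \<bullet> l \<bullet> a)"
  by (simp add: shifts_tm_def Let_def)

lemma after_app [simp]:
  "ok G \<Longrightarrow> ok q \<Longrightarrow> ok x \<Longrightarrow> ty_of G = (Inf_seq X \<rightarrow>\<^sub>t R) \<rightarrow>\<^sub>t U \<Longrightarrow> ty_of q = Inf_seq X \<rightarrow>\<^sub>t R \<Longrightarrow> ty_of x = X \<Longrightarrow>
    cls (after_tm X R U) \<bullet> G \<bullet> q \<bullet> x = G \<bullet> (cls (shift_tm X R) \<bullet> q \<bullet> x)"
  by (simp add: after_tm_def Let_def)

text \<open>As functions of \<open>l\<close>, both sides satisfy the recursion \<open>?f\<close>,
  which prefixes one letter to the previous value. Later inductions have the same shape: abstract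
  both sides, name the step, compare.\<close>

lemma cat_snoc:
  assumes "ok l" "ok y" "ok a" "ty_of l = Seq X" "ty_of y = X" "ty_of a = Inf_seq X"
  shows "cls (cat_tm X) \<bullet> (cls (snoc_tm X) \<bullet> l \<bullet> y) \<bullet> a = cls (cat_tm X) \<bullet> l \<bullet> (cls (prefix_tm X) \<bullet> y \<bullet> a)"
proof -
  let ?l = "Fv ''l'' (Seq X)" and ?y = "Fv ''y'' X" and ?a = "Fv ''a'' (Inf_seq X)" and ?x = "Fv ''x'' X"
    and ?r = "Fv ''r'' (Inf_seq X \<rightarrow>\<^sub>t Inf_seq X)"
  let ?A = "cls (lam ''y'' X (lam ''l'' (Seq X) (lam ''a'' (Inf_seq X)
      (cat_tm X \<cdot> (snoc_tm X \<cdot> ?l \<cdot> ?y) \<cdot> ?a))))"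
    and ?B = "cls (lam ''y'' X (lam ''l'' (Seq X) (lam ''a'' (Inf_seq X)
      (cat_tm X \<cdot> ?l \<cdot> (prefix_tm X \<cdot> ?y \<cdot> ?a)))))"
    and ?f = "cls (lam ''x'' X (lam ''l'' (Seq X) (lam ''r'' (Inf_seq X \<rightarrow>\<^sub>t Inf_seq X) (lam ''a'' (Inf_seq X)
      (prefix_tm X \<cdot> ?x \<cdot> (?r \<cdot> ?a))))))"
  have "?A \<bullet> y = ?B \<bullet> y"
    by (rule seq_rec_unique[of _ _ ?f X "Inf_seq X \<rightarrow>\<^sub>t Inf_seq X"];
      (rule ext_cls[where U = "Inf_seq X"])?) (simp_all add: assms)
  then have "?A \<bullet> y \<bullet> l \<bullet> a = ?B \<bullet> y \<bullet> l \<bullet> a" by simp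
  then show ?thesis using assms by simp
qed

text \<open>A degenerate recursion, whose step returns \<open>g\<close> at the successor whatever
  the previous value is.\<close>

lemma nat_cases:
  assumes "ok f" "ok g" "ty_of f = Nat \<rightarrow>\<^sub>t U" "ty_of g = Nat \<rightarrow>\<^sub>t U" "f \<bullet> zero = g \<bullet> zero"
    and "\<And>n. ok n \<Longrightarrow> ty_of n = Nat \<Longrightarrow> f \<bullet> (suc n) = g \<bullet> (suc n)"
  shows "f = g"
proof -
  let ?f = "cls (lam ''g'' (Nat \<rightarrow>\<^sub>t U) (lam ''n'' Nat (lam ''r'' U
    (Fv ''g'' (Nat \<rightarrow>\<^sub>t U) \<cdot> (Cn Suc\<^sub>c \<cdot> Fv ''n'' Nat)))))"
  show ?thesis
    by (rule nat_rec_unique[of f g "?f \<bullet> g" U]) (simp_all add: assms)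
qed

lemma prefix_head_tail:
  assumes "ok a" "ty_of a = Inf_seq X"
  shows "cls (prefix_tm X) \<bullet> (a \<bullet> zero) \<bullet> (cls (tail_tm X) \<bullet> a) = a"
  by (rule nat_cases[of _ _ X]) (simp_all add: assms)

lemma tail_prefix [simp]:
  "ok x \<Longrightarrow> ok a \<Longrightarrow> ty_of x = X \<Longrightarrow> ty_of a = Inf_seq X \<Longrightarrow>
    cls (tail_tm X) \<bullet> (cls (prefix_tm X) \<bullet> x \<bullet> a) = a"
  by (rule ext_cls[where U = Nat]) simp_all

text \<open>Initial segments grow on the right, whereas concatenation recurses on its left argument
  from the front. This equation converts between the two.\<close>

lemma initial_prefix:
  assumes "ok y" "ok a" "ok n" "ty_of y = X" "ty_of a = Inf_seq X" "ty_of n = Nat"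
  shows "cls (initial_tm X) \<bullet> (cls (prefix_tm X) \<bullet> y \<bullet> a) \<bullet> (suc n) = cons X y (cls (initial_tm X) \<bullet> a \<bullet> n)"
proof -
  let ?y = "Fv ''y'' X" and ?a = "Fv ''a'' (Inf_seq X)" and ?n = "Fv ''n'' Nat" and ?r = "Fv ''r'' (Seq X)"
  let ?A = "cls (lam ''y'' X (lam ''a'' (Inf_seq X) (lam ''n'' Nat
      (initial_tm X \<cdot> (prefix_tm X \<cdot> ?y \<cdot> ?a) \<cdot> (Cn Suc\<^sub>c \<cdot> ?n)))))"
    and ?B = "cls (lam ''y'' X (lam ''a'' (Inf_seq X) (lam ''n'' Nat
      (Cn (Cons\<^sub>c X) \<cdot> ?y \<cdot> (initial_tm X \<cdot> ?a \<cdot> ?n)))))"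
    and ?f = "cls (lam ''a'' (Inf_seq X) (lam ''n'' Nat (lam ''r'' (Seq X)
      (snoc_tm X \<cdot> ?r \<cdot> (?a \<cdot> ?n)))))"
  have "?A \<bullet> y \<bullet> a = ?B \<bullet> y \<bullet> a"
    by (rule nat_rec_unique[of _ _ "?f \<bullet> a" "Seq X"]) (simp_all add: assms initial_suc)
  then have "?A \<bullet> y \<bullet> a \<bullet> n = ?B \<bullet> y \<bullet> a \<bullet> n" by simp
  then show ?thesis using assms by simp
qed

lemma initial_suc_tail:
  assumes "ok a" "ok n" "ty_of a = Inf_seq X" "ty_of n = Nat"
  shows "cls (initial_tm X) \<bullet> a \<bullet> (suc n) = cons X (a \<bullet> zero) (cls (initial_tm X) \<bullet> (cls (tail_tm X) \<bullet> a) \<bullet> n)"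
  using initial_prefix[of "a \<bullet> zero" "cls (tail_tm X) \<bullet> a" n X] assms prefix_head_tail[of a X] by simp

text \<open>Each step passes from \<open>a\<close> to its tail, so the recursion on \<open>n\<close>
  has functions of \<open>a\<close> as values.\<close>

lemma initial_cat_initial:
  assumes "ok a" "ok g" "ok n" "ty_of a = Inf_seq X" "ty_of g = Inf_seq X" "ty_of n = Nat"
  shows "cls (initial_tm X) \<bullet> (cls (cat_tm X) \<bullet> (cls (initial_tm X) \<bullet> a \<bullet> n) \<bullet> g) \<bullet> n =
    cls (initial_tm X) \<bullet> a \<bullet> n"
proof -
  let ?g = "Fv ''g'' (Inf_seq X)" and ?a = "Fv ''a'' (Inf_seq X)" and ?n = "Fv ''n'' Nat"
    and ?r = "Fv ''r'' (Inf_seq X \<rightarrow>\<^sub>t Seq X)"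
  let ?A = "cls (lam ''g'' (Inf_seq X) (lam ''n'' Nat (lam ''a'' (Inf_seq X)
      (initial_tm X \<cdot> (cat_tm X \<cdot> (initial_tm X \<cdot> ?a \<cdot> ?n) \<cdot> ?g) \<cdot> ?n))))"
    and ?B = "cls (lam ''n'' Nat (lam ''a'' (Inf_seq X) (initial_tm X \<cdot> ?a \<cdot> ?n)))"
    and ?f = "cls (lam ''n'' Nat (lam ''r'' (Inf_seq X \<rightarrow>\<^sub>t Seq X) (lam ''a'' (Inf_seq X)
      (Cn (Cons\<^sub>c X) \<cdot> (?a \<cdot> Cn Zero\<^sub>c) \<cdot> (?r \<cdot> (tail_tm X \<cdot> ?a))))))"
  have "?A \<bullet> g = ?B"
    by (rule nat_rec_unique[of _ _ ?f "Inf_seq X \<rightarrow>\<^sub>t Seq X"];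
      (rule ext_cls[where U = "Inf_seq X"])?) (simp_all add: assms initial_suc_tail)
  then have "?A \<bullet> g \<bullet> n \<bullet> a = ?B \<bullet> n \<bullet> a" by simp
  then show ?thesis using assms by simp
qed

lemma shifts_nil:
  "ok q \<Longrightarrow> ty_of q = Inf_seq X \<rightarrow>\<^sub>t R \<Longrightarrow> cls (shifts_tm X R) \<bullet> q \<bullet> nil X = q"
  by (rule ext_cls[where U = "Inf_seq X"]) simp_all

lemma shifts_snoc:
  "ok q \<Longrightarrow> ok l \<Longrightarrow> ok y \<Longrightarrow> ty_of q = Inf_seq X \<rightarrow>\<^sub>t R \<Longrightarrow> ty_of l = Seq X \<Longrightarrow> ty_of y = X \<Longrightarrow>
    cls (shifts_tm X R) \<bullet> q \<bullet> (cls (snoc_tm X) \<bullet> l \<bullet> y) =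
    cls (shift_tm X R) \<bullet> (cls (shifts_tm X R) \<bullet> q \<bullet> l) \<bullet> y"
  by (rule ext_cls[where U = "Inf_seq X"]) (simp_all add: cat_snoc)

text \<open>Every \<open>[a](n) * b\<close> agrees with \<open>a\<close> up to \<open>n\<close>, so
  a modulus \<open>n\<close> of \<open>q\<close> at \<open>a\<close> makes \<open>q\<close> constant
  after \<open>[a](n)\<close>. In this form \<open>CONT\<close> supplies the bar.\<close>

lemma shifts_initial_const:
  assumes C: "prov (All (Inf_seq X) (Eq (Seq X) (initial_tm X \<cdot> a \<cdot> n) (initial_tm X \<cdot> Bv 0 \<cdot> n) \<rightarrow>\<^sub>f
      Eq R (q \<cdot> a) (q \<cdot> Bv 0)))"
    and [simp]: "closed_wt a" "tyof [] a = Inf_seq X" "closed_wt n" "tyof [] n = Nat"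
      "closed_wt q" "tyof [] q = Inf_seq X \<rightarrow>\<^sub>t R"
  shows "prov (Eq (Inf_seq X \<rightarrow>\<^sub>t R) (shifts_tm X R \<cdot> q \<cdot> (initial_tm X \<cdot> a \<cdot> n)) (const_tm X R \<cdot> (q \<cdot> a)))"
proof -
  have "cls (shifts_tm X R \<cdot> q \<cdot> (initial_tm X \<cdot> a \<cdot> n)) = cls (const_tm X R \<cdot> (q \<cdot> a))"
  proof (rule ext_cls[where U = "Inf_seq X"])
    fix g assume "ok g" "ty_of g = Inf_seq X"
    then obtain b where g [simp]: "closed_wt b" "g = cls b" "tyof [] b = Inf_seq X" by (auto elim: okE)
    let ?b = "cat_tm X \<cdot> (initial_tm X \<cdot> a \<cdot> n) \<cdot> b"
    have "prov (Eq (Seq X) (initial_tm X \<cdot> a \<cdot> n) (initial_tm X \<cdot> ?b \<cdot> n))"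
      using initial_cat_initial[of "cls a" "cls b" "cls n" X] by (intro cls_eqD) (simp_all add: cls_app)
    moreover have "prov (Eq (Seq X) (initial_tm X \<cdot> a \<cdot> n) (initial_tm X \<cdot> ?b \<cdot> n) \<rightarrow>\<^sub>f
      Eq R (q \<cdot> a) (q \<cdot> ?b))"
      using provable.AllE[OF C, of ?b] by (simp add: has_type_iff)
    ultimately have "prov (Eq R (q \<cdot> a) (q \<cdot> ?b))" using provable.ImpE by blast
    from cls_eqI[OF this]
    show "cls (shifts_tm X R \<cdot> q \<cdot> (initial_tm X \<cdot> a \<cdot> n)) \<bullet> g = cls (const_tm X R \<cdot> (q \<cdot> a)) \<bullet> g"
      by (simp add: cls_app)
  qed simp_all
  then show ?thesis by (intro cls_eqD) simp_all
qed

text \<open>The hypothesis of a bar induction step is one equation for each \<open>x\<close>. By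
  extensionality it becomes a single equation between functions, which can be substituted into a
  recursion step.\<close>

lemma after_shifts_eq:
  assumes D: "prov (All X (S \<rightarrow>\<^sub>f Eq U (G \<cdot> (shifts_tm X R \<cdot> q \<cdot> (snoc_tm X \<cdot> s \<cdot> Bv 0)))
       (G' \<cdot> (shifts_tm X R \<cdot> q \<cdot> (snoc_tm X \<cdot> s \<cdot> Bv 0)))))" "prov S"
    and [simp]: "closed_wt G" "tyof [] G = (Inf_seq X \<rightarrow>\<^sub>t R) \<rightarrow>\<^sub>t U"
      "closed_wt G'" "tyof [] G' = (Inf_seq X \<rightarrow>\<^sub>t R) \<rightarrow>\<^sub>t U"
      "closed_wt q" "tyof [] q = Inf_seq X \<rightarrow>\<^sub>t R" "closed_wt s" "tyof [] s = Seq X"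
  shows "prov (Eq (X \<rightarrow>\<^sub>t U) (after_tm X R U \<cdot> G \<cdot> (shifts_tm X R \<cdot> q \<cdot> s))
     (after_tm X R U \<cdot> G' \<cdot> (shifts_tm X R \<cdot> q \<cdot> s)))"
proof -
  have "cls (after_tm X R U \<cdot> G \<cdot> (shifts_tm X R \<cdot> q \<cdot> s)) = cls (after_tm X R U \<cdot> G' \<cdot> (shifts_tm X R \<cdot> q \<cdot> s))"
  proof (rule ext_cls[where U = X])
    fix c assume "ok c" "ty_of c = X"
    then obtain x where x [simp]: "closed_wt x" "c = cls x" "tyof [] x = X" by (auto elim: okE)
    have S: "open_fm 0 x S = S" using provable_wff[OF D(2)] by (rule open_wff) simp
    let ?Q = "shifts_tm X R \<cdot> q \<cdot> (snoc_tm X \<cdot> s \<cdot> x)"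
    have "prov (S \<rightarrow>\<^sub>f Eq U (G \<cdot> ?Q) (G' \<cdot> ?Q))"
      using provable.AllE[OF D(1), of x] S by (simp add: has_type_iff)
    then have "prov (Eq U (G \<cdot> ?Q) (G' \<cdot> ?Q))" using D(2) by (rule provable.ImpE)
    from cls_eqI[OF this]
    show "cls (after_tm X R U \<cdot> G \<cdot> (shifts_tm X R \<cdot> q \<cdot> s)) \<bullet> c =
      cls (after_tm X R U \<cdot> G' \<cdot> (shifts_tm X R \<cdot> q \<cdot> s)) \<bullet> c"
      by (simp add: cls_app shifts_snoc)
  qed simp_all
  then show ?thesis by (intro cls_eqD) simp_all
qed

lemma CONT_instance:
  assumes "discrete_ty R"
    and [simp]: "closed_wt a" "tyof [] a = Inf_seq X" "closed_wt q" "tyof [] q = Inf_seq X \<rightarrow>\<^sub>t R"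
  shows "prov (Ex Nat (All (Inf_seq X) (Eq (Seq X) (initial_tm X \<cdot> a \<cdot> Bv 1) (initial_tm X \<cdot> Bv 0 \<cdot> Bv 1) \<rightarrow>\<^sub>f
      Eq R (q \<cdot> a) (q \<cdot> Bv 0))))"
proof -
  have "prov (CONT_fm X R)"
  proof (rule provable.Ax)
    show "CONT_fm X R \<in> theory_ax" using assms(1) by (auto simp: CONT_def)
    show "wff [] (CONT_fm X R)" by (simp add: CONT_fm_def has_type_iff)
  qed
  then have "prov (All (Inf_seq X \<rightarrow>\<^sub>t R) (All (Inf_seq X) (Ex Nat (All (Inf_seq X)
    (Eq (Seq X) (initial_tm X \<cdot> Bv 2 \<cdot> Bv 1) (initial_tm X \<cdot> Bv 0 \<cdot> Bv 1) \<rightarrow>\<^sub>f Eq R (Bv 3 \<cdot> Bv 2) (Bv 3 \<cdot> Bv 0))))))"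
    by (simp add: CONT_fm_def numeral_eq_Suc)
  from provable.AllE[OF this, of q]
  have "prov (All (Inf_seq X) (Ex Nat (All (Inf_seq X)
    (Eq (Seq X) (initial_tm X \<cdot> Bv 2 \<cdot> Bv 1) (initial_tm X \<cdot> Bv 0 \<cdot> Bv 1) \<rightarrow>\<^sub>f Eq R (q \<cdot> Bv 2) (q \<cdot> Bv 0)))))"
    by (simp add: has_type_iff numeral_eq_Suc)
  from provable.AllE[OF this, of a] show ?thesis
    by (simp add: has_type_iff numeral_eq_Suc)
qed

text \<open>The step for \<open>G'\<close> refers to \<open>G\<close>, so that the two sides may unfold differently; under the induction
  hypothesis \<open>G\<close> can be replaced by \<open>G'\<close> in both steps. The constant functionals are the bar, by \<open>CONT\<close>.\<close>

lemma bar_rec_unique: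
  assumes discrete: "discrete_ty R"
    and ok: "ok G" "ok G'" "ok \<Phi>" "ok \<Phi>'"
    and ty: "ty_of G = (Inf_seq X \<rightarrow>\<^sub>t R) \<rightarrow>\<^sub>t U" "ty_of G' = (Inf_seq X \<rightarrow>\<^sub>t R) \<rightarrow>\<^sub>t U"
      "ty_of \<Phi> = (Inf_seq X \<rightarrow>\<^sub>t R) \<rightarrow>\<^sub>t (X \<rightarrow>\<^sub>t U) \<rightarrow>\<^sub>t U" "ty_of \<Phi>' = (Inf_seq X \<rightarrow>\<^sub>t R) \<rightarrow>\<^sub>t (X \<rightarrow>\<^sub>t U) \<rightarrow>\<^sub>t U"
    and const: "\<And>r. ok r \<Longrightarrow> ty_of r = R \<Longrightarrow> G \<bullet> (cls (const_tm X R) \<bullet> r) = G' \<bullet> (cls (const_tm X R) \<bullet> r)"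
    and G: "\<And>q. ok q \<Longrightarrow> ty_of q = Inf_seq X \<rightarrow>\<^sub>t R \<Longrightarrow> G \<bullet> q = \<Phi> \<bullet> q \<bullet> (cls (after_tm X R U) \<bullet> G \<bullet> q)"
    and G': "\<And>q. ok q \<Longrightarrow> ty_of q = Inf_seq X \<rightarrow>\<^sub>t R \<Longrightarrow> G' \<bullet> q = \<Phi>' \<bullet> q \<bullet> (cls (after_tm X R U) \<bullet> G \<bullet> q)"
    and \<Phi>: "\<And>q. ok q \<Longrightarrow> ty_of q = Inf_seq X \<rightarrow>\<^sub>t R \<Longrightarrow>
      \<Phi> \<bullet> q \<bullet> (cls (after_tm X R U) \<bullet> G' \<bullet> q) = \<Phi>' \<bullet> q \<bullet> (cls (after_tm X R U) \<bullet> G' \<bullet> q)"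
  shows "G = G'"
proof (rule ext_cls[OF ok(1,2), where U = "Inf_seq X \<rightarrow>\<^sub>t R"])
  obtain g g' f f' where [simp]: "closed_wt g" "G = cls g" "closed_wt g'" "G' = cls g'"
    "closed_wt f" "\<Phi> = cls f" "closed_wt f'" "\<Phi>' = cls f'"
    using ok by (elim okE)
  have [simp]: "tyof \<Gamma> g = (Inf_seq X \<rightarrow>\<^sub>t R) \<rightarrow>\<^sub>t U" "tyof \<Gamma> g' = (Inf_seq X \<rightarrow>\<^sub>t R) \<rightarrow>\<^sub>t U"
    "tyof \<Gamma> f = (Inf_seq X \<rightarrow>\<^sub>t R) \<rightarrow>\<^sub>t (X \<rightarrow>\<^sub>t U) \<rightarrow>\<^sub>t U"
    "tyof \<Gamma> f' = (Inf_seq X \<rightarrow>\<^sub>t R) \<rightarrow>\<^sub>t (X \<rightarrow>\<^sub>t U) \<rightarrow>\<^sub>t U" for \<Gamma>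
    using ty by (simp_all add: tyof_closed[of _ \<Gamma>])
  fix Q assume "ok Q" "ty_of Q = Inf_seq X \<rightarrow>\<^sub>t R"
  then obtain q where q [simp]: "closed_wt q" "Q = cls q" and "tyof [] q = Inf_seq X \<rightarrow>\<^sub>t R" by (auto elim: okE)
  then have [simp]: "tyof \<Gamma> q = Inf_seq X \<rightarrow>\<^sub>t R" for \<Gamma> by (simp add: tyof_closed[of _ \<Gamma>])
  have "finite (fv_tm g \<union> fv_tm g' \<union> fv_tm q \<union> (\<Union>B\<in>H. fv_fm B))" using finite_H by simp
  from fresh_name[OF this] obtain z where z [simp]: "\<And>T. (z, T) \<notin> fv_tm g" "\<And>T. (z, T) \<notin> fv_tm g'"
    "\<And>T. (z, T) \<notin> fv_tm q" and zH: "\<And>B T. B \<in> H \<Longrightarrow> (z, T) \<notin> fv_fm B" by auto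
  \<comment> \<open>All variables of the bar induction axiom get the name \<open>z\<close>; those of
    types \<open>X\<close> and \<open>Seq X\<close> are bound together and must be told apart by
    their types.\<close>
  have neq [simp]: "X \<noteq> Seq X" "Seq X \<noteq> X" by (induction X) auto
  \<comment> \<open>A provable equation as the relativising predicate: \<open>CONT\<close> reaches
    the bar along every infinite sequence.\<close>
  let ?S = "Eq Bool (Cn True\<^sub>c) (Cn True\<^sub>c)"
  let ?Q = "\<lambda>l. shifts_tm X R \<cdot> q \<cdot> l"
  let ?P = "\<lambda>l. Eq U (g \<cdot> ?Q l) (g' \<cdot> ?Q l)"
  let ?a = "Fv z (Inf_seq X)" and ?s = "Fv z (Seq X)" and ?x = "Fv z X"
  let ?bar = "Ex Nat (?P (initial_tm X \<cdot> ?a \<cdot> Bv 0))"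
    and ?step = "All X (?S \<rightarrow>\<^sub>f ?P (snoc_tm X \<cdot> ?s \<cdot> Bv 0))"
  have S: "prov ?S" by (rule provable.Refl) (simp add: has_type_iff)
  have BI: "prov (?S \<rightarrow>\<^sub>f all z (Inf_seq X) (All Nat ?S \<rightarrow>\<^sub>f ?bar) \<rightarrow>\<^sub>f
    all z (Seq X) (?S \<rightarrow>\<^sub>f ?step \<rightarrow>\<^sub>f ?P ?s) \<rightarrow>\<^sub>f ?P (Cn (Nil\<^sub>c X)))"
  proof (rule provable.Ax)
    have "BI_fm X z z z z ?S (?P ?s) \<in> theory_ax" unfolding BI_def
      by (rule UnI1, rule UnI2, intro CollectI exI conjI refl) auto
    then show "(?S \<rightarrow>\<^sub>f all z (Inf_seq X) (All Nat ?S \<rightarrow>\<^sub>f ?bar) \<rightarrow>\<^sub>f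
      all z (Seq X) (?S \<rightarrow>\<^sub>f ?step \<rightarrow>\<^sub>f ?P ?s) \<rightarrow>\<^sub>f ?P (Cn (Nil\<^sub>c X))) \<in> theory_ax"
      by (simp add: BI_fm_def)
  qed (simp add: has_type_iff)
  have bar: "prov ?bar"
  proof (rule provable_ExE_Imp[OF finite_H CONT_instance[OF discrete, of ?a X q]])
    fix n assume n [simp]: "closed_wt n" "tyof [] n = Nat"
    let ?C = "All (Inf_seq X) (Eq (Seq X) (initial_tm X \<cdot> ?a \<cdot> n) (initial_tm X \<cdot> Bv 0 \<cdot> n) \<rightarrow>\<^sub>f
      Eq R (q \<cdot> ?a) (q \<cdot> Bv 0))"
    let ?i = "initial_tm X \<cdot> ?a \<cdot> n"
    have tyn: "tyof \<Gamma> n = Nat" for \<Gamma> by (simp add: tyof_closed[of _ \<Gamma>])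
    have wC: "wff [] ?C" by (simp add: has_type_iff tyn)
    \<comment> \<open>A second term model, in which the continuity condition \<open>?C\<close> is a
      hypothesis; its equation returns to \<open>H\<close> as an implication through
      \<open>ImpI\<close>.\<close>
    interpret C: world "insert ?C H" using finite_H by unfold_locales simp
    have "prov (?C \<rightarrow>\<^sub>f Eq (Inf_seq X \<rightarrow>\<^sub>t R) (?Q ?i) (const_tm X R \<cdot> (q \<cdot> ?a)))"
      by (intro provable.ImpI C.shifts_initial_const provable.Hyp) (use wC in simp_all)
    moreover have "prov (Eq (Inf_seq X \<rightarrow>\<^sub>t R) (?Q ?i) (const_tm X R \<cdot> (q \<cdot> ?a)) \<rightarrow>\<^sub>f ?P ?i)"
    proof (rule provable_Eq_Imp)
      show "prov (Eq U (g \<cdot> (const_tm X R \<cdot> (q \<cdot> ?a))) (g' \<cdot> (const_tm X R \<cdot> (q \<cdot> ?a))))"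
        using const[of "cls q \<bullet> cls ?a"] by (intro cls_eqD) (simp_all add: cls_app)
    qed simp_all
    moreover have "prov (?P ?i \<rightarrow>\<^sub>f ?bar)"
    proof (rule provable.ImpI)
      have "wff [] (?P ?i)" by (simp add: has_type_iff tyn)
      then have "theory_ax; insert (?P ?i) H \<turnstile>\<^sub>i ?P ?i" by (auto intro: provable.Hyp)
      then show "theory_ax; insert (?P ?i) H \<turnstile>\<^sub>i ?bar"
        by (intro provable.ExI[of _ _ n]) (simp_all add: has_type_iff tyn)
    qed (simp add: has_type_iff tyn)
    ultimately have "prov (?C \<rightarrow>\<^sub>f ?bar)" using provable_Imp_trans by blast
    then show "prov (open_fm 0 n (All (Inf_seq X) (Eq (Seq X) (initial_tm X \<cdot> ?a \<cdot> Bv 1)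
      (initial_tm X \<cdot> Bv 0 \<cdot> Bv 1) \<rightarrow>\<^sub>f Eq R (q \<cdot> ?a) (q \<cdot> Bv 0))) \<rightarrow>\<^sub>f ?bar)"
      by simp
  qed (simp_all add: has_type_iff)
  have step: "prov (?step \<rightarrow>\<^sub>f ?P ?s)"
  proof -
    let ?h = "\<lambda>g. after_tm X R U \<cdot> g \<cdot> ?Q ?s"
    have wD: "wff [] ?step" by (simp add: has_type_iff)
    interpret D: world "insert ?step H" using finite_H by unfold_locales simp
    have "prov (?step \<rightarrow>\<^sub>f Eq (X \<rightarrow>\<^sub>t U) (?h g) (?h g'))"
      by (intro provable.ImpI D.after_shifts_eq[where S = ?S] provable.Hyp provable.Refl)
        (use wD in \<open>simp_all add: has_type_iff\<close>)
    moreover have "prov (Eq (X \<rightarrow>\<^sub>t U) (?h g) (?h g') \<rightarrow>\<^sub>f Eq U (f \<cdot> ?Q ?s \<cdot> ?h g) (f' \<cdot> ?Q ?s \<cdot> ?h g))"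
    proof (rule provable_Eq_Imp)
      show "prov (Eq U (f \<cdot> ?Q ?s \<cdot> ?h g') (f' \<cdot> ?Q ?s \<cdot> ?h g'))"
        using \<Phi>[of "cls (?Q ?s)"] by (intro cls_eqD) (simp_all add: cls_app)
    qed simp_all
    ultimately have "prov (?step \<rightarrow>\<^sub>f Eq U (f \<cdot> ?Q ?s \<cdot> ?h g) (f' \<cdot> ?Q ?s \<cdot> ?h g))"
      using provable_Imp_trans by blast
    then show ?thesis
      using G[of "cls (?Q ?s)"] G'[of "cls (?Q ?s)"]
      by (elim provable_Imp_Eq_subst; intro cls_eqD) (simp_all add: cls_app)
  qed
  have "prov (all z (Inf_seq X) (All Nat ?S \<rightarrow>\<^sub>f ?bar))"
    by (intro provable.AllI provable_const_Imp bar) (use zH in \<open>simp_all add: has_type_iff\<close>)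
  moreover have "prov (all z (Seq X) (?S \<rightarrow>\<^sub>f ?step \<rightarrow>\<^sub>f ?P ?s))"
    by (intro provable.AllI provable_const_Imp step) (use zH in \<open>simp_all add: has_type_iff\<close>)
  ultimately have "prov (?P (Cn (Nil\<^sub>c X)))" using BI S provable.ImpE by blast
  from cls_eqI[OF this] show "G \<bullet> Q = G' \<bullet> Q" by (simp add: cls_app shifts_nil)
qed (simp_all add: ty)

end

section \<open>Definition of IPS from MBR\<close>

text \<open>An entry \<open>(s, l, x)\<close> stands for the nonempty sequence \<open>l * x\<close>; the position \<open>s\<close> reached after it is
  recorded as well.\<close>

abbreviation Entry :: "ty \<Rightarrow> ty" where
  "Entry X \<equiv> Seq X \<times>\<^sub>t Seq X \<times>\<^sub>t X"

abbreviation Sel :: "ty \<Rightarrow> ty \<Rightarrow> ty" where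
  "Sel X R \<equiv> Seq X \<rightarrow>\<^sub>t (X \<rightarrow>\<^sub>t R) \<rightarrow>\<^sub>t X"

abbreviation Out :: "ty \<Rightarrow> ty \<Rightarrow> ty" where
  "Out X R \<equiv> Entry X \<rightarrow>\<^sub>t R"

text \<open>The arguments are the start position and the history. Keeping them inside the value
  makes a single equation of this type cover every position and every history.\<close>

abbreviation Val :: "ty \<Rightarrow> ty \<Rightarrow> ty" where
  "Val X R \<equiv> Seq X \<rightarrow>\<^sub>t Seq (Entry X) \<rightarrow>\<^sub>t R"

section \<open>Entries, histories and flattening\<close>

definition entry_tm :: "ty \<Rightarrow> tm" where
  "entry_tm X =
    (let s = Fv ''s'' (Seq X); l = Fv ''l'' (Seq X); x = Fv ''x'' X
     in lam ''s'' (Seq X) (lam ''l'' (Seq X) (lam ''x'' X (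
       Cn (Pair\<^sub>c (Seq X) (Seq X \<times>\<^sub>t X)) \<cdot> s \<cdot> (Cn (Pair\<^sub>c (Seq X) X) \<cdot> l \<cdot> x)))))"

lemma entry_tm_closed [simp]: "closed_wt (entry_tm X)" "fv_tm (entry_tm X) = {}"
  "tyof \<Gamma> (entry_tm X) = Seq X \<rightarrow>\<^sub>t Seq X \<rightarrow>\<^sub>t X \<rightarrow>\<^sub>t Entry X"
  by (simp_all add: entry_tm_def Let_def)

definition pos_tm :: "ty \<Rightarrow> tm" where
  "pos_tm X =
    (let y = Fv ''y'' (Entry X)
     in lam ''y'' (Entry X) (
       Cn (Fst\<^sub>c (Seq X) (Seq X \<times>\<^sub>t X)) \<cdot> y))"

lemma pos_tm_closed [simp]: "closed_wt (pos_tm X)" "fv_tm (pos_tm X) = {}"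
  "tyof \<Gamma> (pos_tm X) = Entry X \<rightarrow>\<^sub>t Seq X"
  by (simp_all add: pos_tm_def Let_def)

definition init_tm :: "ty \<Rightarrow> tm" where
  "init_tm X =
    (let y = Fv ''y'' (Entry X)
     in lam ''y'' (Entry X) (
       Cn (Fst\<^sub>c (Seq X) X) \<cdot> (Cn (Snd\<^sub>c (Seq X) (Seq X \<times>\<^sub>t X)) \<cdot> y)))"

lemma init_tm_closed [simp]: "closed_wt (init_tm X)" "fv_tm (init_tm X) = {}"
  "tyof \<Gamma> (init_tm X) = Entry X \<rightarrow>\<^sub>t Seq X"
  by (simp_all add: init_tm_def Let_def)

definition last_tm :: "ty \<Rightarrow> tm" where
  "last_tm X =
    (let y = Fv ''y'' (Entry X)
     in lam ''y'' (Entry X) (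
       Cn (Snd\<^sub>c (Seq X) X) \<cdot> (Cn (Snd\<^sub>c (Seq X) (Seq X \<times>\<^sub>t X)) \<cdot> y)))"

lemma last_tm_closed [simp]: "closed_wt (last_tm X)" "fv_tm (last_tm X) = {}"
  "tyof \<Gamma> (last_tm X) = Entry X \<rightarrow>\<^sub>t X"
  by (simp_all add: last_tm_def Let_def)

text \<open>Turns the moves found by the control into entries of one letter each. Answers reach
  \<open>IPS\<close> through flattening, which reads letters, so the empty sequence is put in as
  position.\<close>

definition embed_tm :: "ty \<Rightarrow> tm" where
  "embed_tm X =
    (let a = Fv ''a'' (Inf_seq X); n = Fv ''n'' Nat
     in lam ''a'' (Inf_seq X) (lam ''n'' Nat (
       entry_tm X \<cdot> Cn (Nil\<^sub>c X) \<cdot> Cn (Nil\<^sub>c X) \<cdot> (a \<cdot> n))))"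

lemma embed_tm_closed [simp]: "closed_wt (embed_tm X)" "fv_tm (embed_tm X) = {}"
  "tyof \<Gamma> (embed_tm X) = Inf_seq X \<rightarrow>\<^sub>t Inf_seq (Entry X)"
  by (simp_all add: embed_tm_def Let_def)

text \<open>Each entry hands its position on as the default for the rest of the history. Thus the
  newest entry decides, and \<open>s\<close> is returned for the empty history.\<close>

definition current_tm :: "ty \<Rightarrow> tm" where
  "current_tm X =
    (let S = Fv ''S'' (Seq (Entry X)); s = Fv ''s'' (Seq X); y = Fv ''y'' (Entry X);
         r = Fv ''r'' (Seq X \<rightarrow>\<^sub>t Seq X)
     in lam ''S'' (Seq (Entry X)) (
       Cn (RecSeq\<^sub>c (Entry X) (Seq X \<rightarrow>\<^sub>t Seq X)) \<cdot> lam ''s'' (Seq X) (s)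
         \<cdot> lam ''y'' (Entry X) (lam ''t'' (Seq (Entry X)) (lam ''r'' (Seq X \<rightarrow>\<^sub>t Seq X)
             (lam ''s'' (Seq X) (r \<cdot> (pos_tm X \<cdot> y))))) \<cdot> S))"

lemma current_tm_closed [simp]: "closed_wt (current_tm X)" "fv_tm (current_tm X) = {}"
  "tyof \<Gamma> (current_tm X) = Seq (Entry X) \<rightarrow>\<^sub>t Seq X \<rightarrow>\<^sub>t Seq X"
  by (simp_all add: current_tm_def Let_def)

definition first_tm :: "ty \<Rightarrow> tm" where
  "first_tm X =
    (let y = Fv ''y'' (Entry X); c = Fv ''c'' X
     in lam ''y'' (Entry X) (
       Cn (RecSeq\<^sub>c X X) \<cdot> (last_tm X \<cdot> y) \<cdot> lam ''c'' X (lam ''t'' (Seq X) (lam ''r'' X c)) \<cdot> (init_tm X \<cdot> y)))"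

lemma first_tm_closed [simp]: "closed_wt (first_tm X)" "fv_tm (first_tm X) = {}"
  "tyof \<Gamma> (first_tm X) = Entry X \<rightarrow>\<^sub>t X"
  by (simp_all add: first_tm_def Let_def)

text \<open>Removes one letter from the flattening: the first entry is shortened while its initial
  part is nonempty, and dropped when its last letter is consumed.\<close>

definition advance_tm :: "ty \<Rightarrow> tm" where
  "advance_tm X =
    (let b = Fv ''b'' (Inf_seq (Entry X)); c = Fv ''c'' X; t = Fv ''t'' (Seq X)
     in lam ''b'' (Inf_seq (Entry X)) (
       Cn (RecSeq\<^sub>c X (Inf_seq (Entry X))) \<cdot> (tail_tm (Entry X) \<cdot> b)
         \<cdot> lam ''c'' X (lam ''t'' (Seq X) (lam ''r'' (Inf_seq (Entry X)) (prefix_tm (Entry X)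
             \<cdot> (entry_tm X \<cdot> (pos_tm X \<cdot> (b \<cdot> Cn Zero\<^sub>c)) \<cdot> t \<cdot> (last_tm X \<cdot> (b \<cdot> Cn Zero\<^sub>c)))
             \<cdot> (tail_tm (Entry X) \<cdot> b))))
         \<cdot> (init_tm X \<cdot> (b \<cdot> Cn Zero\<^sub>c))))"

lemma advance_tm_closed [simp]: "closed_wt (advance_tm X)" "fv_tm (advance_tm X) = {}"
  "tyof \<Gamma> (advance_tm X) = Inf_seq (Entry X) \<rightarrow>\<^sub>t Inf_seq (Entry X)"
  by (simp_all add: advance_tm_def Let_def)

text \<open>The recursion on \<open>n\<close> has functions of \<open>b\<close> as values, because
  each step continues with the advanced sequence.\<close>

definition flatten_tm :: "ty \<Rightarrow> tm" where
  "flatten_tm X =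
    (let b = Fv ''b'' (Inf_seq (Entry X)); n = Fv ''n'' Nat;
         r = Fv ''r'' (Inf_seq (Entry X) \<rightarrow>\<^sub>t X)
     in lam ''b'' (Inf_seq (Entry X)) (lam ''n'' Nat (
       Cn (Rec\<^sub>c (Inf_seq (Entry X) \<rightarrow>\<^sub>t X)) \<cdot> lam ''b'' (Inf_seq (Entry X)) (first_tm X \<cdot> (b \<cdot> Cn Zero\<^sub>c))
         \<cdot> lam ''n'' Nat (lam ''r'' (Inf_seq (Entry X) \<rightarrow>\<^sub>t X)
             (lam ''b'' (Inf_seq (Entry X)) (r \<cdot> (advance_tm X \<cdot> b)))) \<cdot> n \<cdot> b)))"

lemma flatten_tm_closed [simp]: "closed_wt (flatten_tm X)" "fv_tm (flatten_tm X) = {}"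
  "tyof \<Gamma> (flatten_tm X) = Inf_seq (Entry X) \<rightarrow>\<^sub>t Inf_seq X"
  by (simp_all add: flatten_tm_def Let_def)

text \<open>The passage from \<open>q\<close> to \<open>q'\<close> of the overview.\<close>

definition lift_tm :: "ty \<Rightarrow> ty \<Rightarrow> tm" where
  "lift_tm X R =
    (let q = Fv ''q'' (Inf_seq X \<rightarrow>\<^sub>t R); b = Fv ''b'' (Inf_seq (Entry X))
     in lam ''q'' (Inf_seq X \<rightarrow>\<^sub>t R) (lam ''b'' (Inf_seq (Entry X)) (
       q \<cdot> (flatten_tm X \<cdot> b))))"

lemma lift_tm_closed [simp]: "closed_wt (lift_tm X R)" "fv_tm (lift_tm X R) = {}"
  "tyof \<Gamma> (lift_tm X R) = (Inf_seq X \<rightarrow>\<^sub>t R) \<rightarrow>\<^sub>t Inf_seq (Entry X) \<rightarrow>\<^sub>t R"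
  by (simp_all add: lift_tm_def Let_def)

section \<open>The control of bar recursion\<close>

definition single_tm :: "ty \<Rightarrow> ty \<Rightarrow> tm" where
  "single_tm X R =
    (let p = Fv ''p'' (Out X R); s = Fv ''s'' (Seq X); x = Fv ''x'' X
     in lam ''p'' (Out X R) (lam ''s'' (Seq X) (lam ''x'' X (
       p \<cdot> (entry_tm X \<cdot> (snoc_tm X \<cdot> s \<cdot> x) \<cdot> Cn (Nil\<^sub>c X) \<cdot> x)))))"

lemma single_tm_closed [simp]: "closed_wt (single_tm X R)" "fv_tm (single_tm X R) = {}"
  "tyof \<Gamma> (single_tm X R) = Out X R \<rightarrow>\<^sub>t Seq X \<rightarrow>\<^sub>t X \<rightarrow>\<^sub>t R"
  by (simp_all add: single_tm_def Let_def)

text \<open>The \<open>p\<^sup>c\<close> of the overview. The recorded position is absolute and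
  stays, whereas the letters are counted from the start of the current play and therefore acquire
  \<open>c\<close>.\<close>

definition push_tm :: "ty \<Rightarrow> ty \<Rightarrow> tm" where
  "push_tm X R =
    (let p = Fv ''p'' (Out X R); c = Fv ''c'' X; y = Fv ''y'' (Entry X)
     in lam ''p'' (Out X R) (lam ''c'' X (lam ''y'' (Entry X) (
       p \<cdot> (entry_tm X \<cdot> (pos_tm X \<cdot> y) \<cdot> (Cn (Cons\<^sub>c X) \<cdot> c \<cdot> (init_tm X \<cdot> y)) \<cdot> (last_tm X \<cdot> y))))))"

lemma push_tm_closed [simp]: "closed_wt (push_tm X R)" "fv_tm (push_tm X R) = {}"
  "tyof \<Gamma> (push_tm X R) = Out X R \<rightarrow>\<^sub>t X \<rightarrow>\<^sub>t Out X R"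
  by (simp_all add: push_tm_def Let_def)

definition choice_tm :: "ty \<Rightarrow> ty \<Rightarrow> tm" where
  "choice_tm X R =
    (let e = Fv ''e'' (Sel X R); s = Fv ''s'' (Seq X); p = Fv ''p'' (Out X R)
     in lam ''e'' (Sel X R) (lam ''s'' (Seq X) (lam ''p'' (Out X R) (
       e \<cdot> s \<cdot> (single_tm X R \<cdot> p \<cdot> s)))))"

lemma choice_tm_closed [simp]: "closed_wt (choice_tm X R)" "fv_tm (choice_tm X R) = {}"
  "tyof \<Gamma> (choice_tm X R) = Sel X R \<rightarrow>\<^sub>t Seq X \<rightarrow>\<^sub>t Out X R \<rightarrow>\<^sub>t X"
  by (simp_all add: choice_tm_def Let_def)

definition unroll_step_tm :: "ty \<Rightarrow> ty \<Rightarrow> tm" where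
  "unroll_step_tm X R =
    (let e = Fv ''e'' (Sel X R);
         r = Fv ''r'' (Seq X \<rightarrow>\<^sub>t Out X R \<rightarrow>\<^sub>t X);
         s = Fv ''s'' (Seq X); p = Fv ''p'' (Out X R)
     in lam ''e'' (Sel X R) (lam ''n'' Nat (lam ''r'' (Seq X \<rightarrow>\<^sub>t Out X R \<rightarrow>\<^sub>t X) (lam ''s'' (Seq X)
         (lam ''p'' (Out X R) (
       r \<cdot> (snoc_tm X \<cdot> s \<cdot> (choice_tm X R \<cdot> e \<cdot> s \<cdot> p)) \<cdot> (push_tm X R \<cdot> p \<cdot> (choice_tm X R \<cdot> e \<cdot> s \<cdot> p))))))))"

lemma unroll_step_tm_closed [simp]: "closed_wt (unroll_step_tm X R)" "fv_tm (unroll_step_tm X R) = {}"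
  "tyof \<Gamma> (unroll_step_tm X R) = Sel X R \<rightarrow>\<^sub>t Nat \<rightarrow>\<^sub>t (Seq X \<rightarrow>\<^sub>t Out X R \<rightarrow>\<^sub>t X) \<rightarrow>\<^sub>t Seq X \<rightarrow>\<^sub>t Out X R \<rightarrow>\<^sub>t X"
  by (simp_all add: unroll_step_tm_def Let_def)

text \<open>Position and outcome function both change after every move, so the recursion on
  \<open>n\<close> has functions of the two as values.\<close>

definition unroll_tm :: "ty \<Rightarrow> ty \<Rightarrow> tm" where
  "unroll_tm X R =
    (let e = Fv ''e'' (Sel X R); s = Fv ''s'' (Seq X); p = Fv ''p'' (Out X R); n = Fv ''n'' Nat
     in lam ''e'' (Sel X R) (lam ''s'' (Seq X) (lam ''p'' (Out X R) (lam ''n'' Nat (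
       Cn (Rec\<^sub>c (Seq X \<rightarrow>\<^sub>t Out X R \<rightarrow>\<^sub>t X)) \<cdot> (choice_tm X R \<cdot> e) \<cdot> (unroll_step_tm X R \<cdot> e) \<cdot> n \<cdot> s \<cdot> p)))))"

lemma unroll_tm_closed [simp]: "closed_wt (unroll_tm X R)" "fv_tm (unroll_tm X R) = {}"
  "tyof \<Gamma> (unroll_tm X R) = Sel X R \<rightarrow>\<^sub>t Seq X \<rightarrow>\<^sub>t Out X R \<rightarrow>\<^sub>t Inf_seq X"
  by (simp_all add: unroll_tm_def Let_def)

text \<open>The \<open>\<nu>\<close> of the overview. A history enters only through the position it
  reaches, which is what makes it plausible that play may be restarted there.\<close>

definition control_tm :: "ty \<Rightarrow> ty \<Rightarrow> tm" where
  "control_tm X R =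
    (let e = Fv ''e'' (Sel X R); s = Fv ''s'' (Seq X); S = Fv ''S'' (Seq (Entry X));
         p = Fv ''p'' (Out X R)
     in lam ''e'' (Sel X R) (lam ''s'' (Seq X) (lam ''S'' (Seq (Entry X)) (lam ''p'' (Out X R) (
       embed_tm X \<cdot> (unroll_tm X R \<cdot> e \<cdot> (current_tm X \<cdot> S \<cdot> s) \<cdot> p))))))"

lemma control_tm_closed [simp]: "closed_wt (control_tm X R)" "fv_tm (control_tm X R) = {}"
  "tyof \<Gamma> (control_tm X R) = Sel X R \<rightarrow>\<^sub>t Seq X \<rightarrow>\<^sub>t Seq (Entry X) \<rightarrow>\<^sub>t Out X R \<rightarrow>\<^sub>t Inf_seq (Entry X)"
  by (simp_all add: control_tm_def Let_def)

definition IPS_tm :: "ty \<Rightarrow> ty \<Rightarrow> tm" where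
  "IPS_tm X R =
    (let F = Fv ''F'' (MBR_ty (Entry X) R); s = Fv ''s'' (Seq X); e = Fv ''e'' (Sel X R);
         q = Fv ''q'' (Inf_seq X \<rightarrow>\<^sub>t R)
     in lam ''F'' (MBR_ty (Entry X) R) (lam ''s'' (Seq X) (lam ''e'' (Sel X R) (lam ''q'' (Inf_seq X \<rightarrow>\<^sub>t R) (
       flatten_tm X \<cdot> (F \<cdot> Cn (Nil\<^sub>c (Entry X)) \<cdot> (control_tm X R \<cdot> e \<cdot> s) \<cdot> (lift_tm X R \<cdot> q)))))))"

lemma IPS_tm_closed [simp]: "closed_wt (IPS_tm X R)" "fv_tm (IPS_tm X R) = {}"
  "tyof \<Gamma> (IPS_tm X R) = MBR_ty (Entry X) R \<rightarrow>\<^sub>t IPS_ty X R"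
  by (simp_all add: IPS_tm_def Let_def MBR_ty_def IPS_ty_def)

text \<open>\<open>value\<close> plays on from the history \<open>S\<close>, \<open>base_value\<close> restarts at the position that \<open>S\<close> reaches.\<close>

definition response_tm :: "ty \<Rightarrow> ty \<Rightarrow> tm" where
  "response_tm Y R =
    (let F = Fv ''F'' (MBR_ty Y R); S = Fv ''S'' (Seq Y);
         v = Fv ''v'' (Seq Y \<rightarrow>\<^sub>t (Y \<rightarrow>\<^sub>t R) \<rightarrow>\<^sub>t Inf_seq Y);
         q = Fv ''q'' (Inf_seq Y \<rightarrow>\<^sub>t R); y = Fv ''y'' Y
     in lam ''F'' (MBR_ty Y R) (lam ''S'' (Seq Y) (lam ''v'' (Seq Y \<rightarrow>\<^sub>t (Y \<rightarrow>\<^sub>t R) \<rightarrow>\<^sub>t Inf_seq Y)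
         (lam ''q'' (Inf_seq Y \<rightarrow>\<^sub>t R) (lam ''y'' Y (
       shift_tm Y R \<cdot> q \<cdot> y \<cdot> (F \<cdot> (snoc_tm Y \<cdot> S \<cdot> y) \<cdot> v \<cdot> (shift_tm Y R \<cdot> q \<cdot> y))))))))"

lemma response_tm_closed [simp]: "closed_wt (response_tm Y R)" "fv_tm (response_tm Y R) = {}"
  "tyof \<Gamma> (response_tm Y R) = MBR_ty Y R \<rightarrow>\<^sub>t Seq Y \<rightarrow>\<^sub>t (Seq Y \<rightarrow>\<^sub>t (Y \<rightarrow>\<^sub>t R) \<rightarrow>\<^sub>t Inf_seq Y) \<rightarrow>\<^sub>t (Inf_seq Y \<rightarrow>\<^sub>t R) \<rightarrow>\<^sub>t Y \<rightarrow>\<^sub>t R"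
  by (simp_all add: response_tm_def Let_def MBR_ty_def)

text \<open>The \<open>p\<close> of the overview in restarted form: after the entry \<open>y\<close>
  the history is empty again and the control starts at the position of \<open>y\<close>. That this
  is what \<open>MBR\<close> really asks at the empty history has to be proved.\<close>

definition outcome_tm :: "ty \<Rightarrow> ty \<Rightarrow> tm" where
  "outcome_tm X R =
    (let F = Fv ''F'' (MBR_ty (Entry X) R); e = Fv ''e'' (Sel X R);
         q = Fv ''q'' (Inf_seq X \<rightarrow>\<^sub>t R); y = Fv ''y'' (Entry X)
     in lam ''F'' (MBR_ty (Entry X) R) (lam ''e'' (Sel X R) (lam ''q'' (Inf_seq X \<rightarrow>\<^sub>t R) (lam ''y'' (Entry X) (
       shift_tm (Entry X) R \<cdot> (lift_tm X R \<cdot> q) \<cdot> y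
         \<cdot> (F \<cdot> Cn (Nil\<^sub>c (Entry X)) \<cdot> (control_tm X R \<cdot> e \<cdot> (pos_tm X \<cdot> y))
            \<cdot> (shift_tm (Entry X) R \<cdot> (lift_tm X R \<cdot> q) \<cdot> y)))))))"

lemma outcome_tm_closed [simp]: "closed_wt (outcome_tm X R)" "fv_tm (outcome_tm X R) = {}"
  "tyof \<Gamma> (outcome_tm X R) = MBR_ty (Entry X) R \<rightarrow>\<^sub>t Sel X R \<rightarrow>\<^sub>t (Inf_seq X \<rightarrow>\<^sub>t R) \<rightarrow>\<^sub>t Out X R"
  by (simp_all add: outcome_tm_def Let_def MBR_ty_def)

definition value_tm :: "ty \<Rightarrow> ty \<Rightarrow> tm" where
  "value_tm X R =
    (let F = Fv ''F'' (MBR_ty (Entry X) R); e = Fv ''e'' (Sel X R);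
         q = Fv ''q'' (Inf_seq (Entry X) \<rightarrow>\<^sub>t R); s = Fv ''s'' (Seq X);
         S = Fv ''S'' (Seq (Entry X))
     in lam ''F'' (MBR_ty (Entry X) R) (lam ''e'' (Sel X R) (lam ''q'' (Inf_seq (Entry X) \<rightarrow>\<^sub>t R)
         (lam ''s'' (Seq X) (lam ''S'' (Seq (Entry X)) (
       q \<cdot> (F \<cdot> S \<cdot> (control_tm X R \<cdot> e \<cdot> s) \<cdot> q)))))))"

lemma value_tm_closed [simp]: "closed_wt (value_tm X R)" "fv_tm (value_tm X R) = {}"
  "tyof \<Gamma> (value_tm X R) = MBR_ty (Entry X) R \<rightarrow>\<^sub>t Sel X R \<rightarrow>\<^sub>t (Inf_seq (Entry X) \<rightarrow>\<^sub>t R) \<rightarrow>\<^sub>t Val X R"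
  by (simp_all add: value_tm_def Let_def MBR_ty_def)

definition base_value_tm :: "ty \<Rightarrow> ty \<Rightarrow> tm" where
  "base_value_tm X R =
    (let F = Fv ''F'' (MBR_ty (Entry X) R); e = Fv ''e'' (Sel X R);
         q = Fv ''q'' (Inf_seq (Entry X) \<rightarrow>\<^sub>t R); s = Fv ''s'' (Seq X);
         S = Fv ''S'' (Seq (Entry X))
     in lam ''F'' (MBR_ty (Entry X) R) (lam ''e'' (Sel X R) (lam ''q'' (Inf_seq (Entry X) \<rightarrow>\<^sub>t R)
         (lam ''s'' (Seq X) (lam ''S'' (Seq (Entry X)) (
       q \<cdot> (F \<cdot> Cn (Nil\<^sub>c (Entry X)) \<cdot> (control_tm X R \<cdot> e \<cdot> (current_tm X \<cdot> S \<cdot> s)) \<cdot> q)))))))"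

lemma base_value_tm_closed [simp]: "closed_wt (base_value_tm X R)" "fv_tm (base_value_tm X R) = {}"
  "tyof \<Gamma> (base_value_tm X R) = MBR_ty (Entry X) R \<rightarrow>\<^sub>t Sel X R \<rightarrow>\<^sub>t (Inf_seq (Entry X) \<rightarrow>\<^sub>t R) \<rightarrow>\<^sub>t Val X R"
  by (simp_all add: base_value_tm_def Let_def MBR_ty_def)

text \<open>Presents a family of values, one for each next entry, as the outcome function that the
  control receives at history \<open>S\<close>.\<close>

definition ask_tm :: "ty \<Rightarrow> ty \<Rightarrow> tm" where
  "ask_tm X R =
    (let h = Fv ''h'' (Entry X \<rightarrow>\<^sub>t Val X R); s = Fv ''s'' (Seq X);
         S = Fv ''S'' (Seq (Entry X)); y = Fv ''y'' (Entry X)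
     in lam ''h'' (Entry X \<rightarrow>\<^sub>t Val X R) (lam ''s'' (Seq X) (lam ''S'' (Seq (Entry X)) (lam ''y'' (Entry X) (
       h \<cdot> y \<cdot> s \<cdot> (snoc_tm (Entry X) \<cdot> S \<cdot> y))))))"

lemma ask_tm_closed [simp]: "closed_wt (ask_tm X R)" "fv_tm (ask_tm X R) = {}"
  "tyof \<Gamma> (ask_tm X R) = (Entry X \<rightarrow>\<^sub>t Val X R) \<rightarrow>\<^sub>t Seq X \<rightarrow>\<^sub>t Seq (Entry X) \<rightarrow>\<^sub>t Out X R"
  by (simp_all add: ask_tm_def Let_def)

definition value_step_tm :: "ty \<Rightarrow> ty \<Rightarrow> tm" where
  "value_step_tm X R =
    (let e = Fv ''e'' (Sel X R); q = Fv ''q'' (Inf_seq (Entry X) \<rightarrow>\<^sub>t R);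
         h = Fv ''h'' (Entry X \<rightarrow>\<^sub>t Val X R); s = Fv ''s'' (Seq X);
         S = Fv ''S'' (Seq (Entry X))
     in lam ''e'' (Sel X R) (lam ''q'' (Inf_seq (Entry X) \<rightarrow>\<^sub>t R) (lam ''h'' (Entry X \<rightarrow>\<^sub>t Val X R)
         (lam ''s'' (Seq X) (lam ''S'' (Seq (Entry X)) (
       q \<cdot> (control_tm X R \<cdot> e \<cdot> s \<cdot> S \<cdot> (ask_tm X R \<cdot> h \<cdot> s \<cdot> S))))))))"

lemma value_step_tm_closed [simp]: "closed_wt (value_step_tm X R)" "fv_tm (value_step_tm X R) = {}"
  "tyof \<Gamma> (value_step_tm X R) = Sel X R \<rightarrow>\<^sub>t (Inf_seq (Entry X) \<rightarrow>\<^sub>t R) \<rightarrow>\<^sub>t (Entry X \<rightarrow>\<^sub>t Val X R) \<rightarrow>\<^sub>t Val X R"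
  by (simp_all add: value_step_tm_def Let_def)

text \<open>Restarting moves the position of \<open>S\<close> into the start position and empties
  the history, so the next questions concern histories of length one.\<close>

definition base_value_step_tm :: "ty \<Rightarrow> ty \<Rightarrow> tm" where
  "base_value_step_tm X R =
    (let e = Fv ''e'' (Sel X R); q = Fv ''q'' (Inf_seq (Entry X) \<rightarrow>\<^sub>t R);
         h = Fv ''h'' (Entry X \<rightarrow>\<^sub>t Val X R); s = Fv ''s'' (Seq X);
         S = Fv ''S'' (Seq (Entry X))
     in lam ''e'' (Sel X R) (lam ''q'' (Inf_seq (Entry X) \<rightarrow>\<^sub>t R) (lam ''h'' (Entry X \<rightarrow>\<^sub>t Val X R)
         (lam ''s'' (Seq X) (lam ''S'' (Seq (Entry X)) (
       q \<cdot> (control_tm X R \<cdot> e \<cdot> (current_tm X \<cdot> S \<cdot> s) \<cdot> Cn (Nil\<^sub>c (Entry X))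
         \<cdot> (ask_tm X R \<cdot> h \<cdot> (current_tm X \<cdot> S \<cdot> s) \<cdot> Cn (Nil\<^sub>c (Entry X))))))))))"

lemma base_value_step_tm_closed [simp]: "closed_wt (base_value_step_tm X R)" "fv_tm (base_value_step_tm X R) = {}"
  "tyof \<Gamma> (base_value_step_tm X R) = Sel X R \<rightarrow>\<^sub>t (Inf_seq (Entry X) \<rightarrow>\<^sub>t R) \<rightarrow>\<^sub>t (Entry X \<rightarrow>\<^sub>t Val X R) \<rightarrow>\<^sub>t Val X R"
  by (simp_all add: base_value_step_tm_def Let_def)

section \<open>Computation rules of the constructed terms\<close>

context world begin

lemma entry_proj [simp]:
  assumes "ok s" "ok l" "ok x" "ty_of s = Seq X" "ty_of l = Seq X" "ty_of x = X"
  shows "cls (pos_tm X) \<bullet> (cls (entry_tm X) \<bullet> s \<bullet> l \<bullet> x) = s"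
    "cls (init_tm X) \<bullet> (cls (entry_tm X) \<bullet> s \<bullet> l \<bullet> x) = l"
    "cls (last_tm X) \<bullet> (cls (entry_tm X) \<bullet> s \<bullet> l \<bullet> x) = x"
  using assms by (simp_all add: entry_tm_def pos_tm_def init_tm_def last_tm_def Let_def)

lemma entry_eta [simp]:
  assumes "ok y" "ty_of y = Entry X"
  shows "cls (entry_tm X) \<bullet> (cls (pos_tm X) \<bullet> y) \<bullet> (cls (init_tm X) \<bullet> y) \<bullet> (cls (last_tm X) \<bullet> y) = y"
  using assms by (simp add: entry_tm_def pos_tm_def init_tm_def last_tm_def pair_eta Let_def)

lemma embed_app [simp]:
  "ok a \<Longrightarrow> ok n \<Longrightarrow> ty_of a = Inf_seq X \<Longrightarrow> ty_of n = Nat \<Longrightarrow>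
    cls (embed_tm X) \<bullet> a \<bullet> n = cls (entry_tm X) \<bullet> nil X \<bullet> nil X \<bullet> (a \<bullet> n)"
  by (simp add: embed_tm_def Let_def)

lemma current_nil [simp]:
  "ok s \<Longrightarrow> ty_of s = Seq X \<Longrightarrow> cls (current_tm X) \<bullet> nil (Entry X) \<bullet> s = s"
  by (simp add: current_tm_def Let_def)

lemma current_cons [simp]:
  "ok s \<Longrightarrow> ok y \<Longrightarrow> ok S \<Longrightarrow> ty_of s = Seq X \<Longrightarrow> ty_of y = Entry X \<Longrightarrow> ty_of S = Seq (Entry X) \<Longrightarrow>
    cls (current_tm X) \<bullet> (cons (Entry X) y S) \<bullet> s = cls (current_tm X) \<bullet> S \<bullet> (cls (pos_tm X) \<bullet> y)"
  by (simp add: current_tm_def Let_def)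

lemma current_snoc:
  assumes "ok s" "ok y" "ok S" "ty_of s = Seq X" "ty_of y = Entry X" "ty_of S = Seq (Entry X)"
  shows "cls (current_tm X) \<bullet> (cls (snoc_tm (Entry X)) \<bullet> S \<bullet> y) \<bullet> s = cls (pos_tm X) \<bullet> y"
proof -
  let ?S = "Fv ''S'' (Seq (Entry X))" and ?y = "Fv ''y'' (Entry X)" and ?s = "Fv ''s'' (Seq X)"
    and ?x = "Fv ''x'' (Entry X)" and ?r = "Fv ''r'' (Seq X \<rightarrow>\<^sub>t Seq X)"
  let ?A = "cls (lam ''y'' (Entry X) (lam ''S'' (Seq (Entry X)) (lam ''s'' (Seq X)
      (current_tm X \<cdot> (snoc_tm (Entry X) \<cdot> ?S \<cdot> ?y) \<cdot> ?s))))"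
    and ?B = "cls (lam ''y'' (Entry X) (lam ''S'' (Seq (Entry X)) (lam ''s'' (Seq X) (pos_tm X \<cdot> ?y))))"
    and ?f = "cls (lam ''x'' (Entry X) (lam ''S'' (Seq (Entry X)) (lam ''r'' (Seq X \<rightarrow>\<^sub>t Seq X)
      (lam ''s'' (Seq X) (?r \<cdot> (pos_tm X \<cdot> ?x))))))"
  have "?A \<bullet> y = ?B \<bullet> y"
    by (rule seq_rec_unique[of _ _ ?f "Entry X" "Seq X \<rightarrow>\<^sub>t Seq X"];
      (rule ext_cls[where U = "Seq X"])?) (simp_all add: assms)
  then have "?A \<bullet> y \<bullet> S \<bullet> s = ?B \<bullet> y \<bullet> S \<bullet> s" by simp
  then show ?thesis using assms by simp
qed

lemma first_nil [simp]:
  "ok s \<Longrightarrow> ok x \<Longrightarrow> ty_of s = Seq X \<Longrightarrow> ty_of x = X \<Longrightarrow>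
    cls (first_tm X) \<bullet> (cls (entry_tm X) \<bullet> s \<bullet> nil X \<bullet> x) = x"
  by (simp add: first_tm_def Let_def)

lemma first_cons [simp]:
  "ok s \<Longrightarrow> ok c \<Longrightarrow> ok l \<Longrightarrow> ok x \<Longrightarrow> ty_of s = Seq X \<Longrightarrow> ty_of c = X \<Longrightarrow> ty_of l = Seq X \<Longrightarrow> ty_of x = X \<Longrightarrow>
    cls (first_tm X) \<bullet> (cls (entry_tm X) \<bullet> s \<bullet> (cons X c l) \<bullet> x) = c"
  by (simp add: first_tm_def Let_def)

lemma advance_nil [simp]:
  "ok b \<Longrightarrow> ty_of b = Inf_seq (Entry X) \<Longrightarrow> cls (init_tm X) \<bullet> (b \<bullet> zero) = nil X \<Longrightarrow>
    cls (advance_tm X) \<bullet> b = cls (tail_tm (Entry X)) \<bullet> b"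
  by (simp add: advance_tm_def Let_def)

lemma advance_cons [simp]:
  "ok b \<Longrightarrow> ok s \<Longrightarrow> ok c \<Longrightarrow> ok l \<Longrightarrow> ok x \<Longrightarrow> ty_of b = Inf_seq (Entry X) \<Longrightarrow> ty_of s = Seq X \<Longrightarrow>
    ty_of c = X \<Longrightarrow> ty_of l = Seq X \<Longrightarrow> ty_of x = X \<Longrightarrow>
    cls (advance_tm X) \<bullet> (cls (prefix_tm (Entry X)) \<bullet> (cls (entry_tm X) \<bullet> s \<bullet> (cons X c l) \<bullet> x) \<bullet> b) =
    cls (prefix_tm (Entry X)) \<bullet> (cls (entry_tm X) \<bullet> s \<bullet> l \<bullet> x) \<bullet> b"
  by (simp add: advance_tm_def Let_def)

lemma flatten_zero [simp]:
  "ok b \<Longrightarrow> ty_of b = Inf_seq (Entry X) \<Longrightarrow>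
    cls (flatten_tm X) \<bullet> b \<bullet> zero = cls (first_tm X) \<bullet> (b \<bullet> zero)"
  by (simp add: flatten_tm_def Let_def)

lemma flatten_suc [simp]:
  "ok b \<Longrightarrow> ok n \<Longrightarrow> ty_of b = Inf_seq (Entry X) \<Longrightarrow> ty_of n = Nat \<Longrightarrow>
    cls (flatten_tm X) \<bullet> b \<bullet> (suc n) = cls (flatten_tm X) \<bullet> (cls (advance_tm X) \<bullet> b) \<bullet> n"
  by (simp add: flatten_tm_def Let_def)

lemma flatten_prefix_nil [simp]:
  assumes "ok b" "ok s" "ok x" "ty_of b = Inf_seq (Entry X)" "ty_of s = Seq X" "ty_of x = X"
  shows "cls (flatten_tm X) \<bullet> (cls (prefix_tm (Entry X)) \<bullet> (cls (entry_tm X) \<bullet> s \<bullet> nil X \<bullet> x) \<bullet> b) =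
    cls (prefix_tm X) \<bullet> x \<bullet> (cls (flatten_tm X) \<bullet> b)"
  by (rule nat_cases[of _ _ X]) (simp_all add: assms)

lemma flatten_prefix_cons [simp]:
  assumes "ok b" "ok s" "ok c" "ok l" "ok x"
    "ty_of b = Inf_seq (Entry X)" "ty_of s = Seq X" "ty_of c = X" "ty_of l = Seq X" "ty_of x = X"
  shows "cls (flatten_tm X) \<bullet> (cls (prefix_tm (Entry X)) \<bullet> (cls (entry_tm X) \<bullet> s \<bullet> (cons X c l) \<bullet> x) \<bullet> b) =
    cls (prefix_tm X) \<bullet> c \<bullet> (cls (flatten_tm X) \<bullet> (cls (prefix_tm (Entry X)) \<bullet> (cls (entry_tm X) \<bullet> s \<bullet> l \<bullet> x) \<bullet> b))"
  by (rule nat_cases[of _ _ X]) (simp_all add: assms)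

lemma tail_embed:
  assumes "ok a" "ty_of a = Inf_seq X"
  shows "cls (tail_tm (Entry X)) \<bullet> (cls (embed_tm X) \<bullet> a) = cls (embed_tm X) \<bullet> (cls (tail_tm X) \<bullet> a)"
  by (rule ext_cls[where U = Nat]) (simp_all add: assms)

text \<open>Embedded entries have an empty initial part, so advancing them is taking the tail. The
  sequence changes along the recursion and is carried as an argument of the values.\<close>

lemma flatten_embed [simp]:
  assumes "ok a" "ty_of a = Inf_seq X"
  shows "cls (flatten_tm X) \<bullet> (cls (embed_tm X) \<bullet> a) = a"
proof (rule ext_cls[where U = Nat])
  fix n assume n: "ok n" "ty_of n = Nat"
  let ?a = "Fv ''a'' (Inf_seq X)" and ?n = "Fv ''n'' Nat" and ?r = "Fv ''r'' (Inf_seq X \<rightarrow>\<^sub>t X)"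
  let ?A = "cls (lam ''n'' Nat (lam ''a'' (Inf_seq X) (flatten_tm X \<cdot> (embed_tm X \<cdot> ?a) \<cdot> ?n)))"
    and ?B = "cls (lam ''n'' Nat (lam ''a'' (Inf_seq X) (?a \<cdot> ?n)))"
    and ?f = "cls (lam ''n'' Nat (lam ''r'' (Inf_seq X \<rightarrow>\<^sub>t X) (lam ''a'' (Inf_seq X) (?r \<cdot> (tail_tm X \<cdot> ?a)))))"
  have "?A = ?B"
    by (rule nat_rec_unique[of _ _ ?f "Inf_seq X \<rightarrow>\<^sub>t X"];
      (rule ext_cls[where U = "Inf_seq X"])?) (simp_all add: tail_embed)
  then have "?A \<bullet> n \<bullet> a = ?B \<bullet> n \<bullet> a" by simp
  then show "cls (flatten_tm X) \<bullet> (cls (embed_tm X) \<bullet> a) \<bullet> n = a \<bullet> n" using assms n by simp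
qed (simp_all add: assms)

lemma lift_app [simp]:
  "ok q \<Longrightarrow> ok b \<Longrightarrow> ty_of q = Inf_seq X \<rightarrow>\<^sub>t R \<Longrightarrow> ty_of b = Inf_seq (Entry X) \<Longrightarrow>
    cls (lift_tm X R) \<bullet> q \<bullet> b = q \<bullet> (cls (flatten_tm X) \<bullet> b)"
  by (simp add: lift_tm_def Let_def)

lemma shift_lift_nil:
  assumes "ok q" "ok s" "ok x" "ty_of q = Inf_seq X \<rightarrow>\<^sub>t R" "ty_of s = Seq X" "ty_of x = X"
  shows "cls (shift_tm (Entry X) R) \<bullet> (cls (lift_tm X R) \<bullet> q) \<bullet> (cls (entry_tm X) \<bullet> s \<bullet> nil X \<bullet> x) =
    cls (lift_tm X R) \<bullet> (cls (shift_tm X R) \<bullet> q \<bullet> x)"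
  by (rule ext_cls[where U = "Inf_seq (Entry X)"]) (simp_all add: assms)

text \<open>The first letter of a longer entry can be absorbed into \<open>q\<close>, since both
  sides are equal after flattening. This is why pushing \<open>c\<close> on outcomes amounts to
  passing from \<open>q\<close> to \<open>q\<^sub>c\<close>.\<close>

lemma shift_lift_cons:
  assumes "ok q" "ok s" "ok c" "ok l" "ok x"
    "ty_of q = Inf_seq X \<rightarrow>\<^sub>t R" "ty_of s = Seq X" "ty_of c = X" "ty_of l = Seq X" "ty_of x = X"
  shows "cls (shift_tm (Entry X) R) \<bullet> (cls (lift_tm X R) \<bullet> q) \<bullet> (cls (entry_tm X) \<bullet> s \<bullet> (cons X c l) \<bullet> x) =
    cls (shift_tm (Entry X) R) \<bullet> (cls (lift_tm X R) \<bullet> (cls (shift_tm X R) \<bullet> q \<bullet> c)) \<bullet>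
      (cls (entry_tm X) \<bullet> s \<bullet> l \<bullet> x)"
  by (rule ext_cls[where U = "Inf_seq (Entry X)"]) (simp_all add: assms)

lemma single_app [simp]:
  "ok p \<Longrightarrow> ok s \<Longrightarrow> ok x \<Longrightarrow> ty_of p = Out X R \<Longrightarrow> ty_of s = Seq X \<Longrightarrow> ty_of x = X \<Longrightarrow>
    cls (single_tm X R) \<bullet> p \<bullet> s \<bullet> x = p \<bullet> (cls (entry_tm X) \<bullet> (cls (snoc_tm X) \<bullet> s \<bullet> x) \<bullet> nil X \<bullet> x)"
  by (simp add: single_tm_def Let_def)

lemma push_app [simp]:
  "ok p \<Longrightarrow> ok c \<Longrightarrow> ok y \<Longrightarrow> ty_of p = Out X R \<Longrightarrow> ty_of c = X \<Longrightarrow> ty_of y = Entry X \<Longrightarrow>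
    cls (push_tm X R) \<bullet> p \<bullet> c \<bullet> y = p \<bullet> (cls (entry_tm X) \<bullet> (cls (pos_tm X) \<bullet> y) \<bullet>
      (cons X c (cls (init_tm X) \<bullet> y)) \<bullet> (cls (last_tm X) \<bullet> y))"
  by (simp add: push_tm_def Let_def)

lemma choice_app:
  "ok e \<Longrightarrow> ok s \<Longrightarrow> ok p \<Longrightarrow> ty_of e = Sel X R \<Longrightarrow> ty_of s = Seq X \<Longrightarrow> ty_of p = Out X R \<Longrightarrow>
    cls (choice_tm X R) \<bullet> e \<bullet> s \<bullet> p = e \<bullet> s \<bullet> (cls (single_tm X R) \<bullet> p \<bullet> s)"
  by (simp add: choice_tm_def Let_def)

text \<open>The base of the recursion is the first move, and its step updates position and outcome
  function. Case distinction on the index gives an equation that already has the shape of the one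
  for \<open>IPS\<close>.\<close>

lemma unroll_eq:
  assumes "ok e" "ok s" "ok p"
    "ty_of e = Sel X R" "ty_of s = Seq X" "ty_of p = Out X R"
    and c: "c = cls (choice_tm X R) \<bullet> e \<bullet> s \<bullet> p"
  shows "cls (unroll_tm X R) \<bullet> e \<bullet> s \<bullet> p = cls (prefix_tm X) \<bullet> c \<bullet>
    (cls (unroll_tm X R) \<bullet> e \<bullet> (cls (snoc_tm X) \<bullet> s \<bullet> c) \<bullet> (cls (push_tm X R) \<bullet> p \<bullet> c))"
  by (rule nat_cases[of _ _ X]) (simp_all add: assms unroll_tm_def unroll_step_tm_def Let_def)

lemma control_app [simp]:
  "ok e \<Longrightarrow> ok s \<Longrightarrow> ok S \<Longrightarrow> ok p \<Longrightarrow> ty_of e = Sel X R \<Longrightarrow> ty_of s = Seq X \<Longrightarrow>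
    ty_of S = Seq (Entry X) \<Longrightarrow> ty_of p = Out X R \<Longrightarrow>
    cls (control_tm X R) \<bullet> e \<bullet> s \<bullet> S \<bullet> p =
      cls (embed_tm X) \<bullet> (cls (unroll_tm X R) \<bullet> e \<bullet> (cls (current_tm X) \<bullet> S \<bullet> s) \<bullet> p)"
  by (simp add: control_tm_def Let_def)

lemma response_app:
  "ok F \<Longrightarrow> ok S \<Longrightarrow> ok v \<Longrightarrow> ok q \<Longrightarrow> ok y \<Longrightarrow> ty_of F = MBR_ty Y R \<Longrightarrow> ty_of S = Seq Y \<Longrightarrow>
    ty_of v = Seq Y \<rightarrow>\<^sub>t (Y \<rightarrow>\<^sub>t R) \<rightarrow>\<^sub>t Inf_seq Y \<Longrightarrow> ty_of q = Inf_seq Y \<rightarrow>\<^sub>t R \<Longrightarrow> ty_of y = Y \<Longrightarrow>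
    cls (response_tm Y R) \<bullet> F \<bullet> S \<bullet> v \<bullet> q \<bullet> y = cls (shift_tm Y R) \<bullet> q \<bullet> y \<bullet>
      (F \<bullet> (cls (snoc_tm Y) \<bullet> S \<bullet> y) \<bullet> v \<bullet> (cls (shift_tm Y R) \<bullet> q \<bullet> y))"
  by (simp add: response_tm_def Let_def MBR_ty_def del: shift_app)

lemma outcome_app:
  "ok F \<Longrightarrow> ok e \<Longrightarrow> ok q \<Longrightarrow> ok y \<Longrightarrow> ty_of F = MBR_ty (Entry X) R \<Longrightarrow>
    ty_of e = Sel X R \<Longrightarrow> ty_of q = Inf_seq X \<rightarrow>\<^sub>t R \<Longrightarrow> ty_of y = Entry X \<Longrightarrow>
    cls (outcome_tm X R) \<bullet> F \<bullet> e \<bullet> q \<bullet> y = cls (shift_tm (Entry X) R) \<bullet> (cls (lift_tm X R) \<bullet> q) \<bullet> y \<bullet>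
      (F \<bullet> nil (Entry X) \<bullet> (cls (control_tm X R) \<bullet> e \<bullet> (cls (pos_tm X) \<bullet> y)) \<bullet>
        (cls (shift_tm (Entry X) R) \<bullet> (cls (lift_tm X R) \<bullet> q) \<bullet> y))"
  by (simp add: outcome_tm_def Let_def MBR_ty_def del: shift_app)

lemma value_app:
  "ok F \<Longrightarrow> ok e \<Longrightarrow> ok q \<Longrightarrow> ok s \<Longrightarrow> ok S \<Longrightarrow> ty_of F = MBR_ty (Entry X) R \<Longrightarrow>
    ty_of e = Sel X R \<Longrightarrow> ty_of q = Inf_seq (Entry X) \<rightarrow>\<^sub>t R \<Longrightarrow> ty_of s = Seq X \<Longrightarrow>
    ty_of S = Seq (Entry X) \<Longrightarrow>
    cls (value_tm X R) \<bullet> F \<bullet> e \<bullet> q \<bullet> s \<bullet> S = q \<bullet> (F \<bullet> S \<bullet> (cls (control_tm X R) \<bullet> e \<bullet> s) \<bullet> q)"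
  by (simp add: value_tm_def Let_def MBR_ty_def)

lemma base_value_app:
  "ok F \<Longrightarrow> ok e \<Longrightarrow> ok q \<Longrightarrow> ok s \<Longrightarrow> ok S \<Longrightarrow> ty_of F = MBR_ty (Entry X) R \<Longrightarrow>
    ty_of e = Sel X R \<Longrightarrow> ty_of q = Inf_seq (Entry X) \<rightarrow>\<^sub>t R \<Longrightarrow> ty_of s = Seq X \<Longrightarrow>
    ty_of S = Seq (Entry X) \<Longrightarrow>
    cls (base_value_tm X R) \<bullet> F \<bullet> e \<bullet> q \<bullet> s \<bullet> S =
      q \<bullet> (F \<bullet> nil (Entry X) \<bullet> (cls (control_tm X R) \<bullet> e \<bullet> (cls (current_tm X) \<bullet> S \<bullet> s)) \<bullet> q)"
  by (simp add: base_value_tm_def Let_def MBR_ty_def)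

lemma ask_app:
  "ok h \<Longrightarrow> ok s \<Longrightarrow> ok S \<Longrightarrow> ok y \<Longrightarrow> ty_of h = Entry X \<rightarrow>\<^sub>t Val X R \<Longrightarrow> ty_of s = Seq X \<Longrightarrow>
    ty_of S = Seq (Entry X) \<Longrightarrow> ty_of y = Entry X \<Longrightarrow>
    cls (ask_tm X R) \<bullet> h \<bullet> s \<bullet> S \<bullet> y = h \<bullet> y \<bullet> s \<bullet> (cls (snoc_tm (Entry X)) \<bullet> S \<bullet> y)"
  by (simp add: ask_tm_def Let_def)

lemma value_step_app:
  "ok e \<Longrightarrow> ok q \<Longrightarrow> ok h \<Longrightarrow> ok s \<Longrightarrow> ok S \<Longrightarrow> ty_of e = Sel X R \<Longrightarrow>
    ty_of q = Inf_seq (Entry X) \<rightarrow>\<^sub>t R \<Longrightarrow> ty_of h = Entry X \<rightarrow>\<^sub>t Val X R \<Longrightarrow> ty_of s = Seq X \<Longrightarrow>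
    ty_of S = Seq (Entry X) \<Longrightarrow>
    cls (value_step_tm X R) \<bullet> e \<bullet> q \<bullet> h \<bullet> s \<bullet> S =
      q \<bullet> (cls (control_tm X R) \<bullet> e \<bullet> s \<bullet> S \<bullet> (cls (ask_tm X R) \<bullet> h \<bullet> s \<bullet> S))"
  by (simp add: value_step_tm_def Let_def)

lemma base_value_step_app:
  "ok e \<Longrightarrow> ok q \<Longrightarrow> ok h \<Longrightarrow> ok s \<Longrightarrow> ok S \<Longrightarrow> ty_of e = Sel X R \<Longrightarrow>
    ty_of q = Inf_seq (Entry X) \<rightarrow>\<^sub>t R \<Longrightarrow> ty_of h = Entry X \<rightarrow>\<^sub>t Val X R \<Longrightarrow> ty_of s = Seq X \<Longrightarrow>
    ty_of S = Seq (Entry X) \<Longrightarrow> s' = cls (current_tm X) \<bullet> S \<bullet> s \<Longrightarrow>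
    cls (base_value_step_tm X R) \<bullet> e \<bullet> q \<bullet> h \<bullet> s \<bullet> S =
      q \<bullet> (cls (control_tm X R) \<bullet> e \<bullet> s' \<bullet> nil (Entry X) \<bullet> (cls (ask_tm X R) \<bullet> h \<bullet> s' \<bullet> nil (Entry X)))"
  by (simp add: base_value_step_tm_def Let_def)

lemma IPS_tm_app:
  "ok F \<Longrightarrow> ok s \<Longrightarrow> ok e \<Longrightarrow> ok q \<Longrightarrow> ty_of F = MBR_ty (Entry X) R \<Longrightarrow> ty_of s = Seq X \<Longrightarrow>
    ty_of e = Sel X R \<Longrightarrow> ty_of q = Inf_seq X \<rightarrow>\<^sub>t R \<Longrightarrow>
    cls (IPS_tm X R) \<bullet> F \<bullet> s \<bullet> e \<bullet> q =
      cls (flatten_tm X) \<bullet> (F \<bullet> nil (Entry X) \<bullet> (cls (control_tm X R) \<bullet> e \<bullet> s) \<bullet> (cls (lift_tm X R) \<bullet> q))"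
  by (simp add: IPS_tm_def Let_def MBR_ty_def)

end

section \<open>Correctness\<close>

text \<open>The abstraction in the equation of \<open>MBR\<close> is replaced by the closed term
  \<open>response_tm\<close>, so that the assumption is an equation of the model.\<close>

locale mbr_world = world +
  fixes F :: "ty \<times> tm set" and X R :: ty
  assumes discrete: "discrete_ty R"
    and ok_F [simp]: "ok F"
    and ty_F: "ty_of F = MBR_ty (Entry X) R"
    and MBR_eq: "ok S \<Longrightarrow> ok v \<Longrightarrow> ok q \<Longrightarrow> ty_of S = Seq (Entry X) \<Longrightarrow>
      ty_of v = Seq (Entry X) \<rightarrow>\<^sub>t Out X R \<rightarrow>\<^sub>t Inf_seq (Entry X) \<Longrightarrow> ty_of q = Inf_seq (Entry X) \<rightarrow>\<^sub>t R \<Longrightarrow>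
      F \<bullet> S \<bullet> v \<bullet> q = v \<bullet> S \<bullet> (cls (response_tm (Entry X) R) \<bullet> F \<bullet> S \<bullet> v \<bullet> q)"
begin

lemma ty_F_unfolded [simp]: "ty_of F = Seq (Entry X) \<rightarrow>\<^sub>t (Seq (Entry X) \<rightarrow>\<^sub>t Out X R \<rightarrow>\<^sub>t Inf_seq (Entry X)) \<rightarrow>\<^sub>t
    (Inf_seq (Entry X) \<rightarrow>\<^sub>t R) \<rightarrow>\<^sub>t Inf_seq (Entry X)"
  using ty_F by (simp add: MBR_ty_def)

declare MBR_ty_def [simp]

text \<open>Expresses the questions of \<open>MBR\<close> through \<open>after_tm\<close>, the form
  in which \<open>bar_rec_unique\<close> expects a recursion to refer to itself.\<close>

lemma response_eq_ask:
  assumes "ok e" "ok q" "ok s" "ok S" "ty_of e = Sel X R" "ty_of q = Inf_seq (Entry X) \<rightarrow>\<^sub>t R"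
    "ty_of s = Seq X" "ty_of S = Seq (Entry X)"
  shows "cls (response_tm (Entry X) R) \<bullet> F \<bullet> S \<bullet> (cls (control_tm X R) \<bullet> e \<bullet> s) \<bullet> q =
    cls (ask_tm X R) \<bullet> (cls (after_tm (Entry X) R (Val X R)) \<bullet> (cls (value_tm X R) \<bullet> F \<bullet> e) \<bullet> q) \<bullet> s \<bullet> S"
  by (rule ext_cls[where U = "Entry X"])
    (simp_all add: assms response_app ask_app value_app del: shift_app)

text \<open>Independence of the past. Both plays start from the same current position and differ
  only in the history, and after one more entry the position is that of this entry in either
  case.\<close>

lemma value_eq_base_value:
  assumes e: "ok e" "ty_of e = Sel X R"
  shows "cls (value_tm X R) \<bullet> F \<bullet> e = cls (base_value_tm X R) \<bullet> F \<bullet> e"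
proof (rule bar_rec_unique[OF discrete, where X = "Entry X" and U = "Val X R"
      and \<Phi> = "cls (value_step_tm X R) \<bullet> e" and \<Phi>' = "cls (base_value_step_tm X R) \<bullet> e"])
  \<comment> \<open>For constant \<open>q\<close> both values are that constant, whichever sequences
    \<open>MBR\<close> produces.\<close>
  fix r assume "ok r" "ty_of r = R"
  then show "cls (value_tm X R) \<bullet> F \<bullet> e \<bullet> (cls (const_tm (Entry X) R) \<bullet> r) =
    cls (base_value_tm X R) \<bullet> F \<bullet> e \<bullet> (cls (const_tm (Entry X) R) \<bullet> r)"
    by - (rule ext_cls2[where U = "Seq X" and V = "Seq (Entry X)" and T = R],
      simp_all add: e value_app base_value_app)
next
  fix q assume q: "ok q" "ty_of q = Inf_seq (Entry X) \<rightarrow>\<^sub>t R"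
  let ?h = "\<lambda>G. cls (after_tm (Entry X) R (Val X R)) \<bullet> G \<bullet> q"
  let ?G = "cls (value_tm X R) \<bullet> F \<bullet> e" and ?G' = "cls (base_value_tm X R) \<bullet> F \<bullet> e"
  show "?G \<bullet> q = cls (value_step_tm X R) \<bullet> e \<bullet> q \<bullet> ?h ?G"
    by (rule ext_cls2[where U = "Seq X" and V = "Seq (Entry X)" and T = R])
      (simp_all add: e q value_app value_step_app MBR_eq response_eq_ask)
  \<comment> \<open>The restarted play has the empty history, so \<open>MBR\<close> continues with
    histories of length one and not with another restart; hence \<open>?G\<close> on the
    right.\<close>
  show "?G' \<bullet> q = cls (base_value_step_tm X R) \<bullet> e \<bullet> q \<bullet> ?h ?G"
    by (rule ext_cls2[where U = "Seq X" and V = "Seq (Entry X)" and T = R])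
      (simp_all add: e q base_value_app base_value_step_app MBR_eq response_eq_ask)
  \<comment> \<open>Restarted values see only the position of the newest entry, and appending the
    same entry to \<open>S\<close> or to the empty history yields the same position.\<close>
  have ask: "cls (ask_tm X R) \<bullet> ?h ?G' \<bullet> s \<bullet> S =
      cls (ask_tm X R) \<bullet> ?h ?G' \<bullet> (cls (current_tm X) \<bullet> S \<bullet> s) \<bullet> nil (Entry X)"
    if "ok s" "ok S" "ty_of s = Seq X" "ty_of S = Seq (Entry X)" for s S
    by (rule ext_cls[where U = "Entry X"])
      (simp_all add: that e q ask_app base_value_app current_snoc del: shift_app)
  show "cls (value_step_tm X R) \<bullet> e \<bullet> q \<bullet> ?h ?G' = cls (base_value_step_tm X R) \<bullet> e \<bullet> q \<bullet> ?h ?G'"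
  proof (rule ext_cls2[where U = "Seq X" and V = "Seq (Entry X)" and T = R])
    fix s S assume *: "ok s" "ok S" "ty_of s = Seq X" "ty_of S = Seq (Entry X)"
    show "cls (value_step_tm X R) \<bullet> e \<bullet> q \<bullet> ?h ?G' \<bullet> s \<bullet> S =
      cls (base_value_step_tm X R) \<bullet> e \<bullet> q \<bullet> ?h ?G' \<bullet> s \<bullet> S"
      using ask[OF *] by (simp add: * e q value_step_app base_value_step_app)
  qed (simp_all add: e q)
qed (simp_all add: e)

text \<open>\<open>MBR\<close> evaluates each entry \<open>y\<close> at the history consisting of
  \<open>y\<close>. Independence of the past turns this into a restart at the position of
  \<open>y\<close>, and flattening undoes the embedding of the answer.\<close>

lemma IPS_tm_eq_unroll:
  assumes a: "ok s" "ok e" "ok q" "ty_of s = Seq X" "ty_of e = Sel X R"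
    "ty_of q = Inf_seq X \<rightarrow>\<^sub>t R"
  shows "cls (IPS_tm X R) \<bullet> F \<bullet> s \<bullet> e \<bullet> q =
    cls (unroll_tm X R) \<bullet> e \<bullet> s \<bullet> (cls (outcome_tm X R) \<bullet> F \<bullet> e \<bullet> q)"
proof -
  have "cls (response_tm (Entry X) R) \<bullet> F \<bullet> nil (Entry X) \<bullet> (cls (control_tm X R) \<bullet> e \<bullet> s) \<bullet>
      (cls (lift_tm X R) \<bullet> q) = cls (outcome_tm X R) \<bullet> F \<bullet> e \<bullet> q"
  proof (rule ext_cls[where U = "Entry X"])
    fix y assume y: "ok y" "ty_of y = Entry X"
    let ?Q = "cls (shift_tm (Entry X) R) \<bullet> (cls (lift_tm X R) \<bullet> q) \<bullet> y"
    have "cls (value_tm X R) \<bullet> F \<bullet> e \<bullet> ?Q \<bullet> s \<bullet> (cons (Entry X) y (nil (Entry X))) =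
      cls (base_value_tm X R) \<bullet> F \<bullet> e \<bullet> ?Q \<bullet> s \<bullet> (cons (Entry X) y (nil (Entry X)))"
      using value_eq_base_value[of e] a by simp
    then show "cls (response_tm (Entry X) R) \<bullet> F \<bullet> nil (Entry X) \<bullet> (cls (control_tm X R) \<bullet> e \<bullet> s) \<bullet>
        (cls (lift_tm X R) \<bullet> q) \<bullet> y = cls (outcome_tm X R) \<bullet> F \<bullet> e \<bullet> q \<bullet> y"
      by (simp add: a y response_app outcome_app value_app base_value_app del: shift_app)
  qed (simp_all add: a)
  then show ?thesis by (simp add: a IPS_tm_app MBR_eq)
qed

text \<open>Pushing a letter keeps the recorded position, hence the control of the restarted play;
  only \<open>q\<close> is shifted.\<close>

lemma push_outcome:
  assumes a: "ok c" "ok e" "ok q" "ty_of c = X" "ty_of e = Sel X R" "ty_of q = Inf_seq X \<rightarrow>\<^sub>t R"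
  shows "cls (push_tm X R) \<bullet> (cls (outcome_tm X R) \<bullet> F \<bullet> e \<bullet> q) \<bullet> c =
    cls (outcome_tm X R) \<bullet> F \<bullet> e \<bullet> (cls (shift_tm X R) \<bullet> q \<bullet> c)"
  by (rule ext_cls[where U = "Entry X"])
    (simp_all add: a outcome_app shift_lift_cons del: shift_app)

text \<open>The entry queried for a letter \<open>x\<close> records the position
  \<open>s * x\<close>, which is where the restarted play, and thus \<open>IPS\<close>,
  continues.\<close>

lemma single_outcome:
  assumes a: "ok s" "ok x" "ok e" "ok q" "ty_of s = Seq X" "ty_of x = X" "ty_of e = Sel X R"
    "ty_of q = Inf_seq X \<rightarrow>\<^sub>t R"
  shows "cls (single_tm X R) \<bullet> (cls (outcome_tm X R) \<bullet> F \<bullet> e \<bullet> q) \<bullet> s \<bullet> x =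
    cls (shift_tm X R) \<bullet> q \<bullet> x \<bullet>
      (cls (IPS_tm X R) \<bullet> F \<bullet> (cls (snoc_tm X) \<bullet> s \<bullet> x) \<bullet> e \<bullet> (cls (shift_tm X R) \<bullet> q \<bullet> x))"
  by (simp add: a outcome_app shift_lift_nil IPS_tm_app del: shift_app)

text \<open>\<open>p\<close> is given by its values so that the abstraction from the equation of
  \<open>IPS\<close> can be put in its place. Extensionality identifies it with the argument of the
  selection function in \<open>choice_tm\<close>.\<close>

lemma IPS_tm_eq:
  assumes a: "ok s" "ok e" "ok q" "ty_of s = Seq X" "ty_of e = Sel X R"
    "ty_of q = Inf_seq X \<rightarrow>\<^sub>t R"
    and c: "c = e \<bullet> s \<bullet> p"
    and p: "ok p" "ty_of p = X \<rightarrow>\<^sub>t R"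
      "\<And>x. ok x \<Longrightarrow> ty_of x = X \<Longrightarrow> p \<bullet> x = cls (shift_tm X R) \<bullet> q \<bullet> x \<bullet>
        (cls (IPS_tm X R) \<bullet> F \<bullet> (cls (snoc_tm X) \<bullet> s \<bullet> x) \<bullet> e \<bullet> (cls (shift_tm X R) \<bullet> q \<bullet> x))"
  shows "cls (IPS_tm X R) \<bullet> F \<bullet> s \<bullet> e \<bullet> q = cls (prefix_tm X) \<bullet> c \<bullet>
    (cls (IPS_tm X R) \<bullet> F \<bullet> (cls (snoc_tm X) \<bullet> s \<bullet> c) \<bullet> e \<bullet> (cls (shift_tm X R) \<bullet> q \<bullet> c))"
proof -
  let ?p = "cls (outcome_tm X R) \<bullet> F \<bullet> e \<bullet> q"
  have "cls (single_tm X R) \<bullet> ?p \<bullet> s = p"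
    by (rule ext_cls[where U = X]) (simp_all add: a p single_outcome del: shift_app single_app)
  then have "c = cls (choice_tm X R) \<bullet> e \<bullet> s \<bullet> ?p"
    by (simp add: a c choice_app)
  moreover have "ok c" "ty_of c = X" by (simp_all add: a c p)
  ultimately show ?thesis
    using unroll_eq[of e s ?p X R c] by (simp add: a IPS_tm_eq_unroll push_outcome)
qed

end

section \<open>Between equations of the model and derivable specifications\<close>

context world begin

lemma MBR_spec_model:
  assumes "discrete_ty R" and spec: "prov (MBR_spec (Entry X) R)"
  shows "mbr_world H (cls (Fv ''F'' (MBR_ty (Entry X) R))) X R"
proof -
  let ?Y = "Entry X"
  let ?F = "Fv ''F'' (MBR_ty ?Y R)"
  show ?thesis
  proof unfold_locales
    fix S v q
    assume "ok S" "ok v" "ok q" and ty: "ty_of S = Seq ?Y"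
      "ty_of v = Seq ?Y \<rightarrow>\<^sub>t (?Y \<rightarrow>\<^sub>t R) \<rightarrow>\<^sub>t Inf_seq ?Y" "ty_of q = Inf_seq ?Y \<rightarrow>\<^sub>t R"
    then obtain tS tv tq where [simp]: "closed_wt tS" "S = cls tS" "closed_wt tv" "v = cls tv"
      "closed_wt tq" "q = cls tq"
      by (elim okE)
    have [simp]: "tyof \<Gamma> tS = Seq ?Y" "tyof \<Gamma> tv = Seq ?Y \<rightarrow>\<^sub>t (?Y \<rightarrow>\<^sub>t R) \<rightarrow>\<^sub>t Inf_seq ?Y"
      "tyof \<Gamma> tq = Inf_seq ?Y \<rightarrow>\<^sub>t R" for \<Gamma>
      using ty by (simp_all add: tyof_closed[of _ \<Gamma>])
    let ?q = "\<lambda>q. shift_tm ?Y R \<cdot> q \<cdot> Bv 0"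
    let ?rhs = "\<lambda>S v q. v \<cdot> S \<cdot> Lam ?Y (?q q \<cdot> (?F \<cdot> (snoc_tm ?Y \<cdot> S \<cdot> Bv 0) \<cdot> v \<cdot> ?q q))"
    have "MBR_spec ?Y R = All (Seq ?Y) (All (Seq ?Y \<rightarrow>\<^sub>t (?Y \<rightarrow>\<^sub>t R) \<rightarrow>\<^sub>t Inf_seq ?Y) (All (Inf_seq ?Y \<rightarrow>\<^sub>t R)
      (Eq (Inf_seq ?Y) (?F \<cdot> Bv 2 \<cdot> Bv 1 \<cdot> Bv 0)
        (Bv 1 \<cdot> Bv 2 \<cdot> Lam ?Y (?q (Bv 1) \<cdot> (?F \<cdot> (snoc_tm ?Y \<cdot> Bv 3 \<cdot> Bv 0) \<cdot> Bv 2 \<cdot> ?q (Bv 1)))))))"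
      by (simp add: MBR_spec_def Let_def numeral_eq_Suc)
    from provable_AllE3[OF spec[unfolded this], of tS tv tq]
    have "prov (Eq (Inf_seq ?Y) (?F \<cdot> tS \<cdot> tv \<cdot> tq) (?rhs tS tv tq))"
      by (simp add: numeral_eq_Suc)
    from cls_eqI[OF this]
    have eq: "cls ?F \<bullet> S \<bullet> v \<bullet> q =
      v \<bullet> S \<bullet> cls (Lam ?Y (?q tq \<cdot> (?F \<cdot> (snoc_tm ?Y \<cdot> tS \<cdot> Bv 0) \<cdot> tv \<cdot> ?q tq)))"
      by (simp add: cls_app MBR_ty_def)
    \<comment> \<open>Extensionality replaces the abstraction in the specification by the closed
      term \<open>response_tm\<close>.\<close>
    have "cls (Lam ?Y (?q tq \<cdot> (?F \<cdot> (snoc_tm ?Y \<cdot> tS \<cdot> Bv 0) \<cdot> tv \<cdot> ?q tq))) =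
      cls (response_tm ?Y R) \<bullet> cls ?F \<bullet> S \<bullet> v \<bullet> q"
      by (rule ext_cls[where U = ?Y])
        (simp_all add: response_app MBR_ty_def del: shift_app)
    with eq show "cls ?F \<bullet> S \<bullet> v \<bullet> q = v \<bullet> S \<bullet> (cls (response_tm ?Y R) \<bullet> cls ?F \<bullet> S \<bullet> v \<bullet> q)" by simp
  qed (use assms in simp_all)
qed

lemma prov_IPS_spec:
  assumes "discrete_ty R" "prov (MBR_spec (Entry X) R)"
  shows "prov (subst_fm ''F'' (IPS_ty X R) (IPS_tm X R \<cdot> Fv ''F'' (MBR_ty (Entry X) R)) (IPS_spec X R))"
proof -
  let ?F = "Fv ''F'' (MBR_ty (Entry X) R)"
  interpret mbr_world H "cls ?F" X R using assms by (rule MBR_spec_model)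
  let ?I = "IPS_tm X R \<cdot> ?F"
  let ?q = "\<lambda>q. shift_tm X R \<cdot> q"
  let ?next = "\<lambda>s e q x. ?I \<cdot> (snoc_tm X \<cdot> s \<cdot> x) \<cdot> e \<cdot> (?q q \<cdot> x)"
  \<comment> \<open>The primed copies stand under the abstraction, where the bound indices are
    greater by one; for closed terms both copies coincide.\<close>
  let ?c = "\<lambda>s e q s' e' q'. e \<cdot> s \<cdot> Lam X (?q q' \<cdot> Bv 0 \<cdot> ?next s' e' q' (Bv 0))"
  let ?Te = "Sel X R"
  let ?E = "Eq (Inf_seq X) (?I \<cdot> Bv 2 \<cdot> Bv 1 \<cdot> Bv 0)
      (prefix_tm X \<cdot> ?c (Bv 2) (Bv 1) (Bv 0) (Bv 3) (Bv 2) (Bv 1) \<cdot>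
        ?next (Bv 2) (Bv 1) (Bv 0) (?c (Bv 2) (Bv 1) (Bv 0) (Bv 3) (Bv 2) (Bv 1)))"
  have "prov (All (Seq X) (All ?Te (All (Inf_seq X \<rightarrow>\<^sub>t R) ?E)))"
  proof (rule provable_AllI3[OF finite_H])
    fix s e q
    assume [simp]: "closed_wt s" "closed_wt e" "closed_wt q"
      and ty: "tyof [] s = Seq X" "tyof [] e = ?Te" "tyof [] q = Inf_seq X \<rightarrow>\<^sub>t R"
    then have [simp]: "tyof \<Gamma> s = Seq X" "tyof \<Gamma> e = ?Te" "tyof \<Gamma> q = Inf_seq X \<rightarrow>\<^sub>t R" for \<Gamma>
      by (simp_all add: tyof_closed[of _ \<Gamma>])
    let ?p = "cls (Lam X (?q q \<cdot> Bv 0 \<cdot> ?next s e q (Bv 0)))"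
    have "cls (IPS_tm X R) \<bullet> cls ?F \<bullet> cls s \<bullet> cls e \<bullet> cls q = cls (prefix_tm X) \<bullet> (cls e \<bullet> cls s \<bullet> ?p) \<bullet>
      (cls (IPS_tm X R) \<bullet> cls ?F \<bullet> (cls (snoc_tm X) \<bullet> cls s \<bullet> (cls e \<bullet> cls s \<bullet> ?p)) \<bullet> cls e \<bullet>
        (cls (shift_tm X R) \<bullet> cls q \<bullet> (cls e \<bullet> cls s \<bullet> ?p)))"
      by (rule IPS_tm_eq[where p = ?p]) (simp_all add: IPS_ty_def del: shift_app)
    then have "prov (Eq (Inf_seq X) (?I \<cdot> s \<cdot> e \<cdot> q) (prefix_tm X \<cdot> ?c s e q s e q \<cdot> ?next s e q (?c s e q s e q)))"
      by (intro cls_eqD) (simp_all add: cls_app IPS_ty_def)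
    then show "prov (open_fm 0 q (open_fm 1 e (open_fm 2 s ?E)))" by (simp add: numeral_eq_Suc)
  qed
  moreover have "subst_fm ''F'' (IPS_ty X R) ?I (IPS_spec X R) =
    All (Seq X) (All ?Te (All (Inf_seq X \<rightarrow>\<^sub>t R) ?E))"
    by (simp add: IPS_spec_def Let_def numeral_eq_Suc)
  ultimately show ?thesis by simp
qed

end

theorem theorem5p6: "MBR \<ge>\<^sub>T[HA_omega \<union> BI \<union> CONT] IPS"
  unfolding T_definable_def
proof (intro allI impI)
  fix X R assume "admissible IPS X R"
  then have disc: "discrete_ty R" by (simp add: IPS_def)
  let ?H = "{MBR_spec (Entry X) R}"
  interpret world ?H by unfold_locales simp
  have "prov (MBR_spec (Entry X) R)"
    by (rule provable.Hyp) (simp_all add: MBR_spec_def Let_def has_type_iff MBR_ty_def)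
  from prov_IPS_spec[OF disc this]
  show "\<exists>Y Q t. admissible MBR Y Q \<and>
      [] \<turnstile> t : ftype MBR Y Q \<rightarrow>\<^sub>t ftype IPS X R \<and> fv_tm t = {} \<and>
      HA_omega \<union> BI \<union> CONT; {spec MBR Y Q} \<turnstile>\<^sub>i
        subst_fm ''F'' (ftype IPS X R) (t \<cdot> Fv ''F'' (ftype MBR Y Q)) (spec IPS X R)"
    \<comment> \<open>\<open>MBR\<close> is taken at sequences of entries with the same
      \<open>R\<close>, so discreteness carries over.\<close>
    using disc by (intro exI[of _ "Entry X"] exI[of _ R] exI[of _ "IPS_tm X R"])
      (simp add: MBR_def IPS_def has_type_iff)
qed

end
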